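(* A concise tensor in $\mathbb C^m\otimes\mathbb C^m\otimes\mathbb C^m$ that is 111-abundant is isomorphic to a tensor $T_\varphi$ associated to a surjective homomorphism of $\mathcal A$-modules $$\varphi:N_1\otimes_{\mathcal A}N_2\to N_3,$$ where $\mathcal A$ is a commutative associative unital algebra, $N_1,N_2,N_3$ are $\mathcal A$-modules and $\dim N_1=\dim N_2=\dim N_3=m\le\dim\mathcal A$, and moreover for every nonzero $n_1\in N_1$ and every nonzero $n_2\in N_2$ the maps $\varphi(n_1\otimes_{\mathcal A}-):N_2\to N_3$ and $\varphi(-\otimes_{\mathcal A}n_2):N_1\to N_3$ are nonzero. Conversely, any such $T_\varphi$ is 111-abundant and concise.
   Context: All vector spaces and algebras are over $\mathbb C$. For an $\mathcal A$-module homomorphism $\varphi:N_1\otimes_{\mathcal A}N_2\to N_3$, the tensor $T_\varphi\in N_1^*\otimes N_2^*\otimes N_3$ is the one corresponding to the bilinear map $N_1\times N_2\to N_3$, $(n_1,n_2)\mapsto\varphi(n_1\otimes_{\mathcal A}n_2)$. Tensors $T\in A\otimes B\otimes C$ and $T'\in A'\otimes B'\otimes C'$ are isomorphic if there are linear isomorphisms $A\to A'$, $B\to B'$, $C\to C'$ carrying $T$ to $T'$. For $T\in A\otimes B\otimes C$ with $\dim A=\dim B=\dim C=m$, let $T(A^* )\subseteq B\otimes C$, $T(B^* )\subseteq A\otimes C$, $T(C^* )\subseteq A\otimes B$ be the images of the linear maps induced by $T$ on $A^*$, $B^*$, $C^*$; $T$ is concise if these three maps are injective, and 111-abundant if $\dim\big((T(A^*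 )\otimes A)\cap(T(B^* )\otimes B)\cap(T(C^* )\otimes C)\big)\ge m$, the intersection taken in $A\otimes B\otimes C$ with factors in the correct positions.
   Formalization: In the converse, 111-abundance is claimed only when no nonzero element of the algebra annihilates all three modules; without this the claim fails (cross product on C^3 with a 3-dimensional algebra acting through scalars). The forward direction also yields such a faithful action. *)

theory Defs
  imports
    "HOL-Algebra.Free_Abelian_Groups"
    "Jordan_Normal_Form.VS_Connect"
begin

text \<open>
  Vector spaces, algebras and modules are carrier-based records in the sense of HOL-Algebra.
  A \<open>\<complex>\<close>-vector space is a record of type \<open>(complex, 'v) module\<close> over the field
  \<open>class_ring\<close>; a commutative unital \<open>\<complex>\<close>-algebra \<open>A\<close> is such a record with
  \<open>algebra class_ring A\<close>; the same record, read as a ring, is the base ring of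
  \<open>A\<close>-modules \<open>N\<close> of type \<open>('a, 'n) module\<close>.
\<close>

abbreviation CC :: "complex ring" where
  "CC \<equiv> class_ring"

definition CC_space :: "(complex, complex) module" where
  "CC_space =
     \<lparr>carrier = UNIV, mult = (*), one = 1, zero = 0, add = (+), smult = (*)\<rparr>"

abbreviation Cvec :: "nat \<Rightarrow> (complex, complex vec) module" where
  "Cvec m \<equiv> module_vec TYPE(complex) m"


section \<open>The tensor product of modules over a commutative ring\<close>

text \<open>
  The tensor product is the free abelian group on the pairs, modulo the subgroup generated by the
  usual bilinearity and balancing relations.
\<close>

definition tensor_rels ::
  "('r, 'x) ring_scheme \<Rightarrow> ('r, 'm) module \<Rightarrow> ('r, 'n) module \<Rightarrow> (('m \<times> 'n) \<Rightarrow>\<^sub>0 int) set" where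
  "tensor_rels R M N =
     {frag_of (x \<oplus>\<^bsub>M\<^esub> x', y) - frag_of (x, y) - frag_of (x', y) | x x' y.
        x \<in> carrier M \<and> x' \<in> carrier M \<and> y \<in> carrier N} \<union>
     {frag_of (x, y \<oplus>\<^bsub>N\<^esub> y') - frag_of (x, y) - frag_of (x, y') | x y y'.
        x \<in> carrier M \<and> y \<in> carrier N \<and> y' \<in> carrier N} \<union>
     {frag_of (r \<odot>\<^bsub>M\<^esub> x, y) - frag_of (x, r \<odot>\<^bsub>N\<^esub> y) | r x y.
        r \<in> carrier R \<and> x \<in> carrier M \<and> y \<in> carrier N}"

definition tensor_kernel ::
  "('r, 'x) ring_scheme \<Rightarrow> ('r, 'm) module \<Rightarrow> ('r, 'n) module \<Rightarrow> (('m \<times> 'n) \<Rightarrow>\<^sub>0 int) set" where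
  "tensor_kernel R M N =
     generate (free_Abelian_group (carrier M \<times> carrier N)) (tensor_rels R M N)"

text \<open>The coset of a formal sum \<open>u\<close> of pairs.\<close>

definition tensor_class ::
  "('r, 'x) ring_scheme \<Rightarrow> ('r, 'm) module \<Rightarrow> ('r, 'n) module \<Rightarrow>
    (('m \<times> 'n) \<Rightarrow>\<^sub>0 int) \<Rightarrow> (('m \<times> 'n) \<Rightarrow>\<^sub>0 int) set" where
  "tensor_class R M N u =
     tensor_kernel R M N #>\<^bsub>free_Abelian_group (carrier M \<times> carrier N)\<^esub> u"

definition pure_tensor ::
  "('r, 'x) ring_scheme \<Rightarrow> ('r, 'm) module \<Rightarrow> ('r, 'n) module \<Rightarrow>
    'm \<Rightarrow> 'n \<Rightarrow> (('m \<times> 'n) \<Rightarrow>\<^sub>0 int) set" where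
  "pure_tensor R M N x y = tensor_class R M N (frag_of (x, y))"

text \<open>
  In \<open>smult\<close>, scaling the first component of every pair maps the relations to relations, so all
  representatives \<open>u\<close> of the coset \<open>X\<close> give the same coset and the union is that coset.
\<close>

definition tensor_product ::
  "('r, 'x) ring_scheme \<Rightarrow> ('r, 'm) module \<Rightarrow> ('r, 'n) module \<Rightarrow>
    ('r, (('m \<times> 'n) \<Rightarrow>\<^sub>0 int) set) module" where
  "tensor_product R M N =
     (let Q = free_Abelian_group (carrier M \<times> carrier N) Mod tensor_kernel R M N in
      \<lparr>carrier = carrier Q,
       mult = undefined,
       one = undefined,
       zero = \<one>\<^bsub>Q\<^esub>,
       add = (\<otimes>\<^bsub>Q\<^esub>),
       smult = (\<lambda>r X. \<Union>u\<in>X.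
         tensor_class R M N (frag_extend (\<lambda>(x, y). frag_of (r \<odot>\<^bsub>M\<^esub> x, y)) u))\<rparr>)"


section \<open>Tensors in three-fold tensor products of finite-dimensional vector spaces\<close>

definition dual_space :: "(complex, 'v) module \<Rightarrow> (complex, 'v \<Rightarrow> complex) module" where
  "dual_space V =
     (ring.func_space CC (carrier V))
       \<lparr>carrier := LinearCombinations.module_hom CC V CC_space \<inter> extensional (carrier V)\<rparr>"

text \<open>
  For finite-dimensional spaces, \<open>U \<otimes> V \<otimes> W\<close> is modelled by the space of trilinear forms on
  \<open>U\<^sup>* \<times> V\<^sup>* \<times> W\<^sup>*\<close>: the tensor \<open>u \<otimes> v \<otimes> w\<close> is the form
  \<open>(\<alpha>, \<beta>, \<gamma>) \<mapsto> \<alpha>(u) \<beta>(v) \<gamma>(w)\<close>.  Likewise \<open>V \<otimes> W\<close> is the space of bilinear forms on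
  \<open>V\<^sup>* \<times> W\<^sup>*\<close>.
\<close>

abbreviation dual_triples ::
  "(complex, 'u) module \<Rightarrow> (complex, 'v) module \<Rightarrow> (complex, 'w) module \<Rightarrow>
    (('u \<Rightarrow> complex) \<times> ('v \<Rightarrow> complex) \<times> ('w \<Rightarrow> complex)) set" where
  "dual_triples U V W \<equiv>
     carrier (dual_space U) \<times> carrier (dual_space V) \<times> carrier (dual_space W)"

definition tensor_space ::
  "(complex, 'u) module \<Rightarrow> (complex, 'v) module \<Rightarrow> (complex, 'w) module \<Rightarrow>
    (complex, ('u \<Rightarrow> complex) \<times> ('v \<Rightarrow> complex) \<times> ('w \<Rightarrow> complex) \<Rightarrow> complex) module" where
  "tensor_space U V W =
     (ring.func_space CC (dual_triples U V W))
       \<lparr>carrier := {t \<in> extensional (dual_triples U V W).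
          (\<forall>\<beta>\<in>carrier (dual_space V). \<forall>\<gamma>\<in>carrier (dual_space W).
             (\<lambda>\<alpha>. t (\<alpha>, \<beta>, \<gamma>)) \<in> LinearCombinations.module_hom CC (dual_space U) CC_space) \<and>
          (\<forall>\<alpha>\<in>carrier (dual_space U). \<forall>\<gamma>\<in>carrier (dual_space W).
             (\<lambda>\<beta>. t (\<alpha>, \<beta>, \<gamma>)) \<in> LinearCombinations.module_hom CC (dual_space V) CC_space) \<and>
          (\<forall>\<alpha>\<in>carrier (dual_space U). \<forall>\<beta>\<in>carrier (dual_space V).
             (\<lambda>\<gamma>. t (\<alpha>, \<beta>, \<gamma>)) \<in> LinearCombinations.module_hom CC (dual_space W) CC_space)}\<rparr>"

text \<open>
  The linear maps \<open>U\<^sup>* \<rightarrow> V \<otimes> W\<close>, \<open>V\<^sup>* \<rightarrow> U \<otimes> W\<close> and \<open>W\<^sup>* \<rightarrow> U \<otimes> V\<close>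
  induced by \<open>t \<in> U \<otimes> V \<otimes> W\<close>.
\<close>

definition contract1 where
  "contract1 (U :: (complex, 'u) module) (V :: (complex, 'v) module) (W :: (complex, 'w) module)
     (t :: ('u \<Rightarrow> complex) \<times> ('v \<Rightarrow> complex) \<times> ('w \<Rightarrow> complex) \<Rightarrow> complex) \<alpha> =
   (\<lambda>(\<beta>, \<gamma>)\<in>carrier (dual_space V) \<times> carrier (dual_space W). t (\<alpha>, \<beta>, \<gamma>))"

definition contract2 where
  "contract2 (U :: (complex, 'u) module) (V :: (complex, 'v) module) (W :: (complex, 'w) module)
     (t :: ('u \<Rightarrow> complex) \<times> ('v \<Rightarrow> complex) \<times> ('w \<Rightarrow> complex) \<Rightarrow> complex) \<beta> =
   (\<lambda>(\<alpha>, \<gamma>)\<in>carrier (dual_space U) \<times> carrier (dual_space W). t (\<alpha>, \<beta>, \<gamma>))"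

definition contract3 where
  "contract3 (U :: (complex, 'u) module) (V :: (complex, 'v) module) (W :: (complex, 'w) module)
     (t :: ('u \<Rightarrow> complex) \<times> ('v \<Rightarrow> complex) \<times> ('w \<Rightarrow> complex) \<Rightarrow> complex) \<gamma> =
   (\<lambda>(\<alpha>, \<beta>)\<in>carrier (dual_space U) \<times> carrier (dual_space V). t (\<alpha>, \<beta>, \<gamma>))"

definition concise where
  "concise (U :: (complex, 'u) module) (V :: (complex, 'v) module) (W :: (complex, 'w) module) t \<longleftrightarrow>
     inj_on (contract1 U V W t) (carrier (dual_space U)) \<and>
     inj_on (contract2 U V W t) (carrier (dual_space V)) \<and>
     inj_on (contract3 U V W t) (carrier (dual_space W))"

text \<open>
  \<open>image_tensor1 U V W t\<close> is \<open>t(U\<^sup>*) \<otimes> U\<close> inside \<open>U \<otimes> V \<otimes> W\<close>: the span of all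
  \<open>u \<otimes> s\<close> with \<open>u \<in> U\<close> and \<open>s \<in> t(U\<^sup>*) \<subseteq> V \<otimes> W\<close>, the factor from \<open>U\<close> being put
  in the first position; similarly for the other two.
\<close>

definition image_tensor1 where
  "image_tensor1 (U :: (complex, 'u) module) (V :: (complex, 'v) module)
     (W :: (complex, 'w) module) t =
   LinearCombinations.module.span CC (tensor_space U V W)
     {\<lambda>(\<alpha>, \<beta>, \<gamma>)\<in>dual_triples U V W. \<alpha> u * s (\<beta>, \<gamma>) | u s.
        u \<in> carrier U \<and> s \<in> contract1 U V W t ` carrier (dual_space U)}"

definition image_tensor2 where
  "image_tensor2 (U :: (complex, 'u) module) (V :: (complex, 'v) module)
     (W :: (complex, 'w) module) t =
   LinearCombinations.module.span CC (tensor_space U V W)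
     {\<lambda>(\<alpha>, \<beta>, \<gamma>)\<in>dual_triples U V W. \<beta> v * s (\<alpha>, \<gamma>) | v s.
        v \<in> carrier V \<and> s \<in> contract2 U V W t ` carrier (dual_space V)}"

definition image_tensor3 where
  "image_tensor3 (U :: (complex, 'u) module) (V :: (complex, 'v) module)
     (W :: (complex, 'w) module) t =
   LinearCombinations.module.span CC (tensor_space U V W)
     {\<lambda>(\<alpha>, \<beta>, \<gamma>)\<in>dual_triples U V W. \<gamma> w * s (\<alpha>, \<beta>) | w s.
        w \<in> carrier W \<and> s \<in> contract3 U V W t ` carrier (dual_space W)}"

text \<open>The parameter \<open>m\<close> is the common dimension of \<open>U\<close>, \<open>V\<close> and \<open>W\<close>.\<close>

definition abundant111 where
  "abundant111 m (U :: (complex, 'u) module) (V :: (complex, 'v) module)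
     (W :: (complex, 'w) module) t \<longleftrightarrow>
   m \<le> vectorspace.dim CC ((tensor_space U V W)
         \<lparr>carrier := image_tensor1 U V W t \<inter> image_tensor2 U V W t \<inter> image_tensor3 U V W t\<rparr>)"

definition linear_iso ::
  "(complex, 'u) module \<Rightarrow> (complex, 'v) module \<Rightarrow> ('u \<Rightarrow> 'v) \<Rightarrow> bool" where
  "linear_iso U V f \<longleftrightarrow>
     f \<in> LinearCombinations.module_hom CC U V \<and>
     bij_betw f (carrier U) (carrier V)"

text \<open>
  On trilinear forms, \<open>f \<otimes> g \<otimes> h\<close> acts by precomposition with the transposed maps.
\<close>

definition isomorphic_tensors where
  "isomorphic_tensors
     (U :: (complex, 'u) module) (V :: (complex, 'v) module) (W :: (complex, 'w) module) t
     (U' :: (complex, 'u1) module) (V' :: (complex, 'v1) module) (W' :: (complex, 'w1) module) t' \<longleftrightarrow>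
   (\<exists>f g h. linear_iso U U' f \<and> linear_iso V V' g \<and> linear_iso W W' h \<and>
      t' = (\<lambda>(\<alpha>, \<beta>, \<gamma>)\<in>dual_triples U' V' W'.
              t (compose (carrier U) \<alpha> f, compose (carrier V) \<beta> g, compose (carrier W) \<gamma> h)))"


section \<open>The tensor of a homomorphism from a tensor product of modules\<close>

definition evaluation ::
  "(complex, 'v) module \<Rightarrow> 'v \<Rightarrow> ('v \<Rightarrow> complex) \<Rightarrow> complex" where
  "evaluation V v = (\<lambda>\<alpha>\<in>carrier (dual_space V). \<alpha> v)"

text \<open>
  The tensor in \<open>U\<^sup>* \<otimes> V\<^sup>* \<otimes> W\<close> corresponding to a bilinear map \<open>f : U \<times> V \<rightarrow> W\<close> of
  finite-dimensional spaces.  Under this correspondence \<open>\<alpha> \<otimes> \<beta> \<otimes> w\<close> is the bilinear map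
  \<open>(u, v) \<mapsto> \<alpha>(u) \<beta>(v) w\<close>, and the trilinear form \<open>\<alpha> \<otimes> \<beta> \<otimes> w\<close> takes at
  \<open>(evaluation U u, evaluation V v, \<gamma>)\<close> the value \<open>\<alpha>(u) \<beta>(v) \<gamma>(w)\<close>.  The evaluations
  exhaust \<open>U\<^sup>*\<^sup>*\<close> and \<open>V\<^sup>*\<^sup>*\<close>, so there is exactly one such tensor.
\<close>

definition tensor_of_bilinear ::
  "(complex, 'u) module \<Rightarrow> (complex, 'v) module \<Rightarrow> (complex, 'w) module \<Rightarrow> ('u \<Rightarrow> 'v \<Rightarrow> 'w) \<Rightarrow>
    (('u \<Rightarrow> complex) \<Rightarrow> complex) \<times> (('v \<Rightarrow> complex) \<Rightarrow> complex) \<times> ('w \<Rightarrow> complex) \<Rightarrow> complex" where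
  "tensor_of_bilinear U V W f =
     (THE t. t \<in> carrier (tensor_space (dual_space U) (dual_space V) W) \<and>
        (\<forall>u\<in>carrier U. \<forall>v\<in>carrier V. \<forall>\<gamma>\<in>carrier (dual_space W).
           t (evaluation U u, evaluation V v, \<gamma>) = \<gamma> (f u v)))"

text \<open>An \<open>A\<close>-module as a complex vector space, along \<open>\<complex> \<rightarrow> A\<close>, \<open>c \<mapsto> c \<sqdot> 1\<close>.\<close>

definition restrict_scalars ::
  "(complex, 'a) module \<Rightarrow> ('a, 'n) module \<Rightarrow> (complex, 'n) module" where
  "restrict_scalars A N =
     \<lparr>carrier = carrier N, mult = mult N, one = one N, zero = zero N, add = add N,
      smult = (\<lambda>c x. (c \<odot>\<^bsub>A\<^esub> \<one>\<^bsub>A\<^esub>) \<odot>\<^bsub>N\<^esub> x)\<rparr>"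

abbreviation restricted_dual ::
  "(complex, 'a) module \<Rightarrow> ('a, 'n) module \<Rightarrow> (complex, 'n \<Rightarrow> complex) module" where
  "restricted_dual A N \<equiv> dual_space (restrict_scalars A N)"

definition tensor_of_hom where
  "tensor_of_hom (A :: (complex, 'a) module) (N1 :: ('a, 'n1) module) (N2 :: ('a, 'n2) module)
     (N3 :: ('a, 'n3) module) (\<phi> :: (('n1 \<times> 'n2) \<Rightarrow>\<^sub>0 int) set \<Rightarrow> 'n3) =
   tensor_of_bilinear (restrict_scalars A N1) (restrict_scalars A N2) (restrict_scalars A N3)
     (\<lambda>x y. \<phi> (pure_tensor A N1 N2 x y))"

definition has_dim :: "(complex, 'v) module \<Rightarrow> nat \<Rightarrow> bool" where
  "has_dim V m \<longleftrightarrow> vectorspace.fin_dim CC V \<and> vectorspace.dim CC V = m"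

text \<open>
  \<open>A\<close> is not assumed to be finite-dimensional; \<open>vectorspace.dim\<close> is meaningful only in the
  finite-dimensional case.
\<close>

definition dim_at_least :: "(complex, 'v) module \<Rightarrow> nat \<Rightarrow> bool" where
  "dim_at_least V m \<longleftrightarrow> (vectorspace.fin_dim CC V \<longrightarrow> m \<le> vectorspace.dim CC V)"

definition nondegenerate_surjection where
  "nondegenerate_surjection m (A :: (complex, 'a) module) (N1 :: ('a, 'n1) module)
     (N2 :: ('a, 'n2) module) (N3 :: ('a, 'n3) module)
     (\<phi> :: (('n1 \<times> 'n2) \<Rightarrow>\<^sub>0 int) set \<Rightarrow> 'n3) \<longleftrightarrow>
   algebra CC A \<and> Module.module A N1 \<and> Module.module A N2 \<and> Module.module A N3 \<and>
   has_dim (restrict_scalars A N1) m \<and> has_dim (restrict_scalars A N2) m \<and>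
   has_dim (restrict_scalars A N3) m \<and> dim_at_least A m \<and>
   \<phi> \<in> LinearCombinations.module_hom A (tensor_product A N1 N2) N3 \<and>
   \<phi> ` carrier (tensor_product A N1 N2) = carrier N3 \<and>
   (\<forall>x\<in>carrier N1 - {\<zero>\<^bsub>N1\<^esub>}. \<exists>y\<in>carrier N2. \<phi> (pure_tensor A N1 N2 x y) \<noteq> \<zero>\<^bsub>N3\<^esub>) \<and>
   (\<forall>y\<in>carrier N2 - {\<zero>\<^bsub>N2\<^esub>}. \<exists>x\<in>carrier N1. \<phi> (pure_tensor A N1 N2 x y) \<noteq> \<zero>\<^bsub>N3\<^esub>)"

text \<open>
  No nonzero element of \<open>A\<close> annihilates all three modules.  Without this, \<open>m \<le> dim A\<close> says
  nothing about the modules, since \<open>A\<close> can be enlarged by elements acting as \<open>0\<close>.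
\<close>

definition acts_faithfully where
  "acts_faithfully (A :: (complex, 'a) module) (N1 :: ('a, 'n1) module) (N2 :: ('a, 'n2) module)
     (N3 :: ('a, 'n3) module) \<longleftrightarrow>
   (\<forall>a\<in>carrier A.
      (\<forall>x\<in>carrier N1. a \<odot>\<^bsub>N1\<^esub> x = \<zero>\<^bsub>N1\<^esub>) \<and>
      (\<forall>x\<in>carrier N2. a \<odot>\<^bsub>N2\<^esub> x = \<zero>\<^bsub>N2\<^esub>) \<and>
      (\<forall>x\<in>carrier N3. a \<odot>\<^bsub>N3\<^esub> x = \<zero>\<^bsub>N3\<^esub>) \<longrightarrow> a = \<zero>\<^bsub>A\<^esub>)"

end

theory Submission
  imports Defs
begin

text \<open>
  Let \<open>T \<in> U \<otimes> V \<otimes> W\<close>.  The space \<open>T(U\<^sup>*) \<otimes> U\<close> consists of the tensors \<open>(X, 1, 1) T\<close> obtained by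
  applying an endomorphism \<open>X\<close> of \<open>U\<^sup>*\<close> to the first argument of \<open>T\<close>, and similarly for the other two
  factors (\<open>image_tensor1_eq\<close>, \<open>image_tensor2_eq\<close>, \<open>image_tensor3_eq\<close>).  So the intersection of the three
  spaces is the set of tensors \<open>(X, 1, 1) T = (1, Y, 1) T = (1, 1, Z) T\<close>.  This is the source of the algebra: read \<open>T\<close> as a
  bilinear map \<open>b : U\<^sup>* \<times> V\<^sup>* \<rightarrow> W\<close> and call \<open>(X, Y, Z)\<close> a triple if \<open>b (X x) y = b x (Y y) = Z (b x y)\<close>
  (here \<open>Z\<close> is transposed, so that it acts on \<open>W\<close>).

  From a tensor to modules.  If \<open>T\<close> is concise, then \<open>b\<close> is nondegenerate in both arguments and its
  values span \<open>W\<close>, so the first entry of a triple determines the others.  Triples can be composed, and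
  two triples commute because they can be applied to different factors (\<open>triple_swap\<close>,
  \<open>triple_commute\<close>).  Hence the first entries form a commutative algebra \<open>A\<close>, which acts on
  \<open>U\<^sup>*\<close>, \<open>V\<^sup>*\<close> and \<open>W\<close> through the three entries.  By construction \<open>b\<close> is \<open>A\<close>-bilinear, so it factors
  through a surjection from the tensor product over \<open>A\<close> (\<open>induced_surjection\<close>).  Finally
  \<open>X \<mapsto> (X, 1, 1) T\<close> maps \<open>A\<close> onto the intersection, so \<open>m \<le> dim A\<close> if \<open>T\<close> is 111-abundant
  (\<open>dim_at_least_product_algebra\<close>).

  From modules to a tensor.  Conciseness of \<open>T\<^sub>\<phi>\<close> restates the nondegeneracy and the surjectivity of
  \<open>\<phi>\<close> (\<open>concise_T\<close>).  The actions of \<open>a \<in> A\<close> on the three modules form a triple, so \<open>a\<close> gives an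
  element of the intersection; if \<open>A\<close> acts faithfully, then \<open>A\<close> embeds in this way, and the intersection
  has dimension at least \<open>m\<close> (\<open>abundant_T\<close>).
\<close>

section \<open>Linear functionals on finite-dimensional spaces\<close>

abbreviation linear_maps ::
  "(complex, 'u) module \<Rightarrow> (complex, 'v) module \<Rightarrow> ('u \<Rightarrow> 'v) set" where
  "linear_maps U V \<equiv> LinearCombinations.module_hom CC U V"

lemma linear_mapsI:
  assumes "\<And>x. x \<in> carrier U \<Longrightarrow> f x \<in> carrier V"
    and "\<And>x y. \<lbrakk>x \<in> carrier U; y \<in> carrier U\<rbrakk> \<Longrightarrow> f (x \<oplus>\<^bsub>U\<^esub> y) = f x \<oplus>\<^bsub>V\<^esub> f y"
    and "\<And>c x. x \<in> carrier U \<Longrightarrow> f (c \<odot>\<^bsub>U\<^esub> x) = c \<odot>\<^bsub>V\<^esub> f x"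
  shows "f \<in> linear_maps U V"
  using assms by (auto simp: LinearCombinations.module_hom_def)

lemma linear_mapsD:
  assumes "f \<in> linear_maps U V"
  shows "x \<in> carrier U \<Longrightarrow> f x \<in> carrier V"
    and "\<lbrakk>x \<in> carrier U; y \<in> carrier U\<rbrakk> \<Longrightarrow> f (x \<oplus>\<^bsub>U\<^esub> y) = f x \<oplus>\<^bsub>V\<^esub> f y"
    and "x \<in> carrier U \<Longrightarrow> f (c \<odot>\<^bsub>U\<^esub> x) = c \<odot>\<^bsub>V\<^esub> f x"
  using assms by (auto simp: LinearCombinations.module_hom_def)

lemma CC_space_simps [simp]:
  "carrier CC_space = UNIV" "x \<oplus>\<^bsub>CC_space\<^esub> y = x + y" "c \<odot>\<^bsub>CC_space\<^esub> x = c * x"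
  "\<zero>\<^bsub>CC_space\<^esub> = 0"
  by (auto simp: CC_space_def)

lemma vectorspace_CCI:
  assumes "module CC V"
  shows "vectorspace CC V"
  using assms class_field by (simp add: vectorspace_def)

lemma vectorspace_CCD:
  assumes "vectorspace CC V"
  shows "module CC V"
  using assms by (simp add: vectorspace_def)

lemma func_space_simps:
  "carrier (ring.func_space CC S) = (S \<rightarrow>\<^sub>E (UNIV :: complex set))"
  "f \<oplus>\<^bsub>ring.func_space CC S\<^esub> g = (\<lambda>x\<in>S. f x + g x)"
  "c \<odot>\<^bsub>ring.func_space CC S\<^esub> f = (\<lambda>x\<in>S. c * f x)"
  "\<zero>\<^bsub>ring.func_space CC S\<^esub> = (\<lambda>x\<in>S. 0)"
  by (auto simp: class_ring.func_space_def)

lemma module_func_space: "module CC (ring.func_space CC S)" for S :: "'z set"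
  by (rule class_cring.func_space_is_module)

lemma dual_space_simps:
  "f \<oplus>\<^bsub>dual_space V\<^esub> g = (\<lambda>x\<in>carrier V. f x + g x)"
  "c \<odot>\<^bsub>dual_space V\<^esub> f = (\<lambda>x\<in>carrier V. c * f x)"
  "\<zero>\<^bsub>dual_space V\<^esub> = (\<lambda>x\<in>carrier V. 0)"
  by (simp_all add: dual_space_def func_space_simps)

lemma dual_memI:
  assumes "\<alpha> \<in> extensional (carrier V)"
    and "\<And>x y. \<lbrakk>x \<in> carrier V; y \<in> carrier V\<rbrakk> \<Longrightarrow> \<alpha> (x \<oplus>\<^bsub>V\<^esub> y) = \<alpha> x + \<alpha> y"
    and "\<And>c x. x \<in> carrier V \<Longrightarrow> \<alpha> (c \<odot>\<^bsub>V\<^esub> x) = c * \<alpha> x"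
  shows "\<alpha> \<in> carrier (dual_space V)"
  using assms by (auto simp: dual_space_def intro!: linear_mapsI)

lemma dual_memD:
  assumes "\<alpha> \<in> carrier (dual_space V)"
  shows "\<alpha> \<in> extensional (carrier V)"
    and "\<lbrakk>x \<in> carrier V; y \<in> carrier V\<rbrakk> \<Longrightarrow> \<alpha> (x \<oplus>\<^bsub>V\<^esub> y) = \<alpha> x + \<alpha> y"
    and "x \<in> carrier V \<Longrightarrow> \<alpha> (c \<odot>\<^bsub>V\<^esub> x) = c * \<alpha> x"
  using assms linear_mapsD[of \<alpha> V CC_space] by (auto simp: dual_space_def)

lemma dual_eqI:
  assumes "\<alpha> \<in> carrier (dual_space V)" "\<beta> \<in> carrier (dual_space V)"
    and "\<And>x. x \<in> carrier V \<Longrightarrow> \<alpha> x = \<beta> x"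
  shows "\<alpha> = \<beta>"
  using assms(3) dual_memD(1)[OF assms(1)] dual_memD(1)[OF assms(2)]
  by (rule_tac extensionalityI)

lemma vectorspace_closed:
  assumes "vectorspace CC V"
  shows "\<lbrakk>x \<in> carrier V; y \<in> carrier V\<rbrakk> \<Longrightarrow> x \<oplus>\<^bsub>V\<^esub> y \<in> carrier V"
    and "x \<in> carrier V \<Longrightarrow> c \<odot>\<^bsub>V\<^esub> x \<in> carrier V"
    and "\<zero>\<^bsub>V\<^esub> \<in> carrier V"
    and "x \<in> carrier V \<Longrightarrow> 0 \<odot>\<^bsub>V\<^esub> x = \<zero>\<^bsub>V\<^esub>"
    and "x \<in> carrier V \<Longrightarrow> 1 \<odot>\<^bsub>V\<^esub> x = x"
proof -
  interpret V: vectorspace CC V by fact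
  show "x \<in> carrier V \<Longrightarrow> c \<odot>\<^bsub>V\<^esub> x \<in> carrier V"
    using V.smult_closed[of c x] by simp
  show "x \<in> carrier V \<Longrightarrow> 0 \<odot>\<^bsub>V\<^esub> x = \<zero>\<^bsub>V\<^esub>" using V.lmult_0[of x] by simp
  show "x \<in> carrier V \<Longrightarrow> 1 \<odot>\<^bsub>V\<^esub> x = x" using V.smult_one[of x] by simp
qed (use assms in \<open>auto simp: vectorspace_def Module.module_def
    intro: abelian_monoid.a_closed abelian_monoid.zero_closed abelian_group.axioms(1)\<close>)

lemma vectorspace_dual_space:
  assumes V: "vectorspace CC V"
  shows "vectorspace CC (dual_space V)"
proof -
  have "LinearCombinations.submodule CC (carrier (dual_space V)) (ring.func_space CC (carrier V))"
  proof (rule LinearCombinations.submodule.intro)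
    show "module CC (ring.func_space CC (carrier V))" by (rule module_func_space)
    show "carrier (dual_space V) \<subseteq> carrier (ring.func_space CC (carrier V))"
      by (auto simp: func_space_simps PiE_def dest: dual_memD(1))
  qed (auto simp: func_space_simps dual_memD vectorspace_closed[OF V] algebra_simps
      intro!: dual_memI)
  from module.submodule_is_module[OF module_func_space this]
  have "module CC (ring.func_space CC (carrier V)\<lparr>carrier := carrier (dual_space V)\<rparr>)" .
  then show ?thesis
    by (intro vectorspace_CCI) (simp add: dual_space_def)
qed

lemma dual_zero:
  assumes V: "vectorspace CC V" and "\<alpha> \<in> carrier (dual_space V)"
  shows "\<alpha> \<zero>\<^bsub>V\<^esub> = 0"
  using dual_memD(3)[OF assms(2), of "\<zero>\<^bsub>V\<^esub>" 0] vectorspace_closed[OF V] by simp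

lemma functional_lincomb:
  assumes V: "vectorspace CC V" and \<alpha>: "\<alpha> \<in> carrier (dual_space V)"
    and "finite B" "B \<subseteq> carrier V"
  shows "\<alpha> (module.lincomb V a B) = (\<Sum>b\<in>B. a b * \<alpha> b)"
  using assms(3,4)
proof (induction B)
  case empty
  interpret vectorspace CC V by fact
  show ?case by (simp add: dual_zero[OF V \<alpha>])
next
  case (insert b B)
  interpret vectorspace CC V by fact
  have "lincomb a (insert b B) = a b \<odot>\<^bsub>V\<^esub> b \<oplus>\<^bsub>V\<^esub> lincomb a B"
    using insert by (intro lincomb_insert2) auto
  moreover have "lincomb a B \<in> carrier V" "a b \<odot>\<^bsub>V\<^esub> b \<in> carrier V"
    using insert by auto
  ultimately show ?case
    using insert by (simp add: dual_memD[OF \<alpha>])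
qed

lemma basis_coordinate_functionals:
  assumes V: "vectorspace CC V" and B: "finite B" "vectorspace.basis CC V B"
  obtains \<epsilon> where "\<And>b. b \<in> B \<Longrightarrow> \<epsilon> b \<in> carrier (dual_space V)"
    and "\<And>b c. \<lbrakk>b \<in> B; c \<in> B\<rbrakk> \<Longrightarrow> \<epsilon> b c = (if b = c then 1 else 0)"
    and "\<And>x. x \<in> carrier V \<Longrightarrow> module.lincomb V (\<lambda>b. \<epsilon> b x) B = x"
proof -
  interpret vectorspace CC V by fact
  have BV: "B \<subseteq> carrier V" using B(2) by (simp add: basis_def)
  have ex1: "\<exists>!a. a \<in> B \<rightarrow>\<^sub>E UNIV \<and> lincomb a B = x" if "x \<in> carrier V" for x
    using basis_criterion[OF B(1) BV] B(2) that by simp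
  define coord where "coord x = (THE a. a \<in> B \<rightarrow>\<^sub>E UNIV \<and> lincomb a B = x)" for x
  have coord: "coord x \<in> B \<rightarrow>\<^sub>E UNIV" "lincomb (coord x) B = x" if "x \<in> carrier V" for x
    using theI'[OF ex1[OF that]] by (auto simp: coord_def)
  have coord_eq: "coord x b = a b" if "lincomb a B = x" "b \<in> B" for x a b
  proof -
    have "lincomb (restrict a B) B = x"
      using that BV by (subst lincomb_cong[of B B "restrict a B" a]) auto
    moreover have "x \<in> carrier V" using that BV by auto
    ultimately have "coord x = restrict a B"
      unfolding coord_def by (intro the1_equality[OF ex1]) auto
    then show ?thesis using that by simp
  qed
  show ?thesis
  proof
    fix b assume b: "b \<in> B"
    show "(\<lambda>x\<in>carrier V. coord x b) \<in> carrier (dual_space V)"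
    proof (rule dual_memI)
      fix x y assume xy: "x \<in> carrier V" "y \<in> carrier V"
      have "lincomb (\<lambda>b. coord x b + coord y b) B = x \<oplus>\<^bsub>V\<^esub> y"
        using lincomb_sum[OF B(1) BV, of "coord x" "coord y"] coord xy by simp
      from coord_eq[OF this b] show "(\<lambda>x\<in>carrier V. coord x b) (x \<oplus>\<^bsub>V\<^esub> y) =
          (\<lambda>x\<in>carrier V. coord x b) x + (\<lambda>x\<in>carrier V. coord x b) y"
        using xy by simp
    next
      fix c x assume x: "x \<in> carrier V"
      have "lincomb (\<lambda>b. c * coord x b) B = c \<odot>\<^bsub>V\<^esub> x"
        using lincomb_smult[OF BV, of "coord x" c] coord x by simp
      from coord_eq[OF this b] show "(\<lambda>x\<in>carrier V. coord x b) (c \<odot>\<^bsub>V\<^esub> x) =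
          c * (\<lambda>x\<in>carrier V. coord x b) x"
        using x vectorspace_closed[OF V] by simp
    qed simp
  next
    fix b c assume bc: "b \<in> B" "c \<in> B"
    have "lincomb (\<lambda>b. if b = c then 1 else 0) B = c"
    proof -
      have "lincomb (\<lambda>b. if b = c then 1 else 0) B =
        (\<lambda>b. if b = c then 1 else 0) c \<odot>\<^bsub>V\<^esub> c \<oplus>\<^bsub>V\<^esub> lincomb (\<lambda>b. if b = c then 1 else 0) (B - {c})"
        by (rule lincomb_del2) (use B BV bc in auto)
      also have "lincomb (\<lambda>b. if b = c then 1 else 0) (B - {c}) = lincomb (\<lambda>b. 0) (B - {c})"
        by (rule lincomb_cong) (use B BV bc in auto)
      also have "\<dots> = \<zero>\<^bsub>V\<^esub>"
        by (rule lincomb_zero) (use B BV bc in auto)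
      finally show ?thesis using bc BV vectorspace_closed[OF V] by auto
    qed
    from coord_eq[OF this bc(1)] show "(\<lambda>x\<in>carrier V. coord x b) c = (if b = c then 1 else 0)"
      using bc BV by auto
  next
    fix x assume "x \<in> carrier V"
    then show "lincomb (\<lambda>b. (\<lambda>x\<in>carrier V. coord x b) x) B = x"
      using coord by simp
  qed
qed

text \<open>
  A coordinate system for \<open>V\<close> expressed through scalar identities only, so that sums are sums of complex
  numbers and never \<open>finsum\<close>s in \<open>V\<close>: the second clause says \<open>x = \<Sum>\<^sub>i \<epsilon>\<^sub>i(x) e\<^sub>i\<close> as seen by all
  functionals, and the third that the functionals separate points.
\<close>

definition dual_frame ::
  "(complex, 'v) module \<Rightarrow> nat \<Rightarrow> (nat \<Rightarrow> 'v) \<Rightarrow> (nat \<Rightarrow> 'v \<Rightarrow> complex) \<Rightarrow> bool" where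
  "dual_frame V n e \<epsilon> \<longleftrightarrow>
     (\<forall>i<n. e i \<in> carrier V \<and> \<epsilon> i \<in> carrier (dual_space V)) \<and>
     (\<forall>x\<in>carrier V. \<forall>\<alpha>\<in>carrier (dual_space V). \<alpha> x = (\<Sum>i<n. \<epsilon> i x * \<alpha> (e i))) \<and>
     (\<forall>x\<in>carrier V. \<forall>y\<in>carrier V. (\<forall>\<alpha>\<in>carrier (dual_space V). \<alpha> x = \<alpha> y) \<longrightarrow> x = y)"

lemma dual_frameD:
  assumes "dual_frame V n e \<epsilon>"
  shows "i < n \<Longrightarrow> e i \<in> carrier V" "i < n \<Longrightarrow> \<epsilon> i \<in> carrier (dual_space V)"
    and "\<lbrakk>x \<in> carrier V; \<alpha> \<in> carrier (dual_space V)\<rbrakk> \<Longrightarrow> \<alpha> x = (\<Sum>i<n. \<epsilon> i x * \<alpha> (e i))"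
    and "\<lbrakk>x \<in> carrier V; y \<in> carrier V; \<And>\<alpha>. \<alpha> \<in> carrier (dual_space V) \<Longrightarrow> \<alpha> x = \<alpha> y\<rbrakk> \<Longrightarrow> x = y"
  using assms unfolding dual_frame_def by blast+

lemma dual_frame_exists:
  assumes V: "vectorspace CC V" and fd: "vectorspace.fin_dim CC V"
  obtains n e \<epsilon> where "dual_frame V n e \<epsilon>"
proof -
  interpret vectorspace CC V by fact
  obtain B where B: "finite B" "basis B" using finite_basis_exists[OF fd] by blast
  then have BV: "B \<subseteq> carrier V" by (simp add: basis_def)
  obtain \<epsilon> where \<epsilon>: "\<And>b. b \<in> B \<Longrightarrow> \<epsilon> b \<in> carrier (dual_space V)"
    "\<And>x. x \<in> carrier V \<Longrightarrow> lincomb (\<lambda>b. \<epsilon> b x) B = x"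
    using basis_coordinate_functionals[OF V B] by metis
  obtain e where e: "bij_betw e {..<card B} B"
    using ex_bij_betw_nat_finite[OF B(1)] by (auto simp: atLeast0LessThan)
  have eB: "e i \<in> B" if "i < card B" for i using e that by (auto simp: bij_betw_def)
  have "dual_frame V (card B) e (\<lambda>i. \<epsilon> (e i))"
    unfolding dual_frame_def
  proof (intro conjI allI ballI impI)
    fix i assume "i < card B"
    then show "e i \<in> carrier V" "\<epsilon> (e i) \<in> carrier (dual_space V)" using eB BV \<epsilon> by auto
  next
    fix x \<alpha> assume x: "x \<in> carrier V" and \<alpha>: "\<alpha> \<in> carrier (dual_space V)"
    have "\<alpha> x = \<alpha> (lincomb (\<lambda>b. \<epsilon> b x) B)" using x \<epsilon> by simp
    also have "\<dots> = (\<Sum>b\<in>B. \<epsilon> b x * \<alpha> b)" by (rule functional_lincomb[OF V \<alpha> B(1) BV])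
    also have "\<dots> = (\<Sum>i<card B. \<epsilon> (e i) x * \<alpha> (e i))"
      by (rule sum.reindex_bij_betw[OF e, symmetric])
    finally show "\<alpha> x = (\<Sum>i<card B. \<epsilon> (e i) x * \<alpha> (e i))" .
  next
    fix x y assume xy: "x \<in> carrier V" "y \<in> carrier V"
      and "\<forall>\<alpha>\<in>carrier (dual_space V). \<alpha> x = \<alpha> y"
    then have "\<epsilon> b x = \<epsilon> b y" if "b \<in> B" for b using that \<epsilon> by auto
    then have "lincomb (\<lambda>b. \<epsilon> b x) B = lincomb (\<lambda>b. \<epsilon> b y) B"
      using BV by (intro lincomb_cong) auto
    then show "x = y" using xy \<epsilon> by simp
  qed
  then show ?thesis by (rule that)
qed

text \<open>
  A proper subspace lies in the kernel of a nonzero functional: extend a basis of the subspace by a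
  vector outside it to a basis of the whole space and take the coordinate of that vector.
\<close>

lemma submodule_eq_carrierI:
  assumes V: "vectorspace CC V" and fd: "vectorspace.fin_dim CC V"
    and S: "LinearCombinations.submodule CC S V"
    and ann: "\<And>\<alpha>. \<lbrakk>\<alpha> \<in> carrier (dual_space V); \<And>s. s \<in> S \<Longrightarrow> \<alpha> s = 0\<rbrakk> \<Longrightarrow> \<forall>x\<in>carrier V. \<alpha> x = 0"
  shows "S = carrier V"
proof (rule ccontr)
  interpret vectorspace CC V by fact
  have SV: "S \<subseteq> carrier V" by (rule submodule.subset[OF S])
  assume "S \<noteq> carrier V"
  then obtain x where x: "x \<in> carrier V" "x \<notin> S" using SV by blast
  have emp: "lin_indpt {}" by (auto simp: lin_dep_def)
  obtain A where A: "maximal A (\<lambda>T. T \<subseteq> S \<and> lin_indpt T)"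
    using maximal_exists[of "\<lambda>T. T \<subseteq> S \<and> lin_indpt T" dim "{}"] li_le_dim[OF fd] SV emp
    by (meson empty_subsetI order_trans)
  then have AS: "A \<subseteq> S" and Ali: "lin_indpt A"
    and Amax: "\<And>T. \<lbrakk>A \<subseteq> T; T \<subseteq> S; lin_indpt T\<rbrakk> \<Longrightarrow> T = A"
    by (auto simp: maximal_def)
  have AV: "A \<subseteq> carrier V" using AS SV by blast
  have "span A \<subseteq> S" by (rule span_is_subset[OF AS S])
  moreover have "s \<in> span A" if "s \<in> S" for s
  proof (cases "s \<in> A")
    case True
    then show ?thesis using in_own_span[OF AV] by blast
  next
    case False
    have "lin_dep (A \<union> {s})" using Amax[of "A \<union> {s}"] AS that False by blast
    then show ?thesis using lin_dep_iff_in_span[OF AV Ali _ False] that SV by blast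
  qed
  ultimately have spanA: "span A = S" by blast
  then have xA: "x \<notin> A" using x AS by blast
  have Ax: "lin_indpt (A \<union> {x})"
    using lin_dep_iff_in_span[OF AV Ali x(1) xA] x spanA by blast
  obtain T where T: "finite T" "maximal T (\<lambda>T. A \<union> {x} \<subseteq> T \<and> T \<subseteq> carrier V \<and> lin_indpt T)"
    using maximal_exists[of "\<lambda>T. A \<union> {x} \<subseteq> T \<and> T \<subseteq> carrier V \<and> lin_indpt T" dim "A \<union> {x}"]
      li_le_dim[OF fd] AV x Ax by blast
  then have "maximal T (\<lambda>T. T \<subseteq> carrier V \<and> lin_indpt T)"
    unfolding maximal_def by (meson order_trans)
  then have "basis T" by (rule max_li_is_basis)
  obtain \<epsilon> where \<epsilon>: "\<And>b. b \<in> T \<Longrightarrow> \<epsilon> b \<in> carrier (dual_space V)"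
    "\<And>b c. \<lbrakk>b \<in> T; c \<in> T\<rbrakk> \<Longrightarrow> \<epsilon> b c = (if b = c then 1 else 0)"
    using basis_coordinate_functionals[OF V \<open>finite T\<close> \<open>basis T\<close>] by metis
  have AT: "A \<subseteq> T" "x \<in> T" using T by (auto simp: maximal_def)
  have "\<epsilon> x s = 0" if s: "s \<in> S" for s
  proof -
    have finA: "finite A" using AT T finite_subset by blast
    obtain a where "lincomb a A = s"
      using finite_in_span[OF finA AV, of s] s by (auto simp: spanA)
    then have "\<epsilon> x s = (\<Sum>b\<in>A. a b * \<epsilon> x b)"
      using functional_lincomb[OF V \<epsilon>(1)[OF AT(2)] finA AV] by metis
    also have "\<dots> = 0"
    proof (intro sum.neutral ballI)
      fix b assume "b \<in> A"
      then have "b \<in> T" "x \<noteq> b" using AT xA by auto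
      then show "a b * \<epsilon> x b = 0" using \<epsilon>(2)[OF AT(2)] by simp
    qed
    finally show ?thesis .
  qed
  from ann[OF \<epsilon>(1)[OF AT(2)] this] x have "\<epsilon> x x = 0" by blast
  then show False using \<epsilon>(2)[OF AT(2) AT(2)] by simp
qed

section \<open>Dimension under linear maps\<close>

lemma linear_map_CCI:
  assumes "vectorspace CC U" "vectorspace CC V" "f \<in> linear_maps U V"
  shows "linear_map CC U V f"
  using assms by (simp add: linear_map_def mod_hom_def mod_hom_axioms_def vectorspace_def)

text \<open>
  Independent sets of \<open>U\<close> are mapped to independent sets of \<open>V\<close>, so they have at most \<open>dim V\<close> elements.
  Finite dimension of \<open>U\<close> is a conclusion: the lemma is applied to algebras about which only
  \<open>dim_at_least\<close> is known.
\<close>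

lemma injective_linear_dim_le:
  assumes U: "vectorspace CC U" and V: "vectorspace CC V" and f: "f \<in> linear_maps U V"
    and inj: "inj_on f (carrier U)" and fd: "vectorspace.fin_dim CC V"
  shows "vectorspace.fin_dim CC U" "vectorspace.dim CC U \<le> vectorspace.dim CC V"
proof -
  interpret linear_map CC U V f by (rule linear_map_CCI[OF U V f])
  have fin_le: "card A \<le> W.dim" if A: "finite A" "A \<subseteq> carrier U" "\<not> V.module.lin_dep A" for A
  proof -
    have fA: "f ` A \<subseteq> carrier V" using A by auto
    have "\<not> W.module.lin_dep (f ` A)"
    proof (rule W.module.finite_lin_indpt2)
      fix a assume "W.module.lincomb a (f ` A) = \<zero>\<^bsub>V\<^esub>"
      then have "f (V.module.lincomb (a \<circ> f) A) = \<zero>\<^bsub>V\<^esub>"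
        using lincomb_linear_image[OF inj A(2) _ A(1), of a] by auto
      moreover have lA: "V.module.lincomb (a \<circ> f) A \<in> carrier U" using A by auto
      ultimately have "V.module.lincomb (a \<circ> f) A = \<zero>\<^bsub>U\<^esub>"
        using inj vectorspace_closed(3)[OF U] f0_is_0 by (metis inj_on_def)
      then have "\<forall>v\<in>A. (a \<circ> f) v = 0"
        using A V.not_lindepD[of A A "a \<circ> f"] by auto
      then show "\<forall>v\<in>f ` A. a v = \<zero>\<^bsub>CC\<^esub>" by auto
    qed (use A fA in auto)
    then have "card (f ` A) \<le> W.dim" using W.li_le_dim[OF fd fA] by blast
    then show ?thesis using card_image[OF inj_on_subset[OF inj A(2)]] by simp
  qed
  have bounded: "finite A \<and> card A \<le> W.dim" if A: "A \<subseteq> carrier U \<and> \<not> V.module.lin_dep A" for A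
  proof -
    have "finite A"
    proof (rule ccontr)
      assume "infinite A"
      then obtain B where B: "finite B" "card B = W.dim + 1" "B \<subseteq> A"
        by (meson infinite_arbitrarily_large)
      have "\<not> V.module.lin_dep B" using V.module.subset_li_is_li A B by blast
      then have "card B \<le> W.dim" using fin_le[OF B(1)] A B by blast
      then show False using B by simp
    qed
    then show ?thesis using fin_le A by blast
  qed
  have emp: "\<not> V.module.lin_dep {}" by (auto simp: V.module.lin_dep_def)
  obtain A where A: "finite A" "maximal A (\<lambda>T. T \<subseteq> carrier U \<and> \<not> V.module.lin_dep T)"
    using maximal_exists[of "\<lambda>T. T \<subseteq> carrier U \<and> \<not> V.module.lin_dep T" W.dim "{}"] bounded emp
    by blast
  have bA: "V.basis A" by (rule V.max_li_is_basis[OF A(2)])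
  then show "V.fin_dim" using A unfolding V.fin_dim_def V.basis_def by blast
  have "card A \<le> W.dim" using bounded[of A] bA unfolding V.basis_def by blast
  then show "V.dim \<le> W.dim" using V.dim_basis[OF A(1) bA] by simp
qed

lemma surjective_linear_dim_le:
  assumes U: "vectorspace CC U" and V: "vectorspace CC V" and f: "f \<in> linear_maps U V"
    and surj: "f ` carrier U = carrier V" and fd: "vectorspace.fin_dim CC U"
  shows "vectorspace.dim CC V \<le> vectorspace.dim CC U"
proof -
  interpret linear_map CC U V f by (rule linear_map_CCI[OF U V f])
  show ?thesis using rank_nullity[OF fd] surj_imp_imT_carrier[OF surj] by simp
qed

lemma has_dim_linear_iso:
  assumes U: "vectorspace CC U" and V: "vectorspace CC V" and f: "linear_iso U V f"
    and "has_dim U m"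
  shows "has_dim V m"
proof -
  interpret linear_map CC U V f
    using f by (intro linear_map_CCI[OF U V]) (auto simp: linear_iso_def)
  show ?thesis
    using assms(4) f dim_eq surj_fin_dim by (auto simp: has_dim_def linear_iso_def bij_betw_def)
qed

section \<open>Biduality\<close>

lemma evaluation_apply [simp]: "\<alpha> \<in> carrier (dual_space V) \<Longrightarrow> evaluation V v \<alpha> = \<alpha> v"
  by (simp add: evaluation_def)

lemma evaluation_in_bidual:
  assumes V: "vectorspace CC V" and v: "v \<in> carrier V"
  shows "evaluation V v \<in> carrier (dual_space (dual_space V))"
  using v vectorspace_closed[OF vectorspace_dual_space[OF V]]
  by (intro dual_memI) (auto simp: evaluation_def dual_space_simps)

text \<open>
  \<open>\<Phi>\<close> applied to \<open>\<alpha> = \<Sum>\<^sub>i \<alpha>(e\<^sub>i) \<epsilon>\<^sub>i\<close>; the partial sums \<open>\<beta>\<close> of this expansion are built by induction.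
\<close>

lemma bidual_functional_expansion:
  assumes V: "vectorspace CC V" and fr: "dual_frame V n e \<epsilon>"
    and \<Phi>: "\<Phi> \<in> carrier (dual_space (dual_space V))" and \<alpha>: "\<alpha> \<in> carrier (dual_space V)"
  shows "\<Phi> \<alpha> = (\<Sum>i<n. \<alpha> (e i) * \<Phi> (\<epsilon> i))"
proof -
  note cl = vectorspace_closed[OF vectorspace_dual_space[OF V]]
  have "\<exists>\<beta>\<in>carrier (dual_space V). (\<forall>x\<in>carrier V. \<beta> x = (\<Sum>i<k. \<epsilon> i x * \<alpha> (e i))) \<and>
      \<Phi> \<beta> = (\<Sum>i<k. \<alpha> (e i) * \<Phi> (\<epsilon> i))" if "k \<le> n" for k
    using that
  proof (induction k)
    case 0
    have "\<Phi> \<zero>\<^bsub>dual_space V\<^esub> = 0"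
      by (rule dual_zero[OF vectorspace_dual_space[OF V] \<Phi>])
    moreover have "\<zero>\<^bsub>dual_space V\<^esub> x = 0" if "x \<in> carrier V" for x
      using that by (simp add: dual_space_simps)
    ultimately show ?case using cl(3) by (intro bexI[of _ "\<zero>\<^bsub>dual_space V\<^esub>"]) simp_all
  next
    case (Suc k)
    then obtain \<beta> where \<beta>: "\<beta> \<in> carrier (dual_space V)"
      "\<And>x. x \<in> carrier V \<Longrightarrow> \<beta> x = (\<Sum>i<k. \<epsilon> i x * \<alpha> (e i))"
      "\<Phi> \<beta> = (\<Sum>i<k. \<alpha> (e i) * \<Phi> (\<epsilon> i))" by auto
    have k: "\<epsilon> k \<in> carrier (dual_space V)" using dual_frameD(2)[OF fr] Suc by simp
    show ?case
    proof (intro bexI[of _ "\<beta> \<oplus>\<^bsub>dual_space V\<^esub> \<alpha> (e k) \<odot>\<^bsub>dual_space V\<^esub> \<epsilon> k"] conjI ballI)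
      show "\<Phi> (\<beta> \<oplus>\<^bsub>dual_space V\<^esub> \<alpha> (e k) \<odot>\<^bsub>dual_space V\<^esub> \<epsilon> k) = (\<Sum>i<Suc k. \<alpha> (e i) * \<Phi> (\<epsilon> i))"
        using \<beta> k cl by (simp add: dual_memD[OF \<Phi>])
      show "\<beta> \<oplus>\<^bsub>dual_space V\<^esub> \<alpha> (e k) \<odot>\<^bsub>dual_space V\<^esub> \<epsilon> k \<in> carrier (dual_space V)"
        by (intro cl(1,2) \<beta>(1) k)
    qed (use \<beta> in \<open>auto simp: dual_space_simps\<close>)
  qed
  from this[of n] obtain \<beta> where \<beta>: "\<beta> \<in> carrier (dual_space V)"
    "\<And>x. x \<in> carrier V \<Longrightarrow> \<beta> x = (\<Sum>i<n. \<epsilon> i x * \<alpha> (e i))"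
    "\<Phi> \<beta> = (\<Sum>i<n. \<alpha> (e i) * \<Phi> (\<epsilon> i))" by auto
  have "\<beta> = \<alpha>"
    using \<beta> dual_frameD(3)[OF fr _ \<alpha>] by (intro dual_eqI[OF \<beta>(1) \<alpha>]) metis
  then show ?thesis using \<beta> by simp
qed

text \<open>The vector is \<open>v = \<Sum>\<^sub>i \<Phi>(\<epsilon>\<^sub>i) e\<^sub>i\<close>, again built from its partial sums.\<close>

lemma bidual_evaluation:
  assumes V: "vectorspace CC V" and fr: "dual_frame V n e \<epsilon>"
    and \<Phi>: "\<Phi> \<in> carrier (dual_space (dual_space V))"
  obtains v where "v \<in> carrier V" "\<Phi> = evaluation V v"
proof -
  note cl = vectorspace_closed[OF V]
  have "\<exists>v\<in>carrier V. \<forall>\<alpha>\<in>carrier (dual_space V). \<alpha> v = (\<Sum>i<k. \<alpha> (e i) * \<Phi> (\<epsilon> i))" if "k \<le> n" for k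
    using that
  proof (induction k)
    case 0
    show ?case using dual_zero[OF V] cl(3) by (intro bexI[of _ "\<zero>\<^bsub>V\<^esub>"]) auto
  next
    case (Suc k)
    then obtain v where v: "v \<in> carrier V"
      "\<And>\<alpha>. \<alpha> \<in> carrier (dual_space V) \<Longrightarrow> \<alpha> v = (\<Sum>i<k. \<alpha> (e i) * \<Phi> (\<epsilon> i))" by auto
    have k: "e k \<in> carrier V" using dual_frameD(1)[OF fr] Suc by simp
    show ?case
      using v k cl
      by (intro bexI[of _ "v \<oplus>\<^bsub>V\<^esub> \<Phi> (\<epsilon> k) \<odot>\<^bsub>V\<^esub> e k"]) (auto simp: dual_memD)
  qed
  from this[of n] obtain v where v: "v \<in> carrier V"
    "\<And>\<alpha>. \<alpha> \<in> carrier (dual_space V) \<Longrightarrow> \<alpha> v = (\<Sum>i<n. \<alpha> (e i) * \<Phi> (\<epsilon> i))" by auto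
  have "\<Phi> = evaluation V v"
    using \<Phi> evaluation_in_bidual[OF V v(1)]
    by (rule dual_eqI) (simp add: v(2) bidual_functional_expansion[OF V fr \<Phi>])
  then show ?thesis using that v by blast
qed

section \<open>Tensors as trilinear forms\<close>

lemma tensor_space_simps:
  "s \<oplus>\<^bsub>tensor_space U V W\<^esub> t = (\<lambda>p\<in>dual_triples U V W. s p + t p)"
  "c \<odot>\<^bsub>tensor_space U V W\<^esub> t = (\<lambda>p\<in>dual_triples U V W. c * t p)"
  "\<zero>\<^bsub>tensor_space U V W\<^esub> = (\<lambda>p\<in>dual_triples U V W. 0)"
  by (simp_all add: tensor_space_def func_space_simps)

lemma tensor_memI:
  assumes "t \<in> extensional (dual_triples U V W)"
    and "\<And>\<beta> \<gamma>. \<lbrakk>\<beta> \<in> carrier (dual_space V); \<gamma> \<in> carrier (dual_space W)\<rbrakk> \<Longrightarrow>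
      (\<lambda>\<alpha>. t (\<alpha>, \<beta>, \<gamma>)) \<in> linear_maps (dual_space U) CC_space"
    and "\<And>\<alpha> \<gamma>. \<lbrakk>\<alpha> \<in> carrier (dual_space U); \<gamma> \<in> carrier (dual_space W)\<rbrakk> \<Longrightarrow>
      (\<lambda>\<beta>. t (\<alpha>, \<beta>, \<gamma>)) \<in> linear_maps (dual_space V) CC_space"
    and "\<And>\<alpha> \<beta>. \<lbrakk>\<alpha> \<in> carrier (dual_space U); \<beta> \<in> carrier (dual_space V)\<rbrakk> \<Longrightarrow>
      (\<lambda>\<gamma>. t (\<alpha>, \<beta>, \<gamma>)) \<in> linear_maps (dual_space W) CC_space"
  shows "t \<in> carrier (tensor_space U V W)"
  using assms by (simp add: tensor_space_def)

lemma tensor_memD: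
  assumes "t \<in> carrier (tensor_space U V W)"
  shows "t \<in> extensional (dual_triples U V W)"
    and "\<lbrakk>\<beta> \<in> carrier (dual_space V); \<gamma> \<in> carrier (dual_space W)\<rbrakk> \<Longrightarrow>
      (\<lambda>\<alpha>. t (\<alpha>, \<beta>, \<gamma>)) \<in> linear_maps (dual_space U) CC_space"
    and "\<lbrakk>\<alpha> \<in> carrier (dual_space U); \<gamma> \<in> carrier (dual_space W)\<rbrakk> \<Longrightarrow>
      (\<lambda>\<beta>. t (\<alpha>, \<beta>, \<gamma>)) \<in> linear_maps (dual_space V) CC_space"
    and "\<lbrakk>\<alpha> \<in> carrier (dual_space U); \<beta> \<in> carrier (dual_space V)\<rbrakk> \<Longrightarrow>
      (\<lambda>\<gamma>. t (\<alpha>, \<beta>, \<gamma>)) \<in> linear_maps (dual_space W) CC_space"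
  using assms by (simp_all add: tensor_space_def)

lemma tensor_linear:
  assumes t: "t \<in> carrier (tensor_space U V W)"
    and "\<alpha> \<in> carrier (dual_space U)" "\<beta> \<in> carrier (dual_space V)" "\<gamma> \<in> carrier (dual_space W)"
  shows "\<alpha>' \<in> carrier (dual_space U) \<Longrightarrow> t (\<alpha> \<oplus>\<^bsub>dual_space U\<^esub> \<alpha>', \<beta>, \<gamma>) = t (\<alpha>, \<beta>, \<gamma>) + t (\<alpha>', \<beta>, \<gamma>)"
    and "\<beta>' \<in> carrier (dual_space V) \<Longrightarrow> t (\<alpha>, \<beta> \<oplus>\<^bsub>dual_space V\<^esub> \<beta>', \<gamma>) = t (\<alpha>, \<beta>, \<gamma>) + t (\<alpha>, \<beta>', \<gamma>)"
    and "\<gamma>' \<in> carrier (dual_space W) \<Longrightarrow> t (\<alpha>, \<beta>, \<gamma> \<oplus>\<^bsub>dual_space W\<^esub> \<gamma>') = t (\<alpha>, \<beta>, \<gamma>) + t (\<alpha>, \<beta>, \<gamma>')"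
    and "t (c \<odot>\<^bsub>dual_space U\<^esub> \<alpha>, \<beta>, \<gamma>) = c * t (\<alpha>, \<beta>, \<gamma>)"
    and "t (\<alpha>, c \<odot>\<^bsub>dual_space V\<^esub> \<beta>, \<gamma>) = c * t (\<alpha>, \<beta>, \<gamma>)"
    and "t (\<alpha>, \<beta>, c \<odot>\<^bsub>dual_space W\<^esub> \<gamma>) = c * t (\<alpha>, \<beta>, \<gamma>)"
  using assms(2-4) tensor_memD(2)[OF t, THEN linear_mapsD(2)] tensor_memD(2)[OF t, THEN linear_mapsD(3)]
    tensor_memD(3)[OF t, THEN linear_mapsD(2)] tensor_memD(3)[OF t, THEN linear_mapsD(3)]
    tensor_memD(4)[OF t, THEN linear_mapsD(2)] tensor_memD(4)[OF t, THEN linear_mapsD(3)]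
  by simp_all

lemma tensor_eqI:
  assumes "s \<in> carrier (tensor_space U V W)" "t \<in> carrier (tensor_space U V W)"
    and "\<And>\<alpha> \<beta> \<gamma>. \<lbrakk>\<alpha> \<in> carrier (dual_space U); \<beta> \<in> carrier (dual_space V); \<gamma> \<in> carrier (dual_space W)\<rbrakk>
      \<Longrightarrow> s (\<alpha>, \<beta>, \<gamma>) = t (\<alpha>, \<beta>, \<gamma>)"
  shows "s = t"
  using tensor_memD(1)[OF assms(1)] tensor_memD(1)[OF assms(2)]
  by (rule extensionalityI) (auto simp: assms(3))

lemma vectorspace_tensor_space:
  assumes U: "vectorspace CC U" and V: "vectorspace CC V" and W: "vectorspace CC W"
  shows "vectorspace CC (tensor_space U V W)"
proof -
  let ?F = "ring.func_space CC (dual_triples U V W)"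
  note cl = vectorspace_closed[OF vectorspace_dual_space[OF U]]
    vectorspace_closed[OF vectorspace_dual_space[OF V]] vectorspace_closed[OF vectorspace_dual_space[OF W]]
  have "LinearCombinations.submodule CC (carrier (tensor_space U V W)) ?F"
  proof (rule LinearCombinations.submodule.intro)
    show "module CC ?F" by (rule module_func_space)
    show "carrier (tensor_space U V W) \<subseteq> carrier ?F"
      by (auto simp: func_space_simps PiE_def dest: tensor_memD(1))
  qed (auto simp: func_space_simps cl tensor_linear algebra_simps
      intro!: tensor_memI linear_mapsI)
  from module.submodule_is_module[OF module_func_space this]
  have "module CC (?F\<lparr>carrier := carrier (tensor_space U V W)\<rparr>)" .
  then show ?thesis
    by (intro vectorspace_CCI) (simp add: tensor_space_def)
qed

text \<open>
  The tensor \<open>(X, Y, Z) t\<close>.  Elements of the three image spaces arise from endomorphisms of the dual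
  spaces in one position, isomorphic copies of a tensor from transposed isomorphisms in all three.
\<close>

definition tensor_pullback ::
  "(complex, 'u) module \<Rightarrow> (complex, 'v) module \<Rightarrow> (complex, 'w) module \<Rightarrow>
    (('u \<Rightarrow> complex) \<Rightarrow> 'a) \<Rightarrow> (('v \<Rightarrow> complex) \<Rightarrow> 'b) \<Rightarrow> (('w \<Rightarrow> complex) \<Rightarrow> 'c) \<Rightarrow>
    ('a \<times> 'b \<times> 'c \<Rightarrow> complex) \<Rightarrow> ('u \<Rightarrow> complex) \<times> ('v \<Rightarrow> complex) \<times> ('w \<Rightarrow> complex) \<Rightarrow> complex" where
  "tensor_pullback U V W X Y Z t = (\<lambda>(\<alpha>, \<beta>, \<gamma>)\<in>dual_triples U V W. t (X \<alpha>, Y \<beta>, Z \<gamma>))"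

lemma tensor_pullback_apply:
  assumes "\<alpha> \<in> carrier (dual_space U)" "\<beta> \<in> carrier (dual_space V)" "\<gamma> \<in> carrier (dual_space W)"
  shows "tensor_pullback U V W X Y Z t (\<alpha>, \<beta>, \<gamma>) = t (X \<alpha>, Y \<beta>, Z \<gamma>)"
  using assms by (simp add: tensor_pullback_def)

lemma tensor_pullback_mem:
  assumes U: "vectorspace CC U" and V: "vectorspace CC V" and W: "vectorspace CC W"
    and X: "X \<in> linear_maps (dual_space U) (dual_space U')"
    and Y: "Y \<in> linear_maps (dual_space V) (dual_space V')"
    and Z: "Z \<in> linear_maps (dual_space W) (dual_space W')"
    and t: "t \<in> carrier (tensor_space U' V' W')"
  shows "tensor_pullback U V W X Y Z t \<in> carrier (tensor_space U V W)"
  by (intro tensor_memI linear_mapsI)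
    (auto simp: tensor_pullback_apply linear_mapsD[OF X] linear_mapsD[OF Y] linear_mapsD[OF Z]
      tensor_linear[OF t] vectorspace_closed[OF vectorspace_dual_space[OF U]]
      vectorspace_closed[OF vectorspace_dual_space[OF V]]
      vectorspace_closed[OF vectorspace_dual_space[OF W]],
     auto simp: tensor_pullback_def)

lemma identity_linear: "(\<lambda>\<alpha>. \<alpha>) \<in> linear_maps U U"
  by (rule linear_mapsI) auto

text \<open>
  The endomorphisms of \<open>U\<^sup>*\<close> are spanned by the rank one maps \<open>\<alpha> \<mapsto> \<alpha>(u) \<alpha>\<^sub>0\<close>, since
  \<open>X = \<Sum>\<^sub>i (\<alpha> \<mapsto> \<alpha>(e\<^sub>i) X(\<epsilon>\<^sub>i))\<close> for a dual frame.  Hence a linear map \<open>h\<close> on endomorphisms sends the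
  span of the rank one maps onto its whole image.  With \<open>h X = (X, 1, 1) t\<close> the images of the rank one
  maps are the generators \<open>u \<otimes> t(\<alpha>\<^sub>0)\<close> of \<open>t(U\<^sup>*) \<otimes> U\<close>; likewise in the other two positions.
\<close>

lemma span_rank_one_image:
  assumes U: "vectorspace CC U" and fr: "dual_frame U n e \<epsilon>" and M: "vectorspace CC M"
    and mem: "\<And>X. X \<in> linear_maps (dual_space U) (dual_space U) \<Longrightarrow> h X \<in> carrier M"
    and add: "\<And>X Y Z. \<lbrakk>X \<in> linear_maps (dual_space U) (dual_space U);
        Y \<in> linear_maps (dual_space U) (dual_space U); Z \<in> linear_maps (dual_space U) (dual_space U);
        \<And>\<alpha>. \<alpha> \<in> carrier (dual_space U) \<Longrightarrow> Z \<alpha> = X \<alpha> \<oplus>\<^bsub>dual_space U\<^esub> Y \<alpha>\<rbrakk> \<Longrightarrow> h Z = h X \<oplus>\<^bsub>M\<^esub> h Y"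
    and smult: "\<And>c X Z. \<lbrakk>X \<in> linear_maps (dual_space U) (dual_space U);
        Z \<in> linear_maps (dual_space U) (dual_space U);
        \<And>\<alpha>. \<alpha> \<in> carrier (dual_space U) \<Longrightarrow> Z \<alpha> = c \<odot>\<^bsub>dual_space U\<^esub> X \<alpha>\<rbrakk> \<Longrightarrow> h Z = c \<odot>\<^bsub>M\<^esub> h X"
  shows "LinearCombinations.module.span CC M
      {h (\<lambda>\<alpha>. \<alpha> u \<odot>\<^bsub>dual_space U\<^esub> \<alpha>0) | u \<alpha>0. u \<in> carrier U \<and> \<alpha>0 \<in> carrier (dual_space U)} =
    h ` linear_maps (dual_space U) (dual_space U)"
    (is "LinearCombinations.module.span CC M ?G = h ` ?E")
    and "LinearCombinations.submodule CC (LinearCombinations.module.span CC M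
      {h (\<lambda>\<alpha>. \<alpha> u \<odot>\<^bsub>dual_space U\<^esub> \<alpha>0) | u \<alpha>0. u \<in> carrier U \<and> \<alpha>0 \<in> carrier (dual_space U)}) M"
proof -
  interpret M: vectorspace CC M by fact
  note D = vectorspace_dual_space[OF U]
  note cl = vectorspace_closed[OF D]
  have rank1: "(\<lambda>\<alpha>. \<alpha> u \<odot>\<^bsub>dual_space U\<^esub> \<alpha>0) \<in> ?E" if "u \<in> carrier U" "\<alpha>0 \<in> carrier (dual_space U)" for u \<alpha>0
    using that cl by (intro linear_mapsI) (auto simp: dual_space_simps algebra_simps)
  have sumE: "(\<lambda>\<alpha>. X \<alpha> \<oplus>\<^bsub>dual_space U\<^esub> Y \<alpha>) \<in> ?E" if "X \<in> ?E" "Y \<in> ?E" for X Y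
    using that[THEN linear_mapsD(1)] that[THEN linear_mapsD(2)] that[THEN linear_mapsD(3)] cl
    by (intro linear_mapsI) (auto simp: dual_space_simps algebra_simps fun_eq_iff)
  have scE: "(\<lambda>\<alpha>. c \<odot>\<^bsub>dual_space U\<^esub> X \<alpha>) \<in> ?E" if "X \<in> ?E" for c X
    using linear_mapsD[OF that] cl
    by (intro linear_mapsI) (auto simp: dual_space_simps algebra_simps fun_eq_iff)
  have sub: "LinearCombinations.submodule CC (h ` ?E) M"
  proof (rule LinearCombinations.submodule.intro)
    show "module CC M" by (rule vectorspace_CCD[OF M])
    show "h ` ?E \<subseteq> carrier M" using mem by blast
    fix v w assume "v \<in> h ` ?E" "w \<in> h ` ?E"
    then obtain X Y where XY: "X \<in> ?E" "Y \<in> ?E" "v = h X" "w = h Y" by blast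
    then have "v \<oplus>\<^bsub>M\<^esub> w = h (\<lambda>\<alpha>. X \<alpha> \<oplus>\<^bsub>dual_space U\<^esub> Y \<alpha>)"
      using add[OF XY(1,2) sumE[OF XY(1,2)]] by simp
    then show "v \<oplus>\<^bsub>M\<^esub> w \<in> h ` ?E" using sumE XY by blast
  next
    fix c v assume "v \<in> h ` ?E"
    then obtain X where X: "X \<in> ?E" "v = h X" by blast
    then have "c \<odot>\<^bsub>M\<^esub> v = h (\<lambda>\<alpha>. c \<odot>\<^bsub>dual_space U\<^esub> X \<alpha>)" using smult[OF X(1) scE[OF X(1)]] by simp
    then show "c \<odot>\<^bsub>M\<^esub> v \<in> h ` ?E" using scE X by blast
  next
    have "h (\<lambda>\<alpha>. 0 \<odot>\<^bsub>dual_space U\<^esub> \<alpha>) = 0 \<odot>\<^bsub>M\<^esub> h (\<lambda>\<alpha>. \<alpha>)"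
      by (rule smult[OF identity_linear scE[OF identity_linear]]) simp
    also have "\<dots> = \<zero>\<^bsub>M\<^esub>" using vectorspace_closed(4)[OF M] mem[OF identity_linear] by simp
    finally show "\<zero>\<^bsub>M\<^esub> \<in> h ` ?E" using scE[OF identity_linear] by (metis imageI)
  qed
  have GE: "?G \<subseteq> h ` ?E" using rank1 by blast
  have "h ` ?E \<subseteq> carrier M" using mem by blast
  with GE have GM: "?G \<subseteq> carrier M" by (rule order_trans)
  have span: "LinearCombinations.submodule CC (M.span ?G) M" by (rule M.span_is_submodule[OF GM])
  show "LinearCombinations.submodule CC (M.span ?G) M" by (rule span)
  show "M.span ?G = h ` ?E"
  proof
    show "M.span ?G \<subseteq> h ` ?E" by (rule M.span_is_subset[OF GE sub])
    show "h ` ?E \<subseteq> M.span ?G"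
    proof
      fix v assume "v \<in> h ` ?E"
      then obtain X where X: "X \<in> ?E" "v = h X" by blast
      have "\<exists>Z\<in>?E. h Z \<in> M.span ?G \<and>
          (\<forall>\<alpha>\<in>carrier (dual_space U). \<forall>x\<in>carrier U. Z \<alpha> x = (\<Sum>i<k. \<alpha> (e i) * X (\<epsilon> i) x))"
        if "k \<le> n" for k
        using that
      proof (induction k)
        case 0
        have "h (\<lambda>\<alpha>. 0 \<odot>\<^bsub>dual_space U\<^esub> \<alpha>) = 0 \<odot>\<^bsub>M\<^esub> h (\<lambda>\<alpha>. \<alpha>)"
          by (rule smult[OF identity_linear scE[OF identity_linear]]) simp
        also have "\<dots> = \<zero>\<^bsub>M\<^esub>" using vectorspace_closed(4)[OF M] mem[OF identity_linear] by simp
        finally have "h (\<lambda>\<alpha>. 0 \<odot>\<^bsub>dual_space U\<^esub> \<alpha>) \<in> M.span ?G"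
          using LinearCombinations.submodule.zero_closed[OF span] by simp
        moreover have "(0 \<odot>\<^bsub>dual_space U\<^esub> \<alpha>) x = 0" if "x \<in> carrier U" for \<alpha> x
          using that by (simp add: dual_space_simps)
        ultimately show ?case using scE[OF identity_linear]
          by (intro bexI[of _ "\<lambda>\<alpha>. 0 \<odot>\<^bsub>dual_space U\<^esub> \<alpha>"]) simp_all
      next
        case (Suc k)
        then obtain Z where Z: "Z \<in> ?E" "h Z \<in> M.span ?G"
          "\<And>\<alpha> x. \<lbrakk>\<alpha> \<in> carrier (dual_space U); x \<in> carrier U\<rbrakk> \<Longrightarrow> Z \<alpha> x = (\<Sum>i<k. \<alpha> (e i) * X (\<epsilon> i) x)"
          by auto
        have k: "e k \<in> carrier U" "X (\<epsilon> k) \<in> carrier (dual_space U)"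
          using dual_frameD[OF fr] Suc linear_mapsD(1)[OF X(1)] by auto
        let ?R = "\<lambda>\<alpha>. \<alpha> (e k) \<odot>\<^bsub>dual_space U\<^esub> X (\<epsilon> k)"
        have R: "?R \<in> ?E" by (rule rank1[OF k])
        have "h ?R \<in> M.span ?G" using M.in_own_span[OF GM] k by blast
        then have "h (\<lambda>\<alpha>. Z \<alpha> \<oplus>\<^bsub>dual_space U\<^esub> ?R \<alpha>) \<in> M.span ?G"
          using add[OF Z(1) R sumE[OF Z(1) R]] LinearCombinations.submodule.m_closed[OF span Z(2)]
          by simp
        moreover have "(Z \<alpha> \<oplus>\<^bsub>dual_space U\<^esub> ?R \<alpha>) x = (\<Sum>i<Suc k. \<alpha> (e i) * X (\<epsilon> i) x)"
          if "\<alpha> \<in> carrier (dual_space U)" "x \<in> carrier U" for \<alpha> x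
          using that Z(3) by (simp add: dual_space_simps)
        ultimately show ?case
          using sumE[OF Z(1) R] by (intro bexI[of _ "\<lambda>\<alpha>. Z \<alpha> \<oplus>\<^bsub>dual_space U\<^esub> ?R \<alpha>"]) simp_all
      qed
      from this[of n] obtain Z where Z: "Z \<in> ?E" "h Z \<in> M.span ?G"
        "\<And>\<alpha> x. \<lbrakk>\<alpha> \<in> carrier (dual_space U); x \<in> carrier U\<rbrakk> \<Longrightarrow> Z \<alpha> x = (\<Sum>i<n. \<alpha> (e i) * X (\<epsilon> i) x)"
        by auto
      have "X \<alpha> = Z \<alpha>" if \<alpha>: "\<alpha> \<in> carrier (dual_space U)" for \<alpha>
      proof (rule dual_eqI)
        fix x assume x: "x \<in> carrier U"
        \<comment> \<open>\<open>\<alpha> \<mapsto> (X \<alpha>) x\<close> is a functional on \<open>U\<^sup>*\<close>\<close>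
        have "(\<lambda>\<alpha>\<in>carrier (dual_space U). X \<alpha> x) \<in> carrier (dual_space (dual_space U))"
          using x cl linear_mapsD[OF X(1)] by (intro dual_memI) (auto simp: dual_space_simps)
        from bidual_functional_expansion[OF U fr this \<alpha>]
        show "X \<alpha> x = Z \<alpha> x"
          using \<alpha> x dual_frameD(2)[OF fr] by (simp add: Z(3))
      qed (use linear_mapsD[OF X(1)] linear_mapsD[OF Z(1)] \<alpha> in auto)
      then have "h X = 1 \<odot>\<^bsub>M\<^esub> h Z"
        by (intro smult[OF Z(1) X(1)])
          (simp add: vectorspace_closed(5)[OF D] linear_mapsD(1)[OF Z(1)])
      then show "v \<in> M.span ?G"
        using Z X vectorspace_closed(5)[OF M mem[OF Z(1)]] by simp
    qed
  qed
qed

lemma generators_reindex: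
  assumes "\<And>u a. \<lbrakk>u \<in> A; a \<in> D\<rbrakk> \<Longrightarrow> F u (c a) = G u a"
  shows "{F u s | u s. u \<in> A \<and> s \<in> c ` D} = {G u a | u a. u \<in> A \<and> a \<in> D}"
  using assms by (safe; metis imageI)

lemma image_tensor1_eq:
  assumes U: "vectorspace CC U" and V: "vectorspace CC V" and W: "vectorspace CC W"
    and fr: "dual_frame U n e \<epsilon>" and t: "t \<in> carrier (tensor_space U V W)"
  shows "image_tensor1 U V W t =
      (\<lambda>X. tensor_pullback U V W X (\<lambda>\<beta>. \<beta>) (\<lambda>\<gamma>. \<gamma>) t) ` linear_maps (dual_space U) (dual_space U)"
      (is "_ = ?h ` ?E")
    and "LinearCombinations.submodule CC (image_tensor1 U V W t) (tensor_space U V W)"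
proof -
  note pull = tensor_pullback_mem[OF U V W _ identity_linear identity_linear t]
  note T = vectorspace_tensor_space[OF U V W]
  have gen: "{\<lambda>(\<alpha>, \<beta>, \<gamma>)\<in>dual_triples U V W. \<alpha> u * s (\<beta>, \<gamma>) | u s.
        u \<in> carrier U \<and> s \<in> contract1 U V W t ` carrier (dual_space U)} =
      {?h (\<lambda>\<alpha>. \<alpha> u \<odot>\<^bsub>dual_space U\<^esub> \<alpha>0) | u \<alpha>0. u \<in> carrier U \<and> \<alpha>0 \<in> carrier (dual_space U)}"
    by (rule generators_reindex)
      (auto simp: tensor_pullback_def contract1_def tensor_linear[OF t] intro!: restrict_ext)
  have add: "?h Z = ?h X \<oplus>\<^bsub>tensor_space U V W\<^esub> ?h Y"
    if "X \<in> ?E" "Y \<in> ?E" "Z \<in> ?E"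
      "\<And>\<alpha>. \<alpha> \<in> carrier (dual_space U) \<Longrightarrow> Z \<alpha> = X \<alpha> \<oplus>\<^bsub>dual_space U\<^esub> Y \<alpha>" for X Y Z
    using that by (intro tensor_eqI[OF pull vectorspace_closed(1)[OF T pull pull]])
      (simp_all add: tensor_space_simps tensor_pullback_apply tensor_linear[OF t] linear_mapsD(1))
  have smult: "?h Z = c \<odot>\<^bsub>tensor_space U V W\<^esub> ?h X"
    if "X \<in> ?E" "Z \<in> ?E"
      "\<And>\<alpha>. \<alpha> \<in> carrier (dual_space U) \<Longrightarrow> Z \<alpha> = c \<odot>\<^bsub>dual_space U\<^esub> X \<alpha>" for c X Z
    using that by (intro tensor_eqI[OF pull vectorspace_closed(2)[OF T pull]])
      (simp_all add: tensor_space_simps tensor_pullback_apply tensor_linear[OF t] linear_mapsD(1))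
  note span = span_rank_one_image[OF U fr T, of ?h, OF pull add smult]
  show "image_tensor1 U V W t = ?h ` ?E"
    unfolding image_tensor1_def gen by (rule span(1))
  show "LinearCombinations.submodule CC (image_tensor1 U V W t) (tensor_space U V W)"
    unfolding image_tensor1_def gen by (rule span(2))
qed

lemma image_tensor2_eq:
  assumes U: "vectorspace CC U" and V: "vectorspace CC V" and W: "vectorspace CC W"
    and fr: "dual_frame V n e \<epsilon>" and t: "t \<in> carrier (tensor_space U V W)"
  shows "image_tensor2 U V W t =
      (\<lambda>Y. tensor_pullback U V W (\<lambda>\<alpha>. \<alpha>) Y (\<lambda>\<gamma>. \<gamma>) t) ` linear_maps (dual_space V) (dual_space V)"
      (is "_ = ?h ` ?E")
    and "LinearCombinations.submodule CC (image_tensor2 U V W t) (tensor_space U V W)"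
proof -
  note pull = tensor_pullback_mem[OF U V W identity_linear _ identity_linear t]
  note T = vectorspace_tensor_space[OF U V W]
  have gen: "{\<lambda>(\<alpha>, \<beta>, \<gamma>)\<in>dual_triples U V W. \<beta> v * s (\<alpha>, \<gamma>) | v s.
        v \<in> carrier V \<and> s \<in> contract2 U V W t ` carrier (dual_space V)} =
      {?h (\<lambda>\<beta>. \<beta> v \<odot>\<^bsub>dual_space V\<^esub> \<beta>0) | v \<beta>0. v \<in> carrier V \<and> \<beta>0 \<in> carrier (dual_space V)}"
    by (rule generators_reindex)
      (auto simp: tensor_pullback_def contract2_def tensor_linear[OF t] intro!: restrict_ext)
  have add: "?h Z = ?h X \<oplus>\<^bsub>tensor_space U V W\<^esub> ?h Y"
    if "X \<in> ?E" "Y \<in> ?E" "Z \<in> ?E"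
      "\<And>\<beta>. \<beta> \<in> carrier (dual_space V) \<Longrightarrow> Z \<beta> = X \<beta> \<oplus>\<^bsub>dual_space V\<^esub> Y \<beta>" for X Y Z
    using that by (intro tensor_eqI[OF pull vectorspace_closed(1)[OF T pull pull]])
      (simp_all add: tensor_space_simps tensor_pullback_apply tensor_linear[OF t] linear_mapsD(1))
  have smult: "?h Z = c \<odot>\<^bsub>tensor_space U V W\<^esub> ?h X"
    if "X \<in> ?E" "Z \<in> ?E"
      "\<And>\<beta>. \<beta> \<in> carrier (dual_space V) \<Longrightarrow> Z \<beta> = c \<odot>\<^bsub>dual_space V\<^esub> X \<beta>" for c X Z
    using that by (intro tensor_eqI[OF pull vectorspace_closed(2)[OF T pull]])
      (simp_all add: tensor_space_simps tensor_pullback_apply tensor_linear[OF t] linear_mapsD(1))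
  note span = span_rank_one_image[OF V fr T, of ?h, OF pull add smult]
  show "image_tensor2 U V W t = ?h ` ?E"
    unfolding image_tensor2_def gen by (rule span(1))
  show "LinearCombinations.submodule CC (image_tensor2 U V W t) (tensor_space U V W)"
    unfolding image_tensor2_def gen by (rule span(2))
qed

lemma image_tensor3_eq:
  assumes U: "vectorspace CC U" and V: "vectorspace CC V" and W: "vectorspace CC W"
    and fr: "dual_frame W n e \<epsilon>" and t: "t \<in> carrier (tensor_space U V W)"
  shows "image_tensor3 U V W t =
      (\<lambda>Z. tensor_pullback U V W (\<lambda>\<alpha>. \<alpha>) (\<lambda>\<beta>. \<beta>) Z t) ` linear_maps (dual_space W) (dual_space W)"
      (is "_ = ?h ` ?E")
    and "LinearCombinations.submodule CC (image_tensor3 U V W t) (tensor_space U V W)"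
proof -
  note pull = tensor_pullback_mem[OF U V W identity_linear identity_linear _ t]
  note T = vectorspace_tensor_space[OF U V W]
  have gen: "{\<lambda>(\<alpha>, \<beta>, \<gamma>)\<in>dual_triples U V W. \<gamma> w * s (\<alpha>, \<beta>) | w s.
        w \<in> carrier W \<and> s \<in> contract3 U V W t ` carrier (dual_space W)} =
      {?h (\<lambda>\<gamma>. \<gamma> w \<odot>\<^bsub>dual_space W\<^esub> \<gamma>0) | w \<gamma>0. w \<in> carrier W \<and> \<gamma>0 \<in> carrier (dual_space W)}"
    by (rule generators_reindex)
      (auto simp: tensor_pullback_def contract3_def tensor_linear[OF t] intro!: restrict_ext)
  have add: "?h Z = ?h X \<oplus>\<^bsub>tensor_space U V W\<^esub> ?h Y"
    if "X \<in> ?E" "Y \<in> ?E" "Z \<in> ?E"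
      "\<And>\<gamma>. \<gamma> \<in> carrier (dual_space W) \<Longrightarrow> Z \<gamma> = X \<gamma> \<oplus>\<^bsub>dual_space W\<^esub> Y \<gamma>" for X Y Z
    using that by (intro tensor_eqI[OF pull vectorspace_closed(1)[OF T pull pull]])
      (simp_all add: tensor_space_simps tensor_pullback_apply tensor_linear[OF t] linear_mapsD(1))
  have smult: "?h Z = c \<odot>\<^bsub>tensor_space U V W\<^esub> ?h X"
    if "X \<in> ?E" "Z \<in> ?E"
      "\<And>\<gamma>. \<gamma> \<in> carrier (dual_space W) \<Longrightarrow> Z \<gamma> = c \<odot>\<^bsub>dual_space W\<^esub> X \<gamma>" for c X Z
    using that by (intro tensor_eqI[OF pull vectorspace_closed(2)[OF T pull]])
      (simp_all add: tensor_space_simps tensor_pullback_apply tensor_linear[OF t] linear_mapsD(1))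
  note span = span_rank_one_image[OF W fr T, of ?h, OF pull add smult]
  show "image_tensor3 U V W t = ?h ` ?E"
    unfolding image_tensor3_def gen by (rule span(1))
  show "LinearCombinations.submodule CC (image_tensor3 U V W t) (tensor_space U V W)"
    unfolding image_tensor3_def gen by (rule span(2))
qed

lemma tensor_expansion:
  assumes U: "vectorspace CC U" "dual_frame U n1 e1 \<epsilon>1" and V: "vectorspace CC V" "dual_frame V n2 e2 \<epsilon>2"
    and W: "vectorspace CC W" "dual_frame W n3 e3 \<epsilon>3" and t: "t \<in> carrier (tensor_space U V W)"
    and \<alpha>: "\<alpha> \<in> carrier (dual_space U)" and \<beta>: "\<beta> \<in> carrier (dual_space V)"
    and \<gamma>: "\<gamma> \<in> carrier (dual_space W)"
  shows "t (\<alpha>, \<beta>, \<gamma>) =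
    (\<Sum>i<n1. \<alpha> (e1 i) * (\<Sum>j<n2. \<beta> (e2 j) * (\<Sum>k<n3. \<gamma> (e3 k) * t (\<epsilon>1 i, \<epsilon>2 j, \<epsilon>3 k))))"
proof -
  note fr = dual_frameD(2)[OF U(2)] dual_frameD(2)[OF V(2)] dual_frameD(2)[OF W(2)]
  note clU = vectorspace_closed[OF vectorspace_dual_space[OF U(1)]]
    and clV = vectorspace_closed[OF vectorspace_dual_space[OF V(1)]]
    and clW = vectorspace_closed[OF vectorspace_dual_space[OF W(1)]]
  have 3: "t (\<alpha>', \<beta>', \<gamma>) = (\<Sum>k<n3. \<gamma> (e3 k) * t (\<alpha>', \<beta>', \<epsilon>3 k))"
    if "\<alpha>' \<in> carrier (dual_space U)" "\<beta>' \<in> carrier (dual_space V)" for \<alpha>' \<beta>'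
  proof -
    have "(\<lambda>\<gamma>\<in>carrier (dual_space W). t (\<alpha>', \<beta>', \<gamma>)) \<in> carrier (dual_space (dual_space W))"
      using that by (intro dual_memI) (simp_all add: tensor_linear[OF t] clW)
    from bidual_functional_expansion[OF W this \<gamma>] show ?thesis using fr \<gamma> by simp
  qed
  have 2: "t (\<alpha>', \<beta>, \<gamma>) = (\<Sum>j<n2. \<beta> (e2 j) * t (\<alpha>', \<epsilon>2 j, \<gamma>))"
    if "\<alpha>' \<in> carrier (dual_space U)" for \<alpha>'
  proof -
    have "(\<lambda>\<beta>\<in>carrier (dual_space V). t (\<alpha>', \<beta>, \<gamma>)) \<in> carrier (dual_space (dual_space V))"
      using that \<gamma> by (intro dual_memI) (simp_all add: tensor_linear[OF t] clV)
    from bidual_functional_expansion[OF V this \<beta>] show ?thesis using fr \<beta> by simp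
  qed
  have 1: "t (\<alpha>, \<beta>, \<gamma>) = (\<Sum>i<n1. \<alpha> (e1 i) * t (\<epsilon>1 i, \<beta>, \<gamma>))"
  proof -
    have "(\<lambda>\<alpha>\<in>carrier (dual_space U). t (\<alpha>, \<beta>, \<gamma>)) \<in> carrier (dual_space (dual_space U))"
      using \<beta> \<gamma> by (intro dual_memI) (simp_all add: tensor_linear[OF t] clU)
    from bidual_functional_expansion[OF U this \<alpha>] show ?thesis using fr \<alpha> by simp
  qed
  show ?thesis
    unfolding 1 by (simp add: 2 3 fr cong: sum.cong_simp)
qed

lemma vectorspace_Cvec: "vectorspace CC (Cvec m)"
  by (rule vec_vs)

text \<open>
  A tensor is determined by its values on the functionals of dual frames; an enumeration \<open>q\<close> of the
  index triples turns these values into a coordinate vector.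
\<close>

lemma fin_dim_tensor_space:
  assumes U: "vectorspace CC U" "vectorspace.fin_dim CC U" and V: "vectorspace CC V" "vectorspace.fin_dim CC V"
    and W: "vectorspace CC W" "vectorspace.fin_dim CC W"
  shows "vectorspace.fin_dim CC (tensor_space U V W)"
proof -
  obtain n1 e1 \<epsilon>1 where frU: "dual_frame U n1 e1 \<epsilon>1" using dual_frame_exists[OF U] .
  obtain n2 e2 \<epsilon>2 where frV: "dual_frame V n2 e2 \<epsilon>2" using dual_frame_exists[OF V] .
  obtain n3 e3 \<epsilon>3 where frW: "dual_frame W n3 e3 \<epsilon>3" using dual_frame_exists[OF W] .
  note fr = dual_frameD(2)[OF frU] dual_frameD(2)[OF frV] dual_frameD(2)[OF frW]
  let ?I = "{..<n1} \<times> {..<n2} \<times> {..<n3}"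
  obtain q where q: "bij_betw q {0..<card ?I} ?I"
    using ex_bij_betw_nat_finite[of ?I] by auto
  have q_mem: "i < n1 \<and> j < n2 \<and> k < n3" if "q p = (i, j, k)" "p < n1 * (n2 * n3)" for p i j k
    using bspec[OF bij_betwE[OF q], of p] that by simp
  define F :: "_ \<Rightarrow> complex vec" where
    "F t = vec (card ?I) (\<lambda>p. case q p of (i, j, k) \<Rightarrow> t (\<epsilon>1 i, \<epsilon>2 j, \<epsilon>3 k))" for t
  have lin: "F \<in> linear_maps (tensor_space U V W) (Cvec (card ?I))"
  proof (rule linear_mapsI)
    fix s t
    show "F (s \<oplus>\<^bsub>tensor_space U V W\<^esub> t) = F s \<oplus>\<^bsub>Cvec (card ?I)\<^esub> F t"
      by (intro eq_vecI)
        (auto simp: F_def module_vec_simps tensor_space_simps fr split: prod.split dest: q_mem)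
    fix c
    show "F (c \<odot>\<^bsub>tensor_space U V W\<^esub> t) = c \<odot>\<^bsub>Cvec (card ?I)\<^esub> F t"
      by (intro eq_vecI)
        (auto simp: F_def module_vec_simps tensor_space_simps fr split: prod.split dest: q_mem)
  qed (simp add: F_def module_vec_simps)
  have inj: "inj_on F (carrier (tensor_space U V W))"
  proof (rule inj_onI)
    fix s t assume s: "s \<in> carrier (tensor_space U V W)" and t: "t \<in> carrier (tensor_space U V W)"
      and eq: "F s = F t"
    have "s (\<epsilon>1 i, \<epsilon>2 j, \<epsilon>3 k) = t (\<epsilon>1 i, \<epsilon>2 j, \<epsilon>3 k)" if "i < n1" "j < n2" "k < n3" for i j k
    proof -
      have "(i, j, k) \<in> q ` {0..<card ?I}" using q that by (simp add: bij_betw_def)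
      then obtain p where p: "p < card ?I" "q p = (i, j, k)" by auto
      from arg_cong[OF eq, of "\<lambda>v. v $ p"] p(1) show ?thesis
        by (simp add: F_def p(2) del: card_cartesian_product)
    qed
    then show "s = t"
      by (intro tensor_eqI[OF s t])
        (simp add: tensor_expansion[OF U(1) frU V(1) frV W(1) frW s] tensor_expansion[OF U(1) frU V(1) frV W(1) frW t])
  qed
  show ?thesis
    by (rule injective_linear_dim_le(1)[OF vectorspace_tensor_space[OF U(1) V(1) W(1)] vectorspace_Cvec lin inj])
      (rule vec_space.fin_dim)
qed

section \<open>The intersection space\<close>

abbreviation intersection_space where
  "intersection_space U V W t \<equiv> (tensor_space U V W)
     \<lparr>carrier := image_tensor1 U V W t \<inter> image_tensor2 U V W t \<inter> image_tensor3 U V W t\<rparr>"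

lemma intersection_space_finite_dim:
  assumes U: "vectorspace CC U" "vectorspace.fin_dim CC U" and V: "vectorspace CC V" "vectorspace.fin_dim CC V"
    and W: "vectorspace CC W" "vectorspace.fin_dim CC W" and t: "t \<in> carrier (tensor_space U V W)"
  shows "vectorspace CC (intersection_space U V W t)"
    and "vectorspace.fin_dim CC (intersection_space U V W t)"
    and "carrier (intersection_space U V W t) \<subseteq> carrier (tensor_space U V W)"
proof -
  obtain n1 e1 \<epsilon>1 where frU: "dual_frame U n1 e1 \<epsilon>1" using dual_frame_exists[OF U] .
  obtain n2 e2 \<epsilon>2 where frV: "dual_frame V n2 e2 \<epsilon>2" using dual_frame_exists[OF V] .
  obtain n3 e3 \<epsilon>3 where frW: "dual_frame W n3 e3 \<epsilon>3" using dual_frame_exists[OF W] .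
  note T = vectorspace_tensor_space[OF U(1) V(1) W(1)]
  note s1 = image_tensor1_eq(2)[OF U(1) V(1) W(1) frU t]
    and s2 = image_tensor2_eq(2)[OF U(1) V(1) W(1) frV t]
    and s3 = image_tensor3_eq(2)[OF U(1) V(1) W(1) frW t]
  let ?I = "image_tensor1 U V W t \<inter> image_tensor2 U V W t \<inter> image_tensor3 U V W t"
  have sub: "LinearCombinations.submodule CC ?I (tensor_space U V W)"
  proof (rule LinearCombinations.submodule.intro)
    show "module CC (tensor_space U V W)" by (rule vectorspace_CCD[OF T])
    show "?I \<subseteq> carrier (tensor_space U V W)"
      using LinearCombinations.submodule.subset[OF s1] by blast
  qed (use LinearCombinations.submodule.m_closed[OF s1] LinearCombinations.submodule.m_closed[OF s2]
      LinearCombinations.submodule.m_closed[OF s3] LinearCombinations.submodule.zero_closed[OF s1]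
      LinearCombinations.submodule.zero_closed[OF s2] LinearCombinations.submodule.zero_closed[OF s3]
      LinearCombinations.submodule.smult_closed[OF s1] LinearCombinations.submodule.smult_closed[OF s2]
      LinearCombinations.submodule.smult_closed[OF s3] in auto)
  then show I: "vectorspace CC (intersection_space U V W t)"
    by (intro vectorspace_CCI module.submodule_is_module[OF vectorspace_CCD[OF T]])
  show le: "carrier (intersection_space U V W t) \<subseteq> carrier (tensor_space U V W)"
    using LinearCombinations.submodule.subset[OF sub] by simp
  show "vectorspace.fin_dim CC (intersection_space U V W t)"
  proof (rule injective_linear_dim_le(1)[OF I T _ _ fin_dim_tensor_space[OF U V W]])
    show "(\<lambda>s. s) \<in> linear_maps (intersection_space U V W t) (tensor_space U V W)"
      by (rule linear_mapsI) (use le in auto)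
  qed simp
qed

section \<open>The tensor of a bilinear map\<close>

text \<open>By biduality the evaluations are all the functionals on a dual space.\<close>

lemma tensor_eqI_evaluation:
  assumes U: "vectorspace CC U" "vectorspace.fin_dim CC U" and V: "vectorspace CC V" "vectorspace.fin_dim CC V"
    and s: "s \<in> carrier (tensor_space (dual_space U) (dual_space V) W)"
    and t: "t \<in> carrier (tensor_space (dual_space U) (dual_space V) W)"
    and eq: "\<And>u v \<gamma>. \<lbrakk>u \<in> carrier U; v \<in> carrier V; \<gamma> \<in> carrier (dual_space W)\<rbrakk> \<Longrightarrow>
      s (evaluation U u, evaluation V v, \<gamma>) = t (evaluation U u, evaluation V v, \<gamma>)"
  shows "s = t"
proof (rule tensor_eqI[OF s t])
  obtain n1 e1 \<epsilon>1 where frU: "dual_frame U n1 e1 \<epsilon>1" using dual_frame_exists[OF U] .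
  obtain n2 e2 \<epsilon>2 where frV: "dual_frame V n2 e2 \<epsilon>2" using dual_frame_exists[OF V] .
  fix \<Phi> \<Psi> \<gamma> assume \<Phi>: "\<Phi> \<in> carrier (dual_space (dual_space U))"
    and \<Psi>: "\<Psi> \<in> carrier (dual_space (dual_space V))" and \<gamma>: "\<gamma> \<in> carrier (dual_space W)"
  obtain u where "u \<in> carrier U" "\<Phi> = evaluation U u" using bidual_evaluation[OF U(1) frU \<Phi>] .
  moreover obtain v where "v \<in> carrier V" "\<Psi> = evaluation V v"
    using bidual_evaluation[OF V(1) frV \<Psi>] .
  ultimately show "s (\<Phi>, \<Psi>, \<gamma>) = t (\<Phi>, \<Psi>, \<gamma>)" using eq \<gamma> by simp
qed

lemma tensor_of_bilinear_eqI:
  assumes U: "vectorspace CC U" "vectorspace.fin_dim CC U" and V: "vectorspace CC V" "vectorspace.fin_dim CC V"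
    and t: "t \<in> carrier (tensor_space (dual_space U) (dual_space V) W)"
    and val: "\<And>u v \<gamma>. \<lbrakk>u \<in> carrier U; v \<in> carrier V; \<gamma> \<in> carrier (dual_space W)\<rbrakk> \<Longrightarrow>
      t (evaluation U u, evaluation V v, \<gamma>) = \<gamma> (f u v)"
  shows "tensor_of_bilinear U V W f = t"
  unfolding tensor_of_bilinear_def
proof (rule the_equality)
  show "t \<in> carrier (tensor_space (dual_space U) (dual_space V) W) \<and>
    (\<forall>u\<in>carrier U. \<forall>v\<in>carrier V. \<forall>\<gamma>\<in>carrier (dual_space W).
       t (evaluation U u, evaluation V v, \<gamma>) = \<gamma> (f u v))"
    using t val by blast
qed (use tensor_eqI_evaluation[OF U V _ t] val in auto)

lemma tensor_of_bilinear:
  assumes U: "vectorspace CC U" "vectorspace.fin_dim CC U" and V: "vectorspace CC V" "vectorspace.fin_dim CC V"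
    and W: "vectorspace CC W"
    and f1: "\<And>v. v \<in> carrier V \<Longrightarrow> (\<lambda>u. f u v) \<in> linear_maps U W"
    and f2: "\<And>u. u \<in> carrier U \<Longrightarrow> (\<lambda>v. f u v) \<in> linear_maps V W"
  shows "tensor_of_bilinear U V W f \<in> carrier (tensor_space (dual_space U) (dual_space V) W)"
    and "\<lbrakk>u \<in> carrier U; v \<in> carrier V; \<gamma> \<in> carrier (dual_space W)\<rbrakk> \<Longrightarrow>
      tensor_of_bilinear U V W f (evaluation U u, evaluation V v, \<gamma>) = \<gamma> (f u v)"
proof -
  obtain n1 e1 \<epsilon>1 where frU: "dual_frame U n1 e1 \<epsilon>1" using dual_frame_exists[OF U] .
  obtain n2 e2 \<epsilon>2 where frV: "dual_frame V n2 e2 \<epsilon>2" using dual_frame_exists[OF V] .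
  note fr1 = dual_frameD(1,2)[OF frU] and fr2 = dual_frameD(1,2)[OF frV]
  note DU = vectorspace_dual_space[OF U(1)] and DV = vectorspace_dual_space[OF V(1)]
    and DW = vectorspace_dual_space[OF W]
  note cl = vectorspace_closed(1,2)[OF vectorspace_dual_space[OF DU]]
    vectorspace_closed(1,2)[OF vectorspace_dual_space[OF DV]]
    vectorspace_closed(1,2)[OF vectorspace_dual_space[OF W]]
  note fcl = linear_mapsD(1)[OF f1]
  \<comment> \<open>the tensor \<open>\<Sum>\<^sub>i\<^sub>j \<epsilon>\<^sub>i \<otimes> \<epsilon>\<^sub>j \<otimes> f(e\<^sub>i, e\<^sub>j)\<close>\<close>
  define t where "t = (\<lambda>(\<Phi>, \<Psi>, \<gamma>)\<in>dual_triples (dual_space U) (dual_space V) W.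
    \<Sum>i<n1. \<Sum>j<n2. \<Phi> (\<epsilon>1 i) * \<Psi> (\<epsilon>2 j) * \<gamma> (f (e1 i) (e2 j)))"
  have t: "t \<in> carrier (tensor_space (dual_space U) (dual_space V) W)"
    by (intro tensor_memI linear_mapsI)
      (auto simp: t_def cl[unfolded dual_space_simps] dual_space_simps fr1 fr2 fcl sum.distrib sum_distrib_left algebra_simps)
  have val: "t (evaluation U u, evaluation V v, \<gamma>) = \<gamma> (f u v)"
    if u: "u \<in> carrier U" and v: "v \<in> carrier V" and \<gamma>: "\<gamma> \<in> carrier (dual_space W)" for u v \<gamma>
  proof -
    have g1: "(\<lambda>u\<in>carrier U. \<gamma> (f u v)) \<in> carrier (dual_space U)" if v: "v \<in> carrier V" for v
      using linear_mapsD[OF f1[OF v]] vectorspace_closed[OF U(1)]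
      by (intro dual_memI) (auto simp: dual_memD[OF \<gamma>])
    have g2: "(\<lambda>v\<in>carrier V. \<gamma> (f u v)) \<in> carrier (dual_space V)"
      using linear_mapsD[OF f2[OF u]] vectorspace_closed[OF V(1)]
      by (intro dual_memI) (auto simp: dual_memD[OF \<gamma>])
    have "\<gamma> (f u v) = (\<Sum>j<n2. \<epsilon>2 j v * \<gamma> (f u (e2 j)))"
      using dual_frameD(3)[OF frV v g2] v fr2 by simp
    also have "\<dots> = (\<Sum>j<n2. \<epsilon>2 j v * (\<Sum>i<n1. \<epsilon>1 i u * \<gamma> (f (e1 i) (e2 j))))"
      using dual_frameD(3)[OF frU u g1] u fr1 fr2 by (intro sum.cong) auto
    also have "\<dots> = (\<Sum>j<n2. \<Sum>i<n1. \<epsilon>1 i u * \<epsilon>2 j v * \<gamma> (f (e1 i) (e2 j)))"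
      by (simp add: sum_distrib_left algebra_simps)
    also have "\<dots> = t (evaluation U u, evaluation V v, \<gamma>)"
      using evaluation_in_bidual[OF U(1) u] evaluation_in_bidual[OF V(1) v] \<gamma> fr1 fr2
      by (subst sum.swap) (simp add: t_def)
    finally show ?thesis by simp
  qed
  have eq: "tensor_of_bilinear U V W f = t"
    by (rule tensor_of_bilinear_eqI[OF U V t val])
  show "tensor_of_bilinear U V W f \<in> carrier (tensor_space (dual_space U) (dual_space V) W)"
    using t eq by simp
  show "\<lbrakk>u \<in> carrier U; v \<in> carrier V; \<gamma> \<in> carrier (dual_space W)\<rbrakk> \<Longrightarrow>
      tensor_of_bilinear U V W f (evaluation U u, evaluation V v, \<gamma>) = \<gamma> (f u v)"
    using val eq by simp
qed

text \<open>
  By biduality an element of \<open>U\<^sup>*\<^sup>*\<close> is an evaluation at some \<open>x\<close>, and contracting with it leaves the tensor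
  of \<open>f x\<close>.  So the three injectivity conditions become conditions on \<open>f\<close>.
\<close>

lemma concise_tensor_of_bilinear:
  assumes U: "vectorspace CC U" "vectorspace.fin_dim CC U" and V: "vectorspace CC V" "vectorspace.fin_dim CC V"
    and W: "vectorspace CC W" "vectorspace.fin_dim CC W"
    and f1: "\<And>v. v \<in> carrier V \<Longrightarrow> (\<lambda>u. f u v) \<in> linear_maps U W"
    and f2: "\<And>u. u \<in> carrier U \<Longrightarrow> (\<lambda>v. f u v) \<in> linear_maps V W"
    and inj1: "\<And>x y. \<lbrakk>x \<in> carrier U; y \<in> carrier U; \<And>v. v \<in> carrier V \<Longrightarrow> f x v = f y v\<rbrakk> \<Longrightarrow> x = y"
    and inj2: "\<And>x y. \<lbrakk>x \<in> carrier V; y \<in> carrier V; \<And>u. u \<in> carrier U \<Longrightarrow> f u x = f u y\<rbrakk> \<Longrightarrow> x = y"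
    and span: "\<And>\<gamma> \<delta>. \<lbrakk>\<gamma> \<in> carrier (dual_space W); \<delta> \<in> carrier (dual_space W);
      \<And>u v. \<lbrakk>u \<in> carrier U; v \<in> carrier V\<rbrakk> \<Longrightarrow> \<gamma> (f u v) = \<delta> (f u v)\<rbrakk> \<Longrightarrow> \<gamma> = \<delta>"
  shows "concise (dual_space U) (dual_space V) W (tensor_of_bilinear U V W f)"
proof -
  obtain n1 e1 \<epsilon>1 where frU: "dual_frame U n1 e1 \<epsilon>1" using dual_frame_exists[OF U] .
  obtain n2 e2 \<epsilon>2 where frV: "dual_frame V n2 e2 \<epsilon>2" using dual_frame_exists[OF V] .
  obtain n3 e3 \<epsilon>3 where frW: "dual_frame W n3 e3 \<epsilon>3" using dual_frame_exists[OF W] .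
  let ?T = "tensor_of_bilinear U V W f"
  note val = tensor_of_bilinear(2)[OF U V W(1) f1 f2]
  note ev = evaluation_in_bidual[OF U(1)] evaluation_in_bidual[OF V(1)]
  note fcl = linear_mapsD(1)[OF f1]
  show ?thesis
    unfolding concise_def
  proof (intro conjI inj_onI)
    fix \<Phi> \<Psi> assume \<Phi>: "\<Phi> \<in> carrier (dual_space (dual_space U))" and \<Psi>: "\<Psi> \<in> carrier (dual_space (dual_space U))"
      and eq: "contract1 (dual_space U) (dual_space V) W ?T \<Phi> = contract1 (dual_space U) (dual_space V) W ?T \<Psi>"
    obtain x where x: "x \<in> carrier U" "\<Phi> = evaluation U x" using bidual_evaluation[OF U(1) frU \<Phi>] .
    obtain y where y: "y \<in> carrier U" "\<Psi> = evaluation U y" using bidual_evaluation[OF U(1) frU \<Psi>] .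
    have "f x v = f y v" if v: "v \<in> carrier V" for v
    proof (rule dual_frameD(4)[OF frW])
      fix \<gamma> assume "\<gamma> \<in> carrier (dual_space W)"
      then show "\<gamma> (f x v) = \<gamma> (f y v)"
        using fun_cong[OF eq, of "(evaluation V v, \<gamma>)"] x y v ev val by (simp add: contract1_def)
    qed (use fcl v x y in auto)
    then show "\<Phi> = \<Psi>" using inj1 x y by blast
  next
    fix \<Phi> \<Psi> assume \<Phi>: "\<Phi> \<in> carrier (dual_space (dual_space V))" and \<Psi>: "\<Psi> \<in> carrier (dual_space (dual_space V))"
      and eq: "contract2 (dual_space U) (dual_space V) W ?T \<Phi> = contract2 (dual_space U) (dual_space V) W ?T \<Psi>"
    obtain x where x: "x \<in> carrier V" "\<Phi> = evaluation V x" using bidual_evaluation[OF V(1) frV \<Phi>] .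
    obtain y where y: "y \<in> carrier V" "\<Psi> = evaluation V y" using bidual_evaluation[OF V(1) frV \<Psi>] .
    have "f u x = f u y" if u: "u \<in> carrier U" for u
    proof (rule dual_frameD(4)[OF frW])
      fix \<gamma> assume "\<gamma> \<in> carrier (dual_space W)"
      then show "\<gamma> (f u x) = \<gamma> (f u y)"
        using fun_cong[OF eq, of "(evaluation U u, \<gamma>)"] x y u ev val by (simp add: contract2_def)
    qed (use fcl u x y in auto)
    then show "\<Phi> = \<Psi>" using inj2 x y by blast
  next
    fix \<gamma> \<delta> assume \<gamma>: "\<gamma> \<in> carrier (dual_space W)" and \<delta>: "\<delta> \<in> carrier (dual_space W)"
      and eq: "contract3 (dual_space U) (dual_space V) W ?T \<gamma> = contract3 (dual_space U) (dual_space V) W ?T \<delta>"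
    show "\<gamma> = \<delta>"
    proof (rule span[OF \<gamma> \<delta>])
      fix u v assume "u \<in> carrier U" "v \<in> carrier V"
      then show "\<gamma> (f u v) = \<delta> (f u v)"
        using fun_cong[OF eq, of "(evaluation U u, evaluation V v)"] \<gamma> \<delta> ev val by (simp add: contract3_def)
    qed
  qed
qed

section \<open>Homomorphisms from a tensor product of modules\<close>

locale module_pair =
  M?: Module.module R M + N?: Module.module R N
  for R :: "('r, 'x) ring_scheme" (structure) and M :: "('r, 'm) module" and N :: "('r, 'n) module"
begin

abbreviation "G \<equiv> free_Abelian_group (carrier M \<times> carrier N)"
abbreviation "K \<equiv> tensor_kernel R M N"
abbreviation "cls \<equiv> tensor_class R M N"

abbreviation scale :: "'r \<Rightarrow> (('m \<times> 'n) \<Rightarrow>\<^sub>0 int) \<Rightarrow> (('m \<times> 'n) \<Rightarrow>\<^sub>0 int)" where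
  "scale r \<equiv> frag_extend (\<lambda>(x, y). frag_of (r \<odot>\<^bsub>M\<^esub> x, y))"

lemma rels_carrier: "tensor_rels R M N \<subseteq> carrier G"
proof -
  have "frag_of p - frag_of q - frag_of s \<in> carrier G" "frag_of p - frag_of q \<in> carrier G"
    if "p \<in> carrier M \<times> carrier N" "q \<in> carrier M \<times> carrier N" "s \<in> carrier M \<times> carrier N" for p q s
    using that by (auto dest!: subsetD[OF keys_diff])
  then show ?thesis unfolding tensor_rels_def by auto
qed

lemma kernel_subgroup: "subgroup K G"
  unfolding tensor_kernel_def by (rule group.generate_is_subgroup[OF group_free_Abelian_group rels_carrier])

lemma kernel_normal: "K \<lhd> G"
  by (rule comm_group.normal_iff_subgroup[OF abelian_free_Abelian_group, THEN iffD2, OF kernel_subgroup])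

lemma kernel_carrier: "u \<in> K \<Longrightarrow> u \<in> carrier G"
  using subgroup.subset[OF kernel_subgroup] by blast

lemma kernel_uminus: "u \<in> K \<Longrightarrow> - u \<in> K"
  using subgroup.m_inv_closed[OF kernel_subgroup, of u] kernel_carrier[of u] by simp

lemma kernel_add: "\<lbrakk>u \<in> K; v \<in> K\<rbrakk> \<Longrightarrow> u + v \<in> K"
  using subgroup.m_closed[OF kernel_subgroup, of u v] by simp

lemma kernel_zero: "0 \<in> K"
  using subgroup.one_closed[OF kernel_subgroup] by simp

lemma kernel_rel: "u \<in> tensor_rels R M N \<Longrightarrow> u \<in> K"
  unfolding tensor_kernel_def by (rule generate.incl)

lemma kernel_induct [consumes 1, case_names zero rel uminus add]:
  assumes "u \<in> K" and "P 0" and "\<And>u. u \<in> tensor_rels R M N \<Longrightarrow> P u"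
    and "\<And>u. \<lbrakk>u \<in> K; P u\<rbrakk> \<Longrightarrow> P (- u)" and "\<And>u v. \<lbrakk>u \<in> K; v \<in> K; P u; P v\<rbrakk> \<Longrightarrow> P (u + v)"
  shows "P u"
  using assms(1) unfolding tensor_kernel_def
proof (induction rule: generate.induct)
  case (inv h)
  then show ?case using assms(3,4) kernel_rel rels_carrier by (metis carrier_free_Abelian_group_iff inv_free_Abelian_group subsetD)
next
  case (eng h1 h2)
  then show ?case using assms(5) by (simp add: tensor_kernel_def)
qed (use assms(2,3) in auto)

lemma cls_iff: "v \<in> cls u \<longleftrightarrow> v - u \<in> K"
proof
  assume "v - u \<in> K"
  then show "v \<in> cls u"
    unfolding tensor_class_def r_coset_def by (auto intro!: bexI[of _ "v - u"])
qed (auto simp: tensor_class_def r_coset_def)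

lemma cls_eqI:
  assumes "u - v \<in> K"
  shows "cls u = cls v"
proof (intro subset_antisym subsetI)
  fix w assume "w \<in> cls u"
  then have "(w - u) + (u - v) \<in> K" using assms by (intro kernel_add) (auto simp: cls_iff)
  then show "w \<in> cls v" by (simp add: cls_iff)
next
  fix w assume "w \<in> cls v"
  then have "(w - v) + - (u - v) \<in> K" using assms by (intro kernel_add kernel_uminus) (auto simp: cls_iff)
  then show "w \<in> cls u" by (simp add: cls_iff)
qed

lemma carrier_tensor_product: "carrier (tensor_product R M N) = cls ` carrier G"
  by (auto simp: tensor_product_def Let_def FactGroup_def RCOSETS_def tensor_class_def)

lemma add_cls:
  assumes "u \<in> carrier G" "v \<in> carrier G"
  shows "cls u \<oplus>\<^bsub>tensor_product R M N\<^esub> cls v = cls (u + v)"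
  using normal.rcos_sum[OF kernel_normal assms]
  by (simp add: tensor_product_def Let_def FactGroup_def tensor_class_def)

lemma scale_carrier:
  assumes "r \<in> carrier R" "u \<in> carrier G"
  shows "scale r u \<in> carrier G"
proof -
  have "Poly_Mapping.keys u \<subseteq> carrier M \<times> carrier N" using assms by simp
  then have "Poly_Mapping.keys (scale r u) \<subseteq> carrier M \<times> carrier N"
  proof (induction rule: free_Abelian_group_induct[consumes 1, case_names zero diff single])
    case (diff u v)
    then show ?case using keys_diff[of "scale r u" "scale r v"] by (auto simp: frag_extend_diff)
  next
    case (single p)
    then show ?case using assms by auto
  qed auto
  then show ?thesis by simp
qed

text \<open>
  Scaling maps every relation to a relation of the same kind; for the balancing relations this uses
  that \<open>R\<close> is commutative.
\<close>

lemma scale_kernel: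
  assumes r: "r \<in> carrier R" and "u \<in> K"
  shows "scale r u \<in> K"
  using assms(2)
proof (induction rule: kernel_induct)
  case (rel u)
  then have "scale r u \<in> tensor_rels R M N"
    unfolding tensor_rels_def
  proof (elim UnE, goal_cases)
    case 1
    then obtain x x' y where "u = frag_of (x \<oplus>\<^bsub>M\<^esub> x', y) - frag_of (x, y) - frag_of (x', y)"
      "x \<in> carrier M" "x' \<in> carrier M" "y \<in> carrier N" by blast
    then show ?case using r
      by (intro UnI1 CollectI exI[of _ "r \<odot>\<^bsub>M\<^esub> x"] exI[of _ "r \<odot>\<^bsub>M\<^esub> x'"] exI[of _ y])
        (simp add: frag_extend_diff M.smult_r_distr)
  next
    case 2
    then obtain x y y' where "u = frag_of (x, y \<oplus>\<^bsub>N\<^esub> y') - frag_of (x, y) - frag_of (x, y')"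
      "x \<in> carrier M" "y \<in> carrier N" "y' \<in> carrier N" by blast
    then show ?case using r
      by (intro UnI1[OF UnI2] CollectI exI[of _ "r \<odot>\<^bsub>M\<^esub> x"] exI[of _ y] exI[of _ y'])
        (simp add: frag_extend_diff)
  next
    case 3
    then obtain s x y where *: "u = frag_of (s \<odot>\<^bsub>M\<^esub> x, y) - frag_of (x, s \<odot>\<^bsub>N\<^esub> y)"
      "s \<in> carrier R" "x \<in> carrier M" "y \<in> carrier N" by blast
    then have "r \<odot>\<^bsub>M\<^esub> (s \<odot>\<^bsub>M\<^esub> x) = s \<odot>\<^bsub>M\<^esub> (r \<odot>\<^bsub>M\<^esub> x)"
      using r by (metis M.smult_assoc1 M.R.m_comm)
    with * show ?case using r
      by (intro UnI2 CollectI exI[of _ s] exI[of _ "r \<odot>\<^bsub>M\<^esub> x"] exI[of _ y])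
        (simp add: frag_extend_diff)
  qed
  then show ?case by (rule kernel_rel)
qed (auto simp: kernel_zero kernel_uminus kernel_add frag_extend_add frag_extend_minus)

text \<open>By the previous lemma all members of the union that defines \<open>smult\<close> are the same coset.\<close>

lemma smult_cls:
  assumes r: "r \<in> carrier R"
  shows "r \<odot>\<^bsub>tensor_product R M N\<^esub> cls u = cls (scale r u)"
proof -
  have "cls (scale r v) = cls (scale r u)" if "v \<in> cls u" for v
    using scale_kernel[OF r, of "v - u"] that by (intro cls_eqI) (simp add: cls_iff frag_extend_diff)
  moreover have "u \<in> cls u" by (simp add: cls_iff kernel_zero)
  ultimately have "(\<Union>v\<in>cls u. cls (scale r v)) = cls (scale r u)" by blast
  then show ?thesis by (simp add: tensor_product_def Let_def)
qed

lemma pure_tensor_add1: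
  assumes "x \<in> carrier M" "x' \<in> carrier M" "y \<in> carrier N"
  shows "pure_tensor R M N (x \<oplus>\<^bsub>M\<^esub> x') y =
    pure_tensor R M N x y \<oplus>\<^bsub>tensor_product R M N\<^esub> pure_tensor R M N x' y"
proof -
  have "frag_of (x \<oplus>\<^bsub>M\<^esub> x', y) - frag_of (x, y) - frag_of (x', y) \<in> K"
    by (rule kernel_rel) (use assms in \<open>auto simp: tensor_rels_def\<close>)
  then show ?thesis using assms
    by (simp add: pure_tensor_def add_cls algebra_simps cls_eqI)
qed

lemma pure_tensor_add2:
  assumes "x \<in> carrier M" "y \<in> carrier N" "y' \<in> carrier N"
  shows "pure_tensor R M N x (y \<oplus>\<^bsub>N\<^esub> y') =
    pure_tensor R M N x y \<oplus>\<^bsub>tensor_product R M N\<^esub> pure_tensor R M N x y'"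
proof -
  have "frag_of (x, y \<oplus>\<^bsub>N\<^esub> y') - frag_of (x, y) - frag_of (x, y') \<in> K"
    by (rule kernel_rel) (use assms in \<open>auto simp: tensor_rels_def\<close>)
  then show ?thesis using assms
    by (simp add: pure_tensor_def add_cls algebra_simps cls_eqI)
qed

lemma pure_tensor_balanced:
  assumes "r \<in> carrier R" "x \<in> carrier M" "y \<in> carrier N"
  shows "pure_tensor R M N (r \<odot>\<^bsub>M\<^esub> x) y = pure_tensor R M N x (r \<odot>\<^bsub>N\<^esub> y)"
  unfolding pure_tensor_def
  by (intro cls_eqI kernel_rel) (use assms in \<open>auto simp: tensor_rels_def\<close>)

lemma smult_pure_tensor:
  assumes "r \<in> carrier R"
  shows "r \<odot>\<^bsub>tensor_product R M N\<^esub> pure_tensor R M N x y = pure_tensor R M N (r \<odot>\<^bsub>M\<^esub> x) y"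
  using assms by (simp add: pure_tensor_def smult_cls)

lemma pure_tensor_carrier:
  assumes "x \<in> carrier M" "y \<in> carrier N"
  shows "pure_tensor R M N x y \<in> carrier (tensor_product R M N)"
  using assms by (simp add: pure_tensor_def carrier_tensor_product)

text \<open>
  The pure tensors generate the tensor product as an abelian group.  The target of \<open>g\<close> and \<open>g'\<close> is a
  type with addition rather than a module: they will be compositions of \<open>\<phi>\<close> with complex functionals.
\<close>

lemma additive_maps_agree:
  fixes g g' :: "(('m \<times> 'n) \<Rightarrow>\<^sub>0 int) set \<Rightarrow> 'g :: ab_group_add"
  assumes add: "\<And>X Y. \<lbrakk>X \<in> carrier (tensor_product R M N); Y \<in> carrier (tensor_product R M N)\<rbrakk> \<Longrightarrow>
      g (X \<oplus>\<^bsub>tensor_product R M N\<^esub> Y) = g X + g Y"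
    and add': "\<And>X Y. \<lbrakk>X \<in> carrier (tensor_product R M N); Y \<in> carrier (tensor_product R M N)\<rbrakk> \<Longrightarrow>
      g' (X \<oplus>\<^bsub>tensor_product R M N\<^esub> Y) = g' X + g' Y"
    and pure: "\<And>x y. \<lbrakk>x \<in> carrier M; y \<in> carrier N\<rbrakk> \<Longrightarrow> g (pure_tensor R M N x y) = g' (pure_tensor R M N x y)"
    and X: "X \<in> carrier (tensor_product R M N)"
  shows "g X = g' X"
proof -
  have plus: "g (cls (u + v)) = g (cls u) + g (cls v)" "g' (cls (u + v)) = g' (cls u) + g' (cls v)"
    if "u \<in> carrier G" "v \<in> carrier G" for u v
    using add[of "cls u" "cls v"] add'[of "cls u" "cls v"] that
    by (auto simp: add_cls carrier_tensor_product)
  have "g (cls u) = g' (cls u)" if "Poly_Mapping.keys u \<subseteq> carrier M \<times> carrier N" for u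
    using that
  proof (induction rule: free_Abelian_group_induct[consumes 1, case_names zero diff single])
    case zero
    then show ?case using plus[of 0 0] by simp
  next
    case (diff u v)
    then have "u - v \<in> carrier G" using keys_diff[of u v] by auto
    then show ?case using plus[of "u - v" v] diff by simp
  next
    case (single p)
    then show ?case using pure[of "fst p" "snd p"] by (auto simp: pure_tensor_def)
  qed
  then show ?thesis using X by (auto simp: carrier_tensor_product)
qed

text \<open>
  The universal property.  The group homomorphism from the free abelian group vanishes on the
  relations, so it is constant on every coset and its value there is the only element of the image
  of the coset.
\<close>

lemma balanced_map_induces_hom:
  assumes P: "Module.module R P"
    and f: "\<And>x y. \<lbrakk>x \<in> carrier M; y \<in> carrier N\<rbrakk> \<Longrightarrow> f x y \<in> carrier P"
    and add1: "\<And>x x' y. \<lbrakk>x \<in> carrier M; x' \<in> carrier M; y \<in> carrier N\<rbrakk> \<Longrightarrow> f (x \<oplus>\<^bsub>M\<^esub> x') y = f x y \<oplus>\<^bsub>P\<^esub> f x' y"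
    and add2: "\<And>x y y'. \<lbrakk>x \<in> carrier M; y \<in> carrier N; y' \<in> carrier N\<rbrakk> \<Longrightarrow> f x (y \<oplus>\<^bsub>N\<^esub> y') = f x y \<oplus>\<^bsub>P\<^esub> f x y'"
    and smult1: "\<And>r x y. \<lbrakk>r \<in> carrier R; x \<in> carrier M; y \<in> carrier N\<rbrakk> \<Longrightarrow> f (r \<odot>\<^bsub>M\<^esub> x) y = r \<odot>\<^bsub>P\<^esub> f x y"
    and smult2: "\<And>r x y. \<lbrakk>r \<in> carrier R; x \<in> carrier M; y \<in> carrier N\<rbrakk> \<Longrightarrow> f x (r \<odot>\<^bsub>N\<^esub> y) = r \<odot>\<^bsub>P\<^esub> f x y"
  obtains \<phi> where "\<phi> \<in> LinearCombinations.module_hom R (tensor_product R M N) P"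
    and "\<And>x y. \<lbrakk>x \<in> carrier M; y \<in> carrier N\<rbrakk> \<Longrightarrow> \<phi> (pure_tensor R M N x y) = f x y"
    and "LinearCombinations.submodule R (\<phi> ` carrier (tensor_product R M N)) P"
proof -
  interpret P: Module.module R P by fact
  obtain h where h: "h \<in> hom G (add_monoid P)"
    and h_of: "\<And>p. p \<in> carrier M \<times> carrier N \<Longrightarrow> h (frag_of p) = (\<lambda>(x, y). f x y) p"
    using comm_group.free_Abelian_group_universal[OF P.a_comm_group, of "\<lambda>(x, y). f x y" "carrier M \<times> carrier N"] f
    by (metis (mono_tags, lifting) case_prod_conv image_subsetI mem_Sigma_iff old.prod.exhaust partial_object.select_convs(1))
  interpret h: group_hom G "add_monoid P" h
    by (rule group_hom.intro[OF group_free_Abelian_group P.a_group]) (simp add: group_hom_axioms_def h)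
  have hcl: "h u \<in> carrier P" if "u \<in> carrier G" for u using h.hom_closed[OF that] by simp
  have hadd: "h (u + v) = h u \<oplus>\<^bsub>P\<^esub> h v" if "u \<in> carrier G" "v \<in> carrier G" for u v
    using h.hom_mult[OF that] by simp
  have h0: "h 0 = \<zero>\<^bsub>P\<^esub>" using h.hom_one by simp
  have hneg: "h (- u) = \<ominus>\<^bsub>P\<^esub> h u" if "u \<in> carrier G" for u
    using h.hom_inv[OF that] that by (simp add: a_inv_def)
  have hdiff: "h (u - v) = h u \<ominus>\<^bsub>P\<^esub> h v" if "u \<in> carrier G" "v \<in> carrier G" for u v
    using hadd[of u "- v"] hneg[of v] that by (simp add: a_minus_def)
  have dcl: "u - v \<in> carrier G" if "u \<in> carrier G" "v \<in> carrier G" for u v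
    using that keys_diff[of u v] by auto
  have cancel: "a \<oplus>\<^bsub>P\<^esub> b \<ominus>\<^bsub>P\<^esub> a \<ominus>\<^bsub>P\<^esub> b = \<zero>\<^bsub>P\<^esub>" if "a \<in> carrier P" "b \<in> carrier P" for a b
  proof -
    have "a \<oplus>\<^bsub>P\<^esub> b \<ominus>\<^bsub>P\<^esub> a = \<ominus>\<^bsub>P\<^esub> a \<oplus>\<^bsub>P\<^esub> (a \<oplus>\<^bsub>P\<^esub> b)"
      using that by (simp add: P.M.minus_eq P.M.a_comm)
    then show ?thesis using that by (simp add: P.M.r_neg1 P.M.minus_eq P.M.r_neg)
  qed
  have hK: "h u = \<zero>\<^bsub>P\<^esub>" if "u \<in> K" for u
    using that
  proof (induction rule: kernel_induct)
    case (rel u)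
    then show ?case
      unfolding tensor_rels_def
    proof (elim UnE, goal_cases)
      case 1
      then obtain x x' y where "u = frag_of (x \<oplus>\<^bsub>M\<^esub> x', y) - frag_of (x, y) - frag_of (x', y)"
        "x \<in> carrier M" "x' \<in> carrier M" "y \<in> carrier N" by blast
      then show ?case
        by (simp add: hdiff dcl[simplified] h_of add1 f cancel)
    next
      case 2
      then obtain x y y' where "u = frag_of (x, y \<oplus>\<^bsub>N\<^esub> y') - frag_of (x, y) - frag_of (x, y')"
        "x \<in> carrier M" "y \<in> carrier N" "y' \<in> carrier N" by blast
      then show ?case
        by (simp add: hdiff dcl[simplified] h_of add2 f cancel)
    next
      case 3
      then obtain s x y where "u = frag_of (s \<odot>\<^bsub>M\<^esub> x, y) - frag_of (x, s \<odot>\<^bsub>N\<^esub> y)"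
        "s \<in> carrier R" "x \<in> carrier M" "y \<in> carrier N" by blast
      then show ?case by (simp add: hdiff h_of smult1 smult2 f P.M.minus_eq P.M.r_neg)
    qed
  next
    case (uminus u)
    then show ?case using hneg[OF kernel_carrier, of u] by simp
  next
    case (add u v)
    then show ?case using hadd[OF kernel_carrier kernel_carrier, of u v] by simp
  qed (rule h0)
  have hscale: "h (scale r u) = r \<odot>\<^bsub>P\<^esub> h u" if r: "r \<in> carrier R" and "Poly_Mapping.keys u \<subseteq> carrier M \<times> carrier N" for r u
    using that(2)
  proof (induction rule: free_Abelian_group_induct[consumes 1, case_names zero diff single])
    case (diff u v)
    then have "u \<in> carrier G" "v \<in> carrier G" by simp_all
    with diff show ?case
      using r hdiff[OF scale_carrier[OF r, of u] scale_carrier[OF r, of v]]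
      by (simp add: frag_extend_diff hdiff hcl P.M.minus_eq P.smult_r_distr P.smult_r_minus)
  next
    case (single p)
    then show ?case using r by (auto simp: h_of smult1)
  qed (use r in \<open>simp_all add: h0\<close>)
  have hcls: "h ` cls u = {h u}" if u: "u \<in> carrier G" for u
  proof -
    have "h v = h u" if "v \<in> cls u" for v
    proof -
      have "v - u \<in> K" using that by (simp add: cls_iff)
      from hadd[OF kernel_carrier[OF this] u] hK[OF this] have "h ((v - u) + u) = h u"
        using hcl[OF u] by (simp del: diff_add_cancel)
      then show ?thesis by simp
    qed
    moreover have "u \<in> cls u" by (simp add: cls_iff kernel_zero)
    ultimately show ?thesis by blast
  qed
  define \<phi> where "\<phi> X = the_elem (h ` X)" for X
  have \<phi>: "\<phi> (cls u) = h u" if "u \<in> carrier G" for u using hcls[OF that] by (simp add: \<phi>_def)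
  have pcl: "u + v \<in> carrier G" if "u \<in> carrier G" "v \<in> carrier G" for u v
    using that keys_add[of u v] by auto
  show ?thesis
  proof
    show "\<phi> \<in> LinearCombinations.module_hom R (tensor_product R M N) P"
      unfolding LinearCombinations.module_hom_def
    proof (intro CollectI conjI allI impI funcsetI; (elim conjE)?)
      fix X assume "X \<in> carrier (tensor_product R M N)"
      then obtain u where u: "u \<in> carrier G" "X = cls u" unfolding carrier_tensor_product by blast
      then show "\<phi> X \<in> carrier P" using \<phi> hcl by metis
      fix r assume r: "r \<in> carrier R"
      have "Poly_Mapping.keys u \<subseteq> carrier M \<times> carrier N" using u(1) by simp
      then show "\<phi> (r \<odot>\<^bsub>tensor_product R M N\<^esub> X) = r \<odot>\<^bsub>P\<^esub> \<phi> X"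
        using u(2) \<phi>[OF u(1)] \<phi>[OF scale_carrier[OF r u(1)]] hscale[OF r] smult_cls[OF r, of u]
        by metis
    next
      fix X Y assume "X \<in> carrier (tensor_product R M N)" "Y \<in> carrier (tensor_product R M N)"
      then obtain u v where uv: "u \<in> carrier G" "X = cls u" "v \<in> carrier G" "Y = cls v"
        unfolding carrier_tensor_product by blast
      then show "\<phi> (X \<oplus>\<^bsub>tensor_product R M N\<^esub> Y) = \<phi> X \<oplus>\<^bsub>P\<^esub> \<phi> Y"
        using \<phi>[OF uv(1)] \<phi>[OF uv(3)] \<phi>[OF pcl[OF uv(1,3)]] hadd[OF uv(1,3)] add_cls[OF uv(1,3)]
        by metis
    qed
    show "\<phi> (pure_tensor R M N x y) = f x y" if "x \<in> carrier M" "y \<in> carrier N" for x y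
      using that by (simp add: pure_tensor_def \<phi> h_of)
    have img: "\<phi> ` carrier (tensor_product R M N) = h ` carrier G"
      by (force simp: carrier_tensor_product \<phi> image_iff)
    show "LinearCombinations.submodule R (\<phi> ` carrier (tensor_product R M N)) P"
      unfolding img
    proof (rule LinearCombinations.submodule.intro[OF P])
      show "h ` carrier G \<subseteq> carrier P" using hcl by blast
      show "v \<oplus>\<^bsub>P\<^esub> w \<in> h ` carrier G" if vw: "v \<in> h ` carrier G" "w \<in> h ` carrier G" for v w
      proof -
        obtain a b where "a \<in> carrier G" "b \<in> carrier G" "v = h a" "w = h b" using vw by blast
        then show ?thesis using hadd pcl by (metis imageI)
      qed
      show "\<zero>\<^bsub>P\<^esub> \<in> h ` carrier G" using h0 by (intro image_eqI[of _ _ 0]) auto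
      show "c \<odot>\<^bsub>P\<^esub> v \<in> h ` carrier G" if c: "c \<in> carrier R" and v: "v \<in> h ` carrier G" for c v
      proof -
        obtain a where a: "a \<in> carrier G" "v = h a" using v by blast
        then have "c \<odot>\<^bsub>P\<^esub> v = h (scale c a)" using hscale[OF c, of a] by simp
        then show ?thesis using imageI[OF scale_carrier[OF c a(1)], of h] by simp
      qed
    qed
  qed
qed

end

section \<open>The tensor of a nondegenerate surjection\<close>

lemma fin_dim_dual_space:
  assumes V: "vectorspace CC V" "vectorspace.fin_dim CC V"
  shows "vectorspace.fin_dim CC (dual_space V)"
proof -
  obtain n e \<epsilon> where fr: "dual_frame V n e \<epsilon>" using dual_frame_exists[OF V] .
  note eV = dual_frameD(1)[OF fr]
  let ?F = "\<lambda>\<alpha>. vec n (\<lambda>i. \<alpha> (e i))"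
  have "?F \<in> linear_maps (dual_space V) (Cvec n)"
    by (rule linear_mapsI) (auto simp: module_vec_simps dual_space_simps eV intro!: eq_vecI)
  moreover have "inj_on ?F (carrier (dual_space V))"
  proof (rule inj_onI)
    fix \<alpha> \<beta> assume \<alpha>: "\<alpha> \<in> carrier (dual_space V)" and \<beta>: "\<beta> \<in> carrier (dual_space V)" and eq: "?F \<alpha> = ?F \<beta>"
    have "\<alpha> (e i) = \<beta> (e i)" if "i < n" for i
      using arg_cong[OF eq, of "\<lambda>v. v $ i"] that by simp
    then show "\<alpha> = \<beta>"
      by (intro dual_eqI[OF \<alpha> \<beta>]) (simp add: dual_frameD(3)[OF fr _ \<alpha>] dual_frameD(3)[OF fr _ \<beta>])
  qed
  ultimately show ?thesis
    by (rule injective_linear_dim_le(1)[OF vectorspace_dual_space[OF V(1)] vectorspace_Cvec _ _ vec_space.fin_dim])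
qed

lemma transpose_linear:
  assumes U: "vectorspace CC U" and L: "L \<in> linear_maps U V"
  shows "(\<lambda>\<alpha>. compose (carrier U) \<alpha> L) \<in> linear_maps (dual_space V) (dual_space U)"
proof (rule linear_mapsI)
  fix \<alpha> assume \<alpha>: "\<alpha> \<in> carrier (dual_space V)"
  show "compose (carrier U) \<alpha> L \<in> carrier (dual_space U)"
    using vectorspace_closed[OF U] linear_mapsD[OF L]
    by (intro dual_memI) (auto simp: compose_def dual_memD[OF \<alpha>])
qed (use linear_mapsD(1)[OF L] in \<open>auto simp: compose_def dual_space_simps fun_eq_iff\<close>)

lemma intersection_space_memI:
  assumes U: "vectorspace CC U" "vectorspace.fin_dim CC U" and V: "vectorspace CC V" "vectorspace.fin_dim CC V"
    and W: "vectorspace CC W" "vectorspace.fin_dim CC W" and t: "t \<in> carrier (tensor_space U V W)"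
    and X: "X \<in> linear_maps (dual_space U) (dual_space U)" "\<Omega> = tensor_pullback U V W X (\<lambda>\<beta>. \<beta>) (\<lambda>\<gamma>. \<gamma>) t"
    and Y: "Y \<in> linear_maps (dual_space V) (dual_space V)" "\<Omega> = tensor_pullback U V W (\<lambda>\<alpha>. \<alpha>) Y (\<lambda>\<gamma>. \<gamma>) t"
    and Z: "Z \<in> linear_maps (dual_space W) (dual_space W)" "\<Omega> = tensor_pullback U V W (\<lambda>\<alpha>. \<alpha>) (\<lambda>\<beta>. \<beta>) Z t"
  shows "\<Omega> \<in> carrier (intersection_space U V W t)"
proof -
  obtain n1 e1 \<epsilon>1 where frU: "dual_frame U n1 e1 \<epsilon>1" using dual_frame_exists[OF U] .
  obtain n2 e2 \<epsilon>2 where frV: "dual_frame V n2 e2 \<epsilon>2" using dual_frame_exists[OF V] .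
  obtain n3 e3 \<epsilon>3 where frW: "dual_frame W n3 e3 \<epsilon>3" using dual_frame_exists[OF W] .
  have "\<Omega> \<in> image_tensor1 U V W t"
    unfolding image_tensor1_eq(1)[OF U(1) V(1) W(1) frU t] using X by blast
  moreover have "\<Omega> \<in> image_tensor2 U V W t"
    unfolding image_tensor2_eq(1)[OF U(1) V(1) W(1) frV t] using Y by blast
  moreover have "\<Omega> \<in> image_tensor3 U V W t"
    unfolding image_tensor3_eq(1)[OF U(1) V(1) W(1) frW t] using Z by blast
  ultimately show ?thesis by simp
qed

lemma intersection_space_memE:
  assumes U: "vectorspace CC U" "vectorspace.fin_dim CC U" and V: "vectorspace CC V" "vectorspace.fin_dim CC V"
    and W: "vectorspace CC W" "vectorspace.fin_dim CC W" and t: "t \<in> carrier (tensor_space U V W)"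
    and \<Omega>: "\<Omega> \<in> carrier (intersection_space U V W t)"
  obtains X Y Z where
    "X \<in> linear_maps (dual_space U) (dual_space U)" "\<Omega> = tensor_pullback U V W X (\<lambda>\<beta>. \<beta>) (\<lambda>\<gamma>. \<gamma>) t"
    "Y \<in> linear_maps (dual_space V) (dual_space V)" "\<Omega> = tensor_pullback U V W (\<lambda>\<alpha>. \<alpha>) Y (\<lambda>\<gamma>. \<gamma>) t"
    "Z \<in> linear_maps (dual_space W) (dual_space W)" "\<Omega> = tensor_pullback U V W (\<lambda>\<alpha>. \<alpha>) (\<lambda>\<beta>. \<beta>) Z t"
proof -
  obtain n1 e1 \<epsilon>1 where frU: "dual_frame U n1 e1 \<epsilon>1" using dual_frame_exists[OF U] .
  obtain n2 e2 \<epsilon>2 where frV: "dual_frame V n2 e2 \<epsilon>2" using dual_frame_exists[OF V] .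
  obtain n3 e3 \<epsilon>3 where frW: "dual_frame W n3 e3 \<epsilon>3" using dual_frame_exists[OF W] .
  have "\<Omega> \<in> image_tensor1 U V W t" "\<Omega> \<in> image_tensor2 U V W t" "\<Omega> \<in> image_tensor3 U V W t"
    using \<Omega> by simp_all
  then show ?thesis
    unfolding image_tensor1_eq(1)[OF U(1) V(1) W(1) frU t] image_tensor2_eq(1)[OF U(1) V(1) W(1) frV t]
      image_tensor3_eq(1)[OF U(1) V(1) W(1) frW t]
    using that by blast
qed

lemma restrict_scalars_simps [simp]:
  "carrier (restrict_scalars A N) = carrier N" "\<zero>\<^bsub>restrict_scalars A N\<^esub> = \<zero>\<^bsub>N\<^esub>"
  "x \<oplus>\<^bsub>restrict_scalars A N\<^esub> y = x \<oplus>\<^bsub>N\<^esub> y"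
  "c \<odot>\<^bsub>restrict_scalars A N\<^esub> x = (c \<odot>\<^bsub>A\<^esub> \<one>\<^bsub>A\<^esub>) \<odot>\<^bsub>N\<^esub> x"
  by (simp_all add: restrict_scalars_def)

lemma algebra_vectorspace:
  assumes "algebra CC A"
  shows "vectorspace CC A"
proof -
  interpret algebra CC A by fact
  show ?thesis by (rule vectorspace_CCI) unfold_locales
qed

lemma algebra_smult_one:
  assumes "algebra CC A" and a: "a \<in> carrier A"
  shows "(c \<odot>\<^bsub>A\<^esub> \<one>\<^bsub>A\<^esub>) \<in> carrier A" "(c \<odot>\<^bsub>A\<^esub> \<one>\<^bsub>A\<^esub>) \<otimes>\<^bsub>A\<^esub> a = c \<odot>\<^bsub>A\<^esub> a"
proof -
  interpret algebra CC A by fact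
  show "(c \<odot>\<^bsub>A\<^esub> \<one>\<^bsub>A\<^esub>) \<in> carrier A" using smult_closed[of c] by simp
  show "(c \<odot>\<^bsub>A\<^esub> \<one>\<^bsub>A\<^esub>) \<otimes>\<^bsub>A\<^esub> a = c \<odot>\<^bsub>A\<^esub> a" using smult_assoc2[of c "\<one>\<^bsub>A\<^esub>" a] a by simp
qed

lemma vectorspace_restrict_scalars:
  assumes A: "algebra CC A" and N: "Module.module A N"
  shows "vectorspace CC (restrict_scalars A N)"
proof -
  interpret algebra CC A by fact
  interpret N: Module.module A N by fact
  note one = algebra_smult_one[OF A one_closed]
  have ab: "abelian_group (restrict_scalars A N)"
    by (rule abelian_groupI) (auto simp: N.M.a_ac intro: bexI[of _ "\<ominus>\<^bsub>N\<^esub> x" for x] N.M.l_neg)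
  have "Module.module CC (restrict_scalars A N)"
  proof (rule moduleI[OF _ ab])
    show "cring CC" using algebra_axioms by (simp add: algebra_def Module.module_def)
    fix a b :: complex and x assume x: "x \<in> carrier (restrict_scalars A N)"
    show "a \<odot>\<^bsub>restrict_scalars A N\<^esub> x \<in> carrier (restrict_scalars A N)" using x one by simp
    show "(a \<oplus>\<^bsub>CC\<^esub> b) \<odot>\<^bsub>restrict_scalars A N\<^esub> x =
        a \<odot>\<^bsub>restrict_scalars A N\<^esub> x \<oplus>\<^bsub>restrict_scalars A N\<^esub> b \<odot>\<^bsub>restrict_scalars A N\<^esub> x"
      using x one smult_l_distr[of a b "\<one>\<^bsub>A\<^esub>"] by (simp add: N.smult_l_distr)
    show "(a \<otimes>\<^bsub>CC\<^esub> b) \<odot>\<^bsub>restrict_scalars A N\<^esub> x =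
        a \<odot>\<^bsub>restrict_scalars A N\<^esub> (b \<odot>\<^bsub>restrict_scalars A N\<^esub> x)"
      using x one smult_assoc1[of a b "\<one>\<^bsub>A\<^esub>"] algebra_smult_one(2)[OF A one(1), of a b]
      by (simp add: N.smult_assoc1[symmetric])
    show "\<one>\<^bsub>CC\<^esub> \<odot>\<^bsub>restrict_scalars A N\<^esub> x = x"
      using x smult_one[of "\<one>\<^bsub>A\<^esub>"] by simp
    fix y assume y: "y \<in> carrier (restrict_scalars A N)"
    show "a \<odot>\<^bsub>restrict_scalars A N\<^esub> (x \<oplus>\<^bsub>restrict_scalars A N\<^esub> y) =
        a \<odot>\<^bsub>restrict_scalars A N\<^esub> x \<oplus>\<^bsub>restrict_scalars A N\<^esub> a \<odot>\<^bsub>restrict_scalars A N\<^esub> y"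
      using x y one by (simp add: N.smult_r_distr)
  qed
  then show ?thesis by (rule vectorspace_CCI)
qed

lemma algebra_action_linear:
  assumes A: "algebra CC A" and N: "Module.module A N" and a: "a \<in> carrier A"
  shows "(\<lambda>x. a \<odot>\<^bsub>N\<^esub> x) \<in> linear_maps (restrict_scalars A N) (restrict_scalars A N)"
proof -
  interpret algebra CC A by fact
  interpret N: Module.module A N by fact
  note one = algebra_smult_one[OF A one_closed]
  show ?thesis
  proof (rule linear_mapsI)
    fix c x assume "x \<in> carrier (restrict_scalars A N)"
    then show "a \<odot>\<^bsub>N\<^esub> (c \<odot>\<^bsub>restrict_scalars A N\<^esub> x) = c \<odot>\<^bsub>restrict_scalars A N\<^esub> (a \<odot>\<^bsub>N\<^esub> x)"
      using a one by (simp add: N.smult_assoc1[symmetric] m_comm)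
  qed (use a in \<open>auto simp: N.smult_r_distr\<close>)
qed

locale nondegenerate_pairing =
  fixes m :: nat and A :: "(complex, 'a) module" and N1 :: "('a, 'n1) module"
    and N2 :: "('a, 'n2) module" and N3 :: "('a, 'n3) module"
    and \<phi> :: "(('n1 \<times> 'n2) \<Rightarrow>\<^sub>0 int) set \<Rightarrow> 'n3"
  assumes nondegenerate: "nondegenerate_surjection m A N1 N2 N3 \<phi>"
begin

abbreviation "U \<equiv> restrict_scalars A N1"
abbreviation "V \<equiv> restrict_scalars A N2"
abbreviation "W \<equiv> restrict_scalars A N3"
abbreviation "T \<equiv> tensor_of_hom A N1 N2 N3 \<phi>"

definition pairing :: "'n1 \<Rightarrow> 'n2 \<Rightarrow> 'n3" where
  "pairing x y = \<phi> (pure_tensor A N1 N2 x y)"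

lemma algebra: "algebra CC A" and modules: "Module.module A N1" "Module.module A N2" "Module.module A N3"
  and hom: "\<phi> \<in> LinearCombinations.module_hom A (tensor_product A N1 N2) N3"
  and surj: "\<phi> ` carrier (tensor_product A N1 N2) = carrier N3"
  and fin_dim: "vectorspace.fin_dim CC U" "vectorspace.fin_dim CC V" "vectorspace.fin_dim CC W"
  and dim_A: "dim_at_least A m"
  and nonzero1: "\<forall>x\<in>carrier N1 - {\<zero>\<^bsub>N1\<^esub>}. \<exists>y\<in>carrier N2. pairing x y \<noteq> \<zero>\<^bsub>N3\<^esub>"
  and nonzero2: "\<forall>y\<in>carrier N2 - {\<zero>\<^bsub>N2\<^esub>}. \<exists>x\<in>carrier N1. pairing x y \<noteq> \<zero>\<^bsub>N3\<^esub>"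
  using nondegenerate by (simp_all add: nondegenerate_surjection_def has_dim_def pairing_def)

sublocale A: algebra CC A by (rule algebra)
sublocale N1: Module.module A N1 by (rule modules)
sublocale N2: Module.module A N2 by (rule modules)
sublocale N3: Module.module A N3 by (rule modules)
sublocale module_pair A N1 N2 by unfold_locales

lemma vs: "vectorspace CC U" "vectorspace CC V" "vectorspace CC W"
  by (intro vectorspace_restrict_scalars algebra modules)+

lemma pairing_closed: "\<lbrakk>x \<in> carrier N1; y \<in> carrier N2\<rbrakk> \<Longrightarrow> pairing x y \<in> carrier N3"
  using hom pure_tensor_carrier by (auto simp: pairing_def LinearCombinations.module_hom_def)

lemma pairing_add1:
  "\<lbrakk>x \<in> carrier N1; x' \<in> carrier N1; y \<in> carrier N2\<rbrakk> \<Longrightarrow> pairing (x \<oplus>\<^bsub>N1\<^esub> x') y = pairing x y \<oplus>\<^bsub>N3\<^esub> pairing x' y"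
  using LinearCombinations.module_hom_add[OF hom] by (simp add: pairing_def pure_tensor_add1 pure_tensor_carrier)

lemma pairing_add2:
  "\<lbrakk>x \<in> carrier N1; y \<in> carrier N2; y' \<in> carrier N2\<rbrakk> \<Longrightarrow> pairing x (y \<oplus>\<^bsub>N2\<^esub> y') = pairing x y \<oplus>\<^bsub>N3\<^esub> pairing x y'"
  using LinearCombinations.module_hom_add[OF hom] by (simp add: pairing_def pure_tensor_add2 pure_tensor_carrier)

lemma pairing_smult1:
  "\<lbrakk>a \<in> carrier A; x \<in> carrier N1; y \<in> carrier N2\<rbrakk> \<Longrightarrow> pairing (a \<odot>\<^bsub>N1\<^esub> x) y = a \<odot>\<^bsub>N3\<^esub> pairing x y"
  using LinearCombinations.module_hom_smult[OF hom]
  by (simp add: pairing_def smult_pure_tensor[symmetric] pure_tensor_carrier)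

lemma pairing_smult2:
  "\<lbrakk>a \<in> carrier A; x \<in> carrier N1; y \<in> carrier N2\<rbrakk> \<Longrightarrow> pairing x (a \<odot>\<^bsub>N2\<^esub> y) = a \<odot>\<^bsub>N3\<^esub> pairing x y"
  using pairing_smult1 by (simp add: pairing_def pure_tensor_balanced)

lemma pairing_linear1: "v \<in> carrier V \<Longrightarrow> (\<lambda>u. pairing u v) \<in> linear_maps U W"
  using algebra_smult_one(1)[OF algebra A.one_closed]
  by (intro linear_mapsI) (auto simp: pairing_closed pairing_add1 pairing_smult1)

lemma pairing_linear2: "u \<in> carrier U \<Longrightarrow> (\<lambda>v. pairing u v) \<in> linear_maps V W"
  using algebra_smult_one(1)[OF algebra A.one_closed]
  by (intro linear_mapsI) (auto simp: pairing_closed pairing_add2 pairing_smult2)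

lemma pairing_inj1:
  assumes "x \<in> carrier N1" "y \<in> carrier N1" and eq: "\<And>v. v \<in> carrier N2 \<Longrightarrow> pairing x v = pairing y v"
  shows "x = y"
proof (rule ccontr)
  assume "x \<noteq> y"
  then have d: "x \<ominus>\<^bsub>N1\<^esub> y \<in> carrier N1 - {\<zero>\<^bsub>N1\<^esub>}" using assms by auto
  obtain v where v: "v \<in> carrier N2" "pairing (x \<ominus>\<^bsub>N1\<^esub> y) v \<noteq> \<zero>\<^bsub>N3\<^esub>"
    using bspec[OF nonzero1 d] by blast
  have "pairing (x \<ominus>\<^bsub>N1\<^esub> y) v \<oplus>\<^bsub>N3\<^esub> pairing y v = pairing x v"
    using assms v d pairing_add1[of "x \<ominus>\<^bsub>N1\<^esub> y" y v] by (simp add: N1.M.minus_eq N1.M.a_assoc N1.M.l_neg)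
  then have "pairing (x \<ominus>\<^bsub>N1\<^esub> y) v = \<zero>\<^bsub>N3\<^esub>"
    using eq[OF v(1)] assms v d pairing_closed by (metis DiffD1 N3.M.add.l_cancel_one' N3.M.add.m_comm)
  then show False using v by simp
qed

lemma pairing_inj2:
  assumes "x \<in> carrier N2" "y \<in> carrier N2" and eq: "\<And>u. u \<in> carrier N1 \<Longrightarrow> pairing u x = pairing u y"
  shows "x = y"
proof (rule ccontr)
  assume "x \<noteq> y"
  then have d: "x \<ominus>\<^bsub>N2\<^esub> y \<in> carrier N2 - {\<zero>\<^bsub>N2\<^esub>}" using assms by auto
  obtain u where u: "u \<in> carrier N1" "pairing u (x \<ominus>\<^bsub>N2\<^esub> y) \<noteq> \<zero>\<^bsub>N3\<^esub>"
    using bspec[OF nonzero2 d] by blast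
  have "pairing u (x \<ominus>\<^bsub>N2\<^esub> y) \<oplus>\<^bsub>N3\<^esub> pairing u y = pairing u x"
    using assms u d pairing_add2[of u "x \<ominus>\<^bsub>N2\<^esub> y" y] by (simp add: N2.M.minus_eq N2.M.a_assoc N2.M.l_neg)
  then have "pairing u (x \<ominus>\<^bsub>N2\<^esub> y) = \<zero>\<^bsub>N3\<^esub>"
    using eq[OF u(1)] assms u d pairing_closed by (metis DiffD1 N3.M.add.l_cancel_one' N3.M.add.m_comm)
  then show False using u by simp
qed

lemma functional_add:
  "\<lbrakk>\<gamma> \<in> carrier (dual_space W); z \<in> carrier N3; w \<in> carrier N3\<rbrakk> \<Longrightarrow> \<gamma> (z \<oplus>\<^bsub>N3\<^esub> w) = \<gamma> z + \<gamma> w"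
  using dual_memD(2)[of \<gamma> W z w] by simp

text \<open>Since \<open>\<phi>\<close> is onto, the values of the pairing generate \<open>N\<^sub>3\<close> as an abelian group.\<close>

lemma additive_agree_on_pairing:
  fixes g g' :: "'n3 \<Rightarrow> complex"
  assumes "\<And>z w. \<lbrakk>z \<in> carrier N3; w \<in> carrier N3\<rbrakk> \<Longrightarrow> g (z \<oplus>\<^bsub>N3\<^esub> w) = g z + g w"
    and "\<And>z w. \<lbrakk>z \<in> carrier N3; w \<in> carrier N3\<rbrakk> \<Longrightarrow> g' (z \<oplus>\<^bsub>N3\<^esub> w) = g' z + g' w"
    and "\<And>x y. \<lbrakk>x \<in> carrier N1; y \<in> carrier N2\<rbrakk> \<Longrightarrow> g (pairing x y) = g' (pairing x y)"
    and "z \<in> carrier N3"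
  shows "g z = g' z"
proof -
  obtain X where X: "X \<in> carrier (tensor_product A N1 N2)" "z = \<phi> X" using surj assms(4) by blast
  have cl: "\<phi> Y \<in> carrier N3" if "Y \<in> carrier (tensor_product A N1 N2)" for Y
    using surj that by blast
  have "(\<lambda>X. g (\<phi> X)) X = (\<lambda>X. g' (\<phi> X)) X"
    by (rule additive_maps_agree)
      (use assms(1-3) X(1) cl in \<open>auto simp: LinearCombinations.module_hom_add[OF hom] pairing_def\<close>)
  then show ?thesis using X by simp
qed

lemma T_tensor_of_bilinear: "T = tensor_of_bilinear U V W pairing"
  by (simp add: tensor_of_hom_def pairing_def[abs_def])

lemma T_mem: "T \<in> carrier (tensor_space (dual_space U) (dual_space V) W)"
  unfolding T_tensor_of_bilinear using vs fin_dim pairing_linear1 pairing_linear2 by (intro tensor_of_bilinear(1)) auto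

lemma T_apply:
  assumes "x \<in> carrier N1" "y \<in> carrier N2" "\<gamma> \<in> carrier (dual_space W)"
  shows "T (evaluation U x, evaluation V y, \<gamma>) = \<gamma> (pairing x y)"
  unfolding T_tensor_of_bilinear using vs fin_dim pairing_linear1 pairing_linear2 assms by (intro tensor_of_bilinear(2)) auto

lemma concise_T: "concise (dual_space U) (dual_space V) W T"
  unfolding T_tensor_of_bilinear
proof (rule concise_tensor_of_bilinear[OF vs(1) fin_dim(1) vs(2) fin_dim(2) vs(3) fin_dim(3)])
  fix \<gamma> \<delta> assume \<gamma>: "\<gamma> \<in> carrier (dual_space W)" and \<delta>: "\<delta> \<in> carrier (dual_space W)"
    and "\<And>u v. \<lbrakk>u \<in> carrier U; v \<in> carrier V\<rbrakk> \<Longrightarrow> \<gamma> (pairing u v) = \<delta> (pairing u v)"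
  then have "\<gamma> z = \<delta> z" if "z \<in> carrier N3" for z
    using that by (intro additive_agree_on_pairing[of \<gamma> \<delta> z]) (simp_all add: functional_add \<gamma> \<delta>)
  then show "\<gamma> = \<delta>" by (intro dual_eqI[OF \<gamma> \<delta>]) simp
qed (use pairing_linear1 pairing_linear2 pairing_inj1 pairing_inj2 in auto)

text \<open>
  Multiplication by \<open>a \<in> A\<close> on \<open>N\<^sub>1\<close>, \<open>N\<^sub>2\<close> or \<open>N\<^sub>3\<close> has the same effect on \<open>T\<close>, so it gives an element
  of the intersection.  By nondegeneracy and surjectivity this element determines the three actions
  of \<open>a\<close>; hence a faithful \<open>A\<close> embeds into the intersection.
\<close>

lemma abundant_T:
  assumes faithful: "acts_faithfully A N1 N2 N3"
  shows "abundant111 m (dual_space U) (dual_space V) W T"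
proof -
  note DU = vectorspace_dual_space[OF vs(1)] fin_dim_dual_space[OF vs(1) fin_dim(1)]
    and DV = vectorspace_dual_space[OF vs(2)] fin_dim_dual_space[OF vs(2) fin_dim(2)]
    and W = vs(3) fin_dim(3)
  obtain n e \<epsilon> where frW: "dual_frame W n e \<epsilon>" using dual_frame_exists[OF W] .
  \<comment> \<open>the actions of \<open>a\<close> on the functionals on the three factors of \<open>N\<^sub>1\<^sup>* \<otimes> N\<^sub>2\<^sup>* \<otimes> N\<^sub>3\<close>\<close>
  define X where "X a = (\<lambda>\<Phi> :: ('n1 \<Rightarrow> complex) \<Rightarrow> complex. compose (carrier (dual_space U)) \<Phi> (\<lambda>\<alpha>. compose (carrier U) \<alpha> (\<lambda>x. a \<odot>\<^bsub>N1\<^esub> x)))" for a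
  define Y where "Y a = (\<lambda>\<Phi> :: ('n2 \<Rightarrow> complex) \<Rightarrow> complex. compose (carrier (dual_space V)) \<Phi> (\<lambda>\<alpha>. compose (carrier V) \<alpha> (\<lambda>x. a \<odot>\<^bsub>N2\<^esub> x)))" for a
  define Z where "Z a = (\<lambda>\<gamma> :: 'n3 \<Rightarrow> complex. compose (carrier W) \<gamma> (\<lambda>x. a \<odot>\<^bsub>N3\<^esub> x))" for a
  have X: "X a \<in> linear_maps (dual_space (dual_space U)) (dual_space (dual_space U))"
    and Y: "Y a \<in> linear_maps (dual_space (dual_space V)) (dual_space (dual_space V))"
    and Z: "Z a \<in> linear_maps (dual_space W) (dual_space W)" if a: "a \<in> carrier A" for a
    unfolding X_def Y_def Z_def
    by (intro transpose_linear DU DV vs algebra_action_linear algebra modules a)+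
  have X_ev: "X a (evaluation U x) = evaluation U (a \<odot>\<^bsub>N1\<^esub> x)"
    if "a \<in> carrier A" "x \<in> carrier N1" for a x
    using linear_mapsD(1)[OF transpose_linear[OF vs(1) algebra_action_linear[OF algebra modules(1) that(1)]]] that
    by (auto simp: X_def evaluation_def compose_def fun_eq_iff)
  have Y_ev: "Y a (evaluation V x) = evaluation V (a \<odot>\<^bsub>N2\<^esub> x)"
    if "a \<in> carrier A" "x \<in> carrier N2" for a x
    using linear_mapsD(1)[OF transpose_linear[OF vs(2) algebra_action_linear[OF algebra modules(2) that(1)]]] that
    by (auto simp: Y_def evaluation_def compose_def fun_eq_iff)
  have Z_apply: "Z a \<gamma> z = \<gamma> (a \<odot>\<^bsub>N3\<^esub> z)" if "z \<in> carrier N3" for a \<gamma> z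
    using that by (simp add: Z_def compose_def)
  define \<Omega> where "\<Omega> a = tensor_pullback (dual_space U) (dual_space V) W (\<lambda>\<alpha>. \<alpha>) (\<lambda>\<beta>. \<beta>) (Z a) T" for a
  note pull = tensor_pullback_mem[OF DU(1) DV(1) W(1) _ _ _ T_mem]
  have \<Omega>_mem: "\<Omega> a \<in> carrier (tensor_space (dual_space U) (dual_space V) W)" if "a \<in> carrier A" for a
    unfolding \<Omega>_def by (intro pull identity_linear Z that)
  have \<Omega>_ev: "\<Omega> a (evaluation U x, evaluation V y, \<gamma>) = \<gamma> (a \<odot>\<^bsub>N3\<^esub> pairing x y)"
    if "a \<in> carrier A" "x \<in> carrier N1" "y \<in> carrier N2" "\<gamma> \<in> carrier (dual_space W)" for a x y \<gamma>
    using that evaluation_in_bidual[OF vs(1), of x] evaluation_in_bidual[OF vs(2), of y]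
      linear_mapsD(1)[OF Z[OF that(1)]]
    by (simp add: \<Omega>_def tensor_pullback_apply T_apply Z_apply pairing_closed)
  note eqI = tensor_eqI_evaluation[OF vs(1) fin_dim(1) vs(2) fin_dim(2), where W = W, unfolded restrict_scalars_simps]
  have \<Omega>_int: "\<Omega> a \<in> carrier (intersection_space (dual_space U) (dual_space V) W T)"
    if a: "a \<in> carrier A" for a
  proof (rule intersection_space_memI[OF DU DV W T_mem X[OF a] _ Y[OF a] _ Z[OF a] \<Omega>_def])
    show "\<Omega> a = tensor_pullback (dual_space U) (dual_space V) W (X a) (\<lambda>\<beta>. \<beta>) (\<lambda>\<gamma>. \<gamma>) T"
      using a evaluation_in_bidual[OF vs(1)] evaluation_in_bidual[OF vs(2)]
      by (intro eqI \<Omega>_mem pull identity_linear X)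
        (simp_all add: \<Omega>_ev tensor_pullback_apply X_ev T_apply pairing_smult1)
    show "\<Omega> a = tensor_pullback (dual_space U) (dual_space V) W (\<lambda>\<alpha>. \<alpha>) (Y a) (\<lambda>\<gamma>. \<gamma>) T"
      using a evaluation_in_bidual[OF vs(1)] evaluation_in_bidual[OF vs(2)]
      by (intro eqI \<Omega>_mem pull identity_linear Y)
        (simp_all add: \<Omega>_ev tensor_pullback_apply Y_ev T_apply pairing_smult2)
  qed
  note TS = vectorspace_tensor_space[OF DU(1) DV(1) W(1)]
  note ev = evaluation_in_bidual[OF vs(1)] evaluation_in_bidual[OF vs(2)]
  have lin: "\<Omega> \<in> linear_maps A (intersection_space (dual_space U) (dual_space V) W T)"
  proof (rule linear_mapsI)
    fix a b assume a: "a \<in> carrier A" and b: "b \<in> carrier A"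
    have "\<Omega> (a \<oplus>\<^bsub>A\<^esub> b) = \<Omega> a \<oplus>\<^bsub>tensor_space (dual_space U) (dual_space V) W\<^esub> \<Omega> b"
      using a b ev by (intro eqI \<Omega>_mem vectorspace_closed(1)[OF TS])
        (simp_all add: \<Omega>_ev tensor_space_simps pairing_closed N3.smult_l_distr functional_add)
    then show "\<Omega> (a \<oplus>\<^bsub>A\<^esub> b) = \<Omega> a \<oplus>\<^bsub>intersection_space (dual_space U) (dual_space V) W T\<^esub> \<Omega> b" by simp
  next
    fix c a assume a: "a \<in> carrier A"
    have "\<gamma> ((c \<odot>\<^bsub>A\<^esub> a) \<odot>\<^bsub>N3\<^esub> z) = c * \<gamma> (a \<odot>\<^bsub>N3\<^esub> z)"
      if "\<gamma> \<in> carrier (dual_space W)" "z \<in> carrier N3" for \<gamma> z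
    proof -
      have "(c \<odot>\<^bsub>A\<^esub> a) \<odot>\<^bsub>N3\<^esub> z = (c \<odot>\<^bsub>A\<^esub> \<one>\<^bsub>A\<^esub>) \<odot>\<^bsub>N3\<^esub> (a \<odot>\<^bsub>N3\<^esub> z)"
        using algebra_smult_one[OF algebra a, of c] a that N3.smult_assoc1 by metis
      also have "\<dots> = c \<odot>\<^bsub>W\<^esub> (a \<odot>\<^bsub>N3\<^esub> z)" by simp
      finally show ?thesis using dual_memD(3)[OF that(1), of "a \<odot>\<^bsub>N3\<^esub> z" c] a that by simp
    qed
    moreover have "c \<odot>\<^bsub>A\<^esub> a \<in> carrier A" using a A.smult_closed[of c a] by simp
    ultimately have "\<Omega> (c \<odot>\<^bsub>A\<^esub> a) = c \<odot>\<^bsub>tensor_space (dual_space U) (dual_space V) W\<^esub> \<Omega> a"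
      using a ev by (intro eqI \<Omega>_mem vectorspace_closed(2)[OF TS])
        (simp_all add: \<Omega>_ev tensor_space_simps pairing_closed)
    then show "\<Omega> (c \<odot>\<^bsub>A\<^esub> a) = c \<odot>\<^bsub>intersection_space (dual_space U) (dual_space V) W T\<^esub> \<Omega> a" by simp
  qed (rule \<Omega>_int)
  have inj: "inj_on \<Omega> (carrier A)"
  proof (rule inj_onI)
    fix a b assume a: "a \<in> carrier A" and b: "b \<in> carrier A" and eq: "\<Omega> a = \<Omega> b"
    have \<gamma>_eq: "\<gamma> (a \<odot>\<^bsub>N3\<^esub> pairing x y) = \<gamma> (b \<odot>\<^bsub>N3\<^esub> pairing x y)"
      if "x \<in> carrier N1" "y \<in> carrier N2" "\<gamma> \<in> carrier (dual_space W)" for x y \<gamma>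
      using \<Omega>_ev[OF a that] \<Omega>_ev[OF b that] eq by simp
    have p_eq: "a \<odot>\<^bsub>N3\<^esub> pairing x y = b \<odot>\<^bsub>N3\<^esub> pairing x y" if "x \<in> carrier N1" "y \<in> carrier N2" for x y
      by (rule dual_frameD(4)[OF frW]) (use that a b \<gamma>_eq pairing_closed in auto)
    have 1: "a \<odot>\<^bsub>N1\<^esub> x = b \<odot>\<^bsub>N1\<^esub> x" if "x \<in> carrier N1" for x
      by (rule pairing_inj1) (use that a b p_eq in \<open>auto simp: pairing_smult1\<close>)
    have 2: "a \<odot>\<^bsub>N2\<^esub> y = b \<odot>\<^bsub>N2\<^esub> y" if "y \<in> carrier N2" for y
      by (rule pairing_inj2) (use that a b p_eq in \<open>auto simp: pairing_smult2\<close>)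
    have 3: "a \<odot>\<^bsub>N3\<^esub> z = b \<odot>\<^bsub>N3\<^esub> z" if z: "z \<in> carrier N3" for z
    proof (rule dual_frameD(4)[OF frW])
      fix \<gamma> assume \<gamma>: "\<gamma> \<in> carrier (dual_space W)"
      show "\<gamma> (a \<odot>\<^bsub>N3\<^esub> z) = \<gamma> (b \<odot>\<^bsub>N3\<^esub> z)"
        by (rule additive_agree_on_pairing[of "\<lambda>z. \<gamma> (a \<odot>\<^bsub>N3\<^esub> z)" "\<lambda>z. \<gamma> (b \<odot>\<^bsub>N3\<^esub> z)"])
          (use a b z \<gamma>_eq[OF _ _ \<gamma>] in \<open>auto simp: N3.smult_r_distr functional_add[OF \<gamma>]\<close>)
    qed (use a b z in auto)
    have zero: "(a \<ominus>\<^bsub>A\<^esub> b) \<odot>\<^bsub>N\<^esub> x = \<zero>\<^bsub>N\<^esub>"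
      if N: "Module.module A N" and "x \<in> carrier N" "a \<odot>\<^bsub>N\<^esub> x = b \<odot>\<^bsub>N\<^esub> x" for N :: "('a, 'y) module" and x
    proof -
      interpret N: Module.module A N by fact
      show ?thesis using that(2,3) a b
        by (simp add: A.minus_eq N.smult_l_distr N.smult_l_minus N.M.r_neg)
    qed
    have "a \<ominus>\<^bsub>A\<^esub> b = \<zero>\<^bsub>A\<^esub>"
      using faithful a b 1 2 3 zero[OF modules(1)] zero[OF modules(2)] zero[OF modules(3)]
      unfolding acts_faithfully_def by (metis A.minus_closed)
    then show "a = b" using a b by simp
  qed
  note I = intersection_space_finite_dim[OF DU DV W T_mem]
  note le = injective_linear_dim_le[OF algebra_vectorspace[OF algebra] I(1) lin inj I(2)]
  show ?thesis
    using le dim_A by (simp add: abundant111_def dim_at_least_def)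
qed

end

section \<open>Coordinate vectors and their functionals\<close>

lemma Cvec_simps [simp]:
  "carrier (Cvec m) = carrier_vec m" "x \<oplus>\<^bsub>Cvec m\<^esub> y = x + y" "c \<odot>\<^bsub>Cvec m\<^esub> x = c \<cdot>\<^sub>v x" "\<zero>\<^bsub>Cvec m\<^esub> = 0\<^sub>v m"
  by (simp_all add: module_vec_simps)

lemma fin_dim_Cvec: "vectorspace.fin_dim CC (Cvec m)"
  by (rule vec_space.fin_dim)

text \<open>Induction over the truncations of \<open>v\<close> to its first \<open>k\<close> coordinates.\<close>

lemma Cvec_functional_expansion:
  assumes \<alpha>: "\<alpha> \<in> carrier (dual_space (Cvec m))" and v: "v \<in> carrier_vec m"
  shows "\<alpha> v = (\<Sum>i<m. v $ i * \<alpha> (unit_vec m i))"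
proof -
  have "\<alpha> (vec m (\<lambda>i. if i < k then v $ i else 0)) = (\<Sum>i<k. v $ i * \<alpha> (unit_vec m i))" if "k \<le> m" for k
    using that
  proof (induction k)
    case 0
    have "vec m (\<lambda>i. if i < 0 then v $ i else 0) = \<zero>\<^bsub>Cvec m\<^esub>" by (auto intro: eq_vecI)
    then show ?case using dual_zero[OF vectorspace_Cvec \<alpha>] by simp
  next
    case (Suc k)
    let ?w = "vec m (\<lambda>i. if i < k then v $ i else 0)"
    have "vec m (\<lambda>i. if i < Suc k then v $ i else 0) = ?w + v $ k \<cdot>\<^sub>v unit_vec m k"
      using Suc(2) by (intro eq_vecI) (auto simp: less_Suc_eq)
    then show ?case
      using Suc dual_memD(2)[OF \<alpha>, of ?w "v $ k \<cdot>\<^sub>v unit_vec m k"] dual_memD(3)[OF \<alpha>, of "unit_vec m k" "v $ k"]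
      by simp
  qed
  moreover have "vec m (\<lambda>i. if i < m then v $ i else 0) = v" using v by (auto intro: eq_vecI)
  ultimately show ?thesis using order_refl by metis
qed

definition coord_functional :: "nat \<Rightarrow> complex vec \<Rightarrow> complex vec \<Rightarrow> complex" where
  "coord_functional m x = (\<lambda>v\<in>carrier_vec m. v \<bullet> x)"

lemma coord_functional_apply [simp]: "v \<in> carrier_vec m \<Longrightarrow> coord_functional m x v = v \<bullet> x"
  by (simp add: coord_functional_def)

lemma coord_functional_linear: "coord_functional m \<in> linear_maps (Cvec m) (dual_space (Cvec m))"
proof (rule linear_mapsI)
  fix x assume x: "x \<in> carrier (Cvec m)"
  show "coord_functional m x \<in> carrier (dual_space (Cvec m))"
    using x by (intro dual_memI) (auto simp: add_scalar_prod_distrib[of _ m] coord_functional_def)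
  fix y assume y: "y \<in> carrier (Cvec m)"
  show "coord_functional m (x \<oplus>\<^bsub>Cvec m\<^esub> y) = coord_functional m x \<oplus>\<^bsub>dual_space (Cvec m)\<^esub> coord_functional m y"
    using x y by (auto simp: dual_space_simps coord_functional_def scalar_prod_add_distrib[of _ m] intro!: restrict_ext)
next
  fix c :: complex and x assume x: "x \<in> carrier (Cvec m)"
  then show "coord_functional m (c \<odot>\<^bsub>Cvec m\<^esub> x) = c \<odot>\<^bsub>dual_space (Cvec m)\<^esub> coord_functional m x"
    by (auto simp: dual_space_simps coord_functional_def intro!: restrict_ext)
qed

lemma coord_functional_mem: "x \<in> carrier_vec m \<Longrightarrow> coord_functional m x \<in> carrier (dual_space (Cvec m))"
  using linear_mapsD(1)[OF coord_functional_linear] by simp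

lemma vec_eqI_scalar_prod:
  assumes "x \<in> carrier_vec m" "y \<in> carrier_vec m" "\<And>v. v \<in> carrier_vec m \<Longrightarrow> v \<bullet> x = v \<bullet> (y :: complex vec)"
  shows "x = y"
proof (rule eq_vecI)
  fix i assume "i < dim_vec y"
  then show "x $ i = y $ i" using assms(3)[of "unit_vec m i"] assms(1,2) by simp
qed (use assms in auto)

lemma coord_functional_bij:
  "bij_betw (coord_functional m) (carrier_vec m) (carrier (dual_space (Cvec m)))"
proof -
  have "inj_on (coord_functional m) (carrier_vec m)"
  proof (rule inj_onI)
    fix x y :: "complex vec" assume xy: "x \<in> carrier_vec m" "y \<in> carrier_vec m"
      and eq: "coord_functional m x = coord_functional m y"
    show "x = y"
    proof (rule vec_eqI_scalar_prod[OF xy])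
      fix v :: "complex vec" assume "v \<in> carrier_vec m"
      then show "v \<bullet> x = v \<bullet> y" using fun_cong[OF eq, of v] by simp
    qed
  qed
  moreover have "\<alpha> \<in> coord_functional m ` carrier_vec m" if \<alpha>: "\<alpha> \<in> carrier (dual_space (Cvec m))" for \<alpha>
  proof
    show x: "vec m (\<lambda>i. \<alpha> (unit_vec m i)) \<in> carrier_vec m" by simp
    show "\<alpha> = coord_functional m (vec m (\<lambda>i. \<alpha> (unit_vec m i)))"
    proof (rule dual_eqI[OF \<alpha> coord_functional_mem[OF x]])
      fix v assume "v \<in> carrier (Cvec m)"
      then show "\<alpha> v = coord_functional m (vec m (\<lambda>i. \<alpha> (unit_vec m i))) v"
        using Cvec_functional_expansion[OF \<alpha>, of v] by (simp add: scalar_prod_def atLeast0LessThan)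
    qed
  qed
  ultimately show ?thesis using coord_functional_mem by (auto simp: bij_betw_def)
qed

lemma functionals_separate_vectors:
  assumes "x \<in> carrier_vec m" "y \<in> carrier_vec m"
    and "\<And>\<alpha>. \<alpha> \<in> carrier (dual_space (Cvec m)) \<Longrightarrow> \<alpha> x = \<alpha> y"
  shows "x = (y :: complex vec)"
proof (rule vec_eqI_scalar_prod[OF assms(1,2)])
  fix v :: "complex vec" assume v: "v \<in> carrier_vec m"
  have "x \<bullet> v = y \<bullet> v"
    using assms(3)[OF coord_functional_mem[OF v]] assms(1,2) by simp
  then show "v \<bullet> x = v \<bullet> y"
    using comm_scalar_prod[OF v assms(1)] comm_scalar_prod[OF v assms(2)] by simp
qed

lemma linear_map_matrix:
  assumes f: "f \<in> linear_maps (Cvec m) (Cvec m)"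
  obtains M where "M \<in> carrier_mat m m" "\<And>v. v \<in> carrier_vec m \<Longrightarrow> f v = M *\<^sub>v v"
proof
  let ?M = "mat m m (\<lambda>(i, j). f (unit_vec m j) $ i)"
  show "?M \<in> carrier_mat m m" by simp
  fix v :: "complex vec" assume v: "v \<in> carrier_vec m"
  have fc: "f w \<in> carrier_vec m" if "w \<in> carrier_vec m" for w using linear_mapsD(1)[OF f] that by simp
  show "f v = ?M *\<^sub>v v"
  proof (rule eq_vecI)
    fix i assume "i < dim_vec (?M *\<^sub>v v)"
    then have i: "i < m" by simp
    have "(\<lambda>v\<in>carrier_vec m. f v $ i) \<in> carrier (dual_space (Cvec m))"
      using linear_mapsD(2,3)[OF f] fc[THEN carrier_vecD] i by (intro dual_memI) auto
    from Cvec_functional_expansion[OF this v] show "f v $ i = (?M *\<^sub>v v) $ i"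
      using v i by (simp add: scalar_prod_def atLeast0LessThan mult.commute)
  qed (use fc[OF v] in auto)
qed

lemma mat_eqI_vec:
  assumes "X \<in> carrier_mat m m" "Y \<in> carrier_mat m m" "\<And>v. v \<in> carrier_vec m \<Longrightarrow> X *\<^sub>v v = Y *\<^sub>v (v :: complex vec)"
  shows "X = Y"
proof (rule eq_matI)
  fix i j assume ij: "i < dim_row Y" "j < dim_col Y"
  have "(X *\<^sub>v unit_vec m j) $ i = (Y *\<^sub>v unit_vec m j) $ i" using assms(3)[of "unit_vec m j"] by simp
  then show "X $$ (i, j) = Y $$ (i, j)" using assms(1,2) ij by (simp add: row_def)
qed (use assms in auto)

lemma smult_mat_vec:
  assumes "X \<in> carrier_mat m m" "v \<in> carrier_vec m"
  shows "(c \<cdot>\<^sub>m X) *\<^sub>v v = c \<cdot>\<^sub>v (X *\<^sub>v (v :: complex vec))"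
  using assms by (intro eq_vecI) auto

section \<open>The algebra of a nondegenerate bilinear product\<close>

text \<open>
  In coordinates, the three nondegeneracy conditions are the three conditions for conciseness of
  the tensor of \<open>b\<close>; the last one says that no nonzero functional vanishes on all values of \<open>b\<close>.
\<close>

locale nondegenerate_product =
  fixes m :: nat and b :: "complex vec \<Rightarrow> complex vec \<Rightarrow> complex vec"
  assumes linear1: "y \<in> carrier_vec m \<Longrightarrow> (\<lambda>x. b x y) \<in> linear_maps (Cvec m) (Cvec m)"
    and linear2: "x \<in> carrier_vec m \<Longrightarrow> (\<lambda>y. b x y) \<in> linear_maps (Cvec m) (Cvec m)"
    and inj1: "\<lbrakk>x \<in> carrier_vec m; x' \<in> carrier_vec m; \<And>y. y \<in> carrier_vec m \<Longrightarrow> b x y = b x' y\<rbrakk> \<Longrightarrow> x = x'"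
    and inj2: "\<lbrakk>y \<in> carrier_vec m; y' \<in> carrier_vec m; \<And>x. x \<in> carrier_vec m \<Longrightarrow> b x y = b x y'\<rbrakk> \<Longrightarrow> y = y'"
    and inj3: "\<lbrakk>z \<in> carrier_vec m; z' \<in> carrier_vec m;
      \<And>x y. \<lbrakk>x \<in> carrier_vec m; y \<in> carrier_vec m\<rbrakk> \<Longrightarrow> b x y \<bullet> z = b x y \<bullet> z'\<rbrakk> \<Longrightarrow> z = z'"
begin

lemma b_closed: "\<lbrakk>x \<in> carrier_vec m; y \<in> carrier_vec m\<rbrakk> \<Longrightarrow> b x y \<in> carrier_vec m"
  using linear_mapsD(1)[OF linear1] by simp

lemma b_add1: "\<lbrakk>x \<in> carrier_vec m; x' \<in> carrier_vec m; y \<in> carrier_vec m\<rbrakk> \<Longrightarrow> b (x + x') y = b x y + b x' y"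
  using linear_mapsD(2)[OF linear1] by simp

lemma b_add2: "\<lbrakk>x \<in> carrier_vec m; y \<in> carrier_vec m; y' \<in> carrier_vec m\<rbrakk> \<Longrightarrow> b x (y + y') = b x y + b x y'"
  using linear_mapsD(2)[OF linear2] by simp

lemma b_smult1: "\<lbrakk>x \<in> carrier_vec m; y \<in> carrier_vec m\<rbrakk> \<Longrightarrow> b (c \<cdot>\<^sub>v x) y = c \<cdot>\<^sub>v b x y"
  using linear_mapsD(3)[OF linear1] by simp

lemma b_smult2: "\<lbrakk>x \<in> carrier_vec m; y \<in> carrier_vec m\<rbrakk> \<Longrightarrow> b x (c \<cdot>\<^sub>v y) = c \<cdot>\<^sub>v b x y"
  using linear_mapsD(3)[OF linear2] by simp

definition triple :: "complex mat \<Rightarrow> complex mat \<Rightarrow> complex mat \<Rightarrow> bool" where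
  "triple X Y Z \<longleftrightarrow> X \<in> carrier_mat m m \<and> Y \<in> carrier_mat m m \<and> Z \<in> carrier_mat m m \<and>
     (\<forall>x\<in>carrier_vec m. \<forall>y\<in>carrier_vec m. b (X *\<^sub>v x) y = Z *\<^sub>v b x y \<and> b x (Y *\<^sub>v y) = Z *\<^sub>v b x y)"

lemma tripleD:
  assumes "triple X Y Z"
  shows "X \<in> carrier_mat m m" "Y \<in> carrier_mat m m" "Z \<in> carrier_mat m m"
    and "\<lbrakk>x \<in> carrier_vec m; y \<in> carrier_vec m\<rbrakk> \<Longrightarrow> b (X *\<^sub>v x) y = Z *\<^sub>v b x y"
    and "\<lbrakk>x \<in> carrier_vec m; y \<in> carrier_vec m\<rbrakk> \<Longrightarrow> b x (Y *\<^sub>v y) = Z *\<^sub>v b x y"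
  using assms unfolding triple_def by auto

lemma tripleI:
  assumes "X \<in> carrier_mat m m" "Y \<in> carrier_mat m m" "Z \<in> carrier_mat m m"
    and "\<And>x y. \<lbrakk>x \<in> carrier_vec m; y \<in> carrier_vec m\<rbrakk> \<Longrightarrow> b (X *\<^sub>v x) y = Z *\<^sub>v b x y"
    and "\<And>x y. \<lbrakk>x \<in> carrier_vec m; y \<in> carrier_vec m\<rbrakk> \<Longrightarrow> b x (Y *\<^sub>v y) = Z *\<^sub>v b x y"
  shows "triple X Y Z"
  using assms unfolding triple_def by auto

text \<open>
  \<open>Y\<close> is determined since \<open>b\<close> is nondegenerate in the second argument.  \<open>Z\<close> is determined on the values
  of \<open>b\<close>, which span; this is applied to the rows of \<open>Z\<close>, regarded as functionals.
\<close>

lemma triple_unique: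
  assumes XYZ: "triple X Y Z" and XYZ': "triple X Y' Z'"
  shows "Y = Y'" "Z = Z'"
proof -
  note D = tripleD[OF XYZ] and D' = tripleD[OF XYZ']
  show "Y = Y'"
  proof (rule mat_eqI_vec[OF D(2) D'(2)])
    fix v :: "complex vec" assume v: "v \<in> carrier_vec m"
    have "b x (Y *\<^sub>v v) = b x (Y' *\<^sub>v v)" if "x \<in> carrier_vec m" for x
      using D(4,5)[OF that v] D'(4,5)[OF that v] by simp
    then show "Y *\<^sub>v v = Y' *\<^sub>v v" using D(2) D'(2) v by (rule_tac inj2) auto
  qed
  show "Z = Z'"
  proof (rule eq_rowI)
    fix k assume k: "k < dim_row Z'"
    show "row Z k = row Z' k"
    proof (rule inj3)
      fix x y :: "complex vec" assume xy: "x \<in> carrier_vec m" "y \<in> carrier_vec m"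
      have "(Z *\<^sub>v b x y) $ k = (Z' *\<^sub>v b x y) $ k"
        using D(4)[OF xy] D'(4)[OF xy] by simp
      then show "b x y \<bullet> row Z k = b x y \<bullet> row Z' k"
        using k D(3) D'(3) b_closed[OF xy] by (simp add: comm_scalar_prod[of "b x y" m])
    qed (use k D(3) D'(3) in auto)
  qed (use D(3) D'(3) in auto)
qed

lemma triple_add:
  assumes "triple X Y Z" "triple X' Y' Z'"
  shows "triple (X + X') (Y + Y') (Z + Z')"
  using tripleD[OF assms(1)] tripleD[OF assms(2)]
  by (intro tripleI) (auto simp: add_mult_distrib_mat_vec[of _ m m] b_add1 b_add2 b_closed)

lemma triple_smult:
  assumes "triple X Y Z"
  shows "triple (c \<cdot>\<^sub>m X) (c \<cdot>\<^sub>m Y) (c \<cdot>\<^sub>m Z)"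
  using tripleD[OF assms]
  by (intro tripleI) (auto simp: smult_mat_vec[of _ m] b_smult1 b_smult2 b_closed)

lemma triple_one: "triple (1\<^sub>m m) (1\<^sub>m m) (1\<^sub>m m)"
  by (intro tripleI) (auto simp: b_closed)

lemma triple_zero: "triple (0\<^sub>m m m) (0\<^sub>m m m) (0\<^sub>m m m)"
proof -
  have "(0 :: complex) \<cdot>\<^sub>m 1\<^sub>m m = 0\<^sub>m m m" by (intro eq_matI) auto
  then show ?thesis using triple_smult[OF triple_one, of 0] by simp
qed

text \<open>
  Two triples pass each other because they can be applied to different factors:
  \<open>Z (Z' (b x y)) = Z (b x (Y' y)) = b (X x) (Y' y) = Z' (b (X x) y) = Z' (Z (b x y))\<close>.
\<close>

lemma triple_swap:
  assumes "triple X Y Z" "triple X' Y' Z'" and x: "x \<in> carrier_vec m" and y: "y \<in> carrier_vec m"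
  shows "Z *\<^sub>v (Z' *\<^sub>v b x y) = Z' *\<^sub>v (Z *\<^sub>v b x y)"
proof -
  note D = tripleD[OF assms(1)] and D' = tripleD[OF assms(2)]
  have Xx: "X *\<^sub>v x \<in> carrier_vec m" using D(1) x by simp
  have Yy: "Y' *\<^sub>v y \<in> carrier_vec m" using D'(2) y by simp
  have "Z *\<^sub>v (Z' *\<^sub>v b x y) = Z *\<^sub>v b x (Y' *\<^sub>v y)" using D'(5)[OF x y] by simp
  also have "\<dots> = b (X *\<^sub>v x) (Y' *\<^sub>v y)" using D(4)[OF x Yy] by simp
  also have "\<dots> = Z' *\<^sub>v b (X *\<^sub>v x) y" using D'(5)[OF Xx y] by simp
  also have "\<dots> = Z' *\<^sub>v (Z *\<^sub>v b x y)" using D(4)[OF x y] by simp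
  finally show ?thesis .
qed

lemma triple_commute:
  assumes "triple X Y Z" "triple X' Y' Z'"
  shows "X * X' = X' * X"
proof -
  note D = tripleD[OF assms(1)] and D' = tripleD[OF assms(2)]
  show ?thesis
  proof (rule mat_eqI_vec)
    fix v :: "complex vec" assume v: "v \<in> carrier_vec m"
    have "X *\<^sub>v (X' *\<^sub>v v) = X' *\<^sub>v (X *\<^sub>v v)"
    proof (rule inj1)
      fix y :: "complex vec" assume y: "y \<in> carrier_vec m"
      show "b (X *\<^sub>v (X' *\<^sub>v v)) y = b (X' *\<^sub>v (X *\<^sub>v v)) y"
        using D D' v y triple_swap[OF assms v y] by auto
    qed (use D D' v in auto)
    then show "(X * X') *\<^sub>v v = (X' * X) *\<^sub>v v"
      using D D' v by (simp add: assoc_mult_mat_vec[of _ m m _ m])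
  qed (use D D' in auto)
qed

lemma triple_mult:
  assumes "triple X Y Z" "triple X' Y' Z'"
  shows "triple (X * X') (Y * Y') (Z * Z')"
  using tripleD[OF assms(1)] tripleD[OF assms(2)] triple_swap[OF assms]
  by (intro tripleI) (auto simp: assoc_mult_mat_vec[of _ m m _ m] b_closed)

text \<open>
  The algebra of all triples, represented by their first entries; the other two entries are
  functions of the first.
\<close>

definition product_algebra :: "(complex, complex mat) module" where
  "product_algebra = \<lparr>carrier = {X. \<exists>Y Z. triple X Y Z}, mult = (*), one = 1\<^sub>m m,
     zero = 0\<^sub>m m m, add = (+), smult = (\<cdot>\<^sub>m)\<rparr>"

definition second :: "complex mat \<Rightarrow> complex mat" where
  "second X = (THE Y. \<exists>Z. triple X Y Z)"

definition third :: "complex mat \<Rightarrow> complex mat" where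
  "third X = (THE Z. \<exists>Y. triple X Y Z)"

lemma second_third_eq:
  assumes "triple X Y Z"
  shows "second X = Y" "third X = Z"
  unfolding second_def third_def using assms triple_unique by blast+

lemma triple_second_third: "X \<in> carrier product_algebra \<Longrightarrow> triple X (second X) (third X)"
  using second_third_eq by (fastforce simp: product_algebra_def)

lemma product_algebra_simps [simp]:
  "X \<otimes>\<^bsub>product_algebra\<^esub> Y = X * Y" "X \<oplus>\<^bsub>product_algebra\<^esub> Y = X + Y"
  "c \<odot>\<^bsub>product_algebra\<^esub> X = c \<cdot>\<^sub>m X" "\<one>\<^bsub>product_algebra\<^esub> = 1\<^sub>m m" "\<zero>\<^bsub>product_algebra\<^esub> = 0\<^sub>m m m"
  by (simp_all add: product_algebra_def)

lemma product_algebra_memI: "triple X Y Z \<Longrightarrow> X \<in> carrier product_algebra"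
  by (auto simp: product_algebra_def)

lemma product_algebra_carrier_mat: "X \<in> carrier product_algebra \<Longrightarrow> X \<in> carrier_mat m m"
  using triple_second_third tripleD(1) by blast

lemma product_algebra_closed:
  assumes "X \<in> carrier product_algebra" "X' \<in> carrier product_algebra"
  shows "X * X' \<in> carrier product_algebra" "X + X' \<in> carrier product_algebra" "c \<cdot>\<^sub>m X \<in> carrier product_algebra"
  by (rule product_algebra_memI, rule triple_mult triple_add triple_smult,
      (rule triple_second_third assms)+)+

lemma algebra_product_algebra: "algebra CC product_algebra"
proof (rule algebraI)
  note cl = product_algebra_closed and mat = product_algebra_carrier_mat
  have unit: "1\<^sub>m m \<in> carrier product_algebra" "0\<^sub>m m m \<in> carrier product_algebra"
    using product_algebra_memI triple_one triple_zero by blast+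
  show "cring CC" by (rule class_cring.cring_axioms)
  show "cring product_algebra"
  proof (rule cringI)
    show "abelian_group product_algebra"
    proof (rule abelian_groupI)
      fix X assume X: "X \<in> carrier product_algebra"
      have "-1 \<cdot>\<^sub>m X + X = 0\<^sub>m m m" using mat[OF X] by (intro eq_matI) auto
      then show "\<exists>Y\<in>carrier product_algebra. Y \<oplus>\<^bsub>product_algebra\<^esub> X = \<zero>\<^bsub>product_algebra\<^esub>"
        using cl(3)[OF X X, of "-1"] by (intro bexI[of _ "-1 \<cdot>\<^sub>m X"]) simp_all
    next
      fix X Y Z
      assume "X \<in> carrier product_algebra" "Y \<in> carrier product_algebra" "Z \<in> carrier product_algebra"
      then show "X \<oplus>\<^bsub>product_algebra\<^esub> Y \<oplus>\<^bsub>product_algebra\<^esub> Z = X \<oplus>\<^bsub>product_algebra\<^esub> (Y \<oplus>\<^bsub>product_algebra\<^esub> Z)"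
        using mat by (simp add: assoc_add_mat[of _ m m])
    next
      fix X Y assume "X \<in> carrier product_algebra" "Y \<in> carrier product_algebra"
      then show "X \<oplus>\<^bsub>product_algebra\<^esub> Y = Y \<oplus>\<^bsub>product_algebra\<^esub> X"
        using mat by (simp add: comm_add_mat[of _ m m])
    qed (use cl unit mat in \<open>auto intro: left_add_zero_mat\<close>)
    show "comm_monoid product_algebra"
    proof (rule comm_monoidI)
      fix X Y Z
      assume "X \<in> carrier product_algebra" "Y \<in> carrier product_algebra" "Z \<in> carrier product_algebra"
      then show "X \<otimes>\<^bsub>product_algebra\<^esub> Y \<otimes>\<^bsub>product_algebra\<^esub> Z = X \<otimes>\<^bsub>product_algebra\<^esub> (Y \<otimes>\<^bsub>product_algebra\<^esub> Z)"
        using mat by (simp add: assoc_mult_mat[of _ m m _ m _ m])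
    next
      fix X Y assume "X \<in> carrier product_algebra" "Y \<in> carrier product_algebra"
      then show "X \<otimes>\<^bsub>product_algebra\<^esub> Y = Y \<otimes>\<^bsub>product_algebra\<^esub> X"
        using triple_commute triple_second_third by (metis product_algebra_simps(1))
    qed (use cl unit left_mult_one_mat[OF mat] in auto)
    fix X Y Z
    assume "X \<in> carrier product_algebra" "Y \<in> carrier product_algebra" "Z \<in> carrier product_algebra"
    then show "(X \<oplus>\<^bsub>product_algebra\<^esub> Y) \<otimes>\<^bsub>product_algebra\<^esub> Z =
        X \<otimes>\<^bsub>product_algebra\<^esub> Z \<oplus>\<^bsub>product_algebra\<^esub> Y \<otimes>\<^bsub>product_algebra\<^esub> Z"
      using mat by (simp add: add_mult_distrib_mat[of _ m m _ _ m])
  qed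
  fix a c :: complex and X Y assume X: "X \<in> carrier product_algebra" and Y: "Y \<in> carrier product_algebra"
  show "a \<odot>\<^bsub>product_algebra\<^esub> X \<in> carrier product_algebra" using cl(3)[OF X X] by simp
  show "(a \<oplus>\<^bsub>CC\<^esub> c) \<odot>\<^bsub>product_algebra\<^esub> X = a \<odot>\<^bsub>product_algebra\<^esub> X \<oplus>\<^bsub>product_algebra\<^esub> c \<odot>\<^bsub>product_algebra\<^esub> X"
    using mat[OF X] by (auto simp: algebra_simps intro!: eq_matI)
  show "a \<odot>\<^bsub>product_algebra\<^esub> (X \<oplus>\<^bsub>product_algebra\<^esub> Y) = a \<odot>\<^bsub>product_algebra\<^esub> X \<oplus>\<^bsub>product_algebra\<^esub> a \<odot>\<^bsub>product_algebra\<^esub> Y"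
    using mat[OF X] mat[OF Y] by (auto simp: algebra_simps intro!: eq_matI)
  show "(a \<otimes>\<^bsub>CC\<^esub> c) \<odot>\<^bsub>product_algebra\<^esub> X = a \<odot>\<^bsub>product_algebra\<^esub> (c \<odot>\<^bsub>product_algebra\<^esub> X)"
    by (auto intro!: eq_matI)
  show "\<one>\<^bsub>CC\<^esub> \<odot>\<^bsub>product_algebra\<^esub> X = X" by (auto intro!: eq_matI)
  show "(a \<odot>\<^bsub>product_algebra\<^esub> X) \<otimes>\<^bsub>product_algebra\<^esub> Y = a \<odot>\<^bsub>product_algebra\<^esub> (X \<otimes>\<^bsub>product_algebra\<^esub> Y)"
    using mat[OF X] mat[OF Y] by (simp add: mult_smult_assoc_mat[of _ m m _ m])
qed

text \<open>One construction for all three modules: \<open>\<rho>\<close> selects an entry of the triple of \<open>X\<close>.\<close>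

definition matrix_module :: "(complex mat \<Rightarrow> complex mat) \<Rightarrow> (complex mat, complex vec) module" where
  "matrix_module \<rho> = \<lparr>carrier = carrier_vec m, mult = undefined, one = undefined,
     zero = 0\<^sub>v m, add = (+), smult = (\<lambda>X v. \<rho> X *\<^sub>v v)\<rparr>"

lemma matrix_module_simps [simp]:
  "carrier (matrix_module \<rho>) = carrier_vec m" "x \<oplus>\<^bsub>matrix_module \<rho>\<^esub> y = x + y"
  "X \<odot>\<^bsub>matrix_module \<rho>\<^esub> x = \<rho> X *\<^sub>v x" "\<zero>\<^bsub>matrix_module \<rho>\<^esub> = 0\<^sub>v m"
  by (simp_all add: matrix_module_def)

definition representation :: "(complex mat \<Rightarrow> complex mat) \<Rightarrow> bool" where
  "representation \<rho> \<longleftrightarrow>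
     (\<forall>X\<in>carrier product_algebra. \<rho> X \<in> carrier_mat m m \<and> (\<forall>c. \<rho> (c \<cdot>\<^sub>m X) = c \<cdot>\<^sub>m \<rho> X)) \<and>
     (\<forall>X\<in>carrier product_algebra. \<forall>Y\<in>carrier product_algebra.
        \<rho> (X + Y) = \<rho> X + \<rho> Y \<and> \<rho> (X * Y) = \<rho> X * \<rho> Y) \<and> \<rho> (1\<^sub>m m) = 1\<^sub>m m"

lemma representations: "representation (\<lambda>X. X)" "representation second" "representation third"
proof -
  note t = triple_second_third
  have "second (X + Y) = second X + second Y" "third (X + Y) = third X + third Y"
    "second (X * Y) = second X * second Y" "third (X * Y) = third X * third Y"
    if "X \<in> carrier product_algebra" "Y \<in> carrier product_algebra" for X Y
    using second_third_eq[OF triple_add[OF t[OF that(1)] t[OF that(2)]]]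
      second_third_eq[OF triple_mult[OF t[OF that(1)] t[OF that(2)]]] by auto
  moreover have "second (c \<cdot>\<^sub>m X) = c \<cdot>\<^sub>m second X" "third (c \<cdot>\<^sub>m X) = c \<cdot>\<^sub>m third X"
    if "X \<in> carrier product_algebra" for X c
    using second_third_eq[OF triple_smult[OF t[OF that]]] by auto
  moreover note second_third_eq[OF triple_one] tripleD(1-3)[OF t]
  ultimately show "representation (\<lambda>X. X)" "representation second" "representation third"
    by (auto simp: representation_def)
qed

lemma matrix_module_module:
  assumes "representation \<rho>"
  shows "Module.module product_algebra (matrix_module \<rho>)"
proof (rule moduleI)
  have \<rho>: "\<rho> X \<in> carrier_mat m m" "\<rho> (X + Y) = \<rho> X + \<rho> Y" "\<rho> (X * Y) = \<rho> X * \<rho> Y" "\<rho> (1\<^sub>m m) = 1\<^sub>m m"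
    if "X \<in> carrier product_algebra" "Y \<in> carrier product_algebra" for X Y
    using assms that by (auto simp: representation_def)
  show "cring product_algebra" using algebra_product_algebra by (simp add: algebra_def)
  show "abelian_group (matrix_module \<rho>)"
  proof (rule abelian_groupI)
    fix x assume "x \<in> carrier (matrix_module \<rho>)"
    then show "\<exists>y\<in>carrier (matrix_module \<rho>). y \<oplus>\<^bsub>matrix_module \<rho>\<^esub> x = \<zero>\<^bsub>matrix_module \<rho>\<^esub>"
      by (intro bexI[of _ "- x"]) auto
  qed (auto simp: assoc_add_vec[of _ m] comm_add_vec[of _ m])
  fix X Y x assume X: "X \<in> carrier product_algebra" and Y: "Y \<in> carrier product_algebra"
    and x: "x \<in> carrier (matrix_module \<rho>)"
  note r = \<rho>[OF X Y] \<rho>(1)[OF Y Y]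
  show "X \<odot>\<^bsub>matrix_module \<rho>\<^esub> x \<in> carrier (matrix_module \<rho>)" using r x by auto
  show "(X \<oplus>\<^bsub>product_algebra\<^esub> Y) \<odot>\<^bsub>matrix_module \<rho>\<^esub> x =
      X \<odot>\<^bsub>matrix_module \<rho>\<^esub> x \<oplus>\<^bsub>matrix_module \<rho>\<^esub> Y \<odot>\<^bsub>matrix_module \<rho>\<^esub> x"
    using r x by (simp add: add_mult_distrib_mat_vec[of _ m m])
  show "(X \<otimes>\<^bsub>product_algebra\<^esub> Y) \<odot>\<^bsub>matrix_module \<rho>\<^esub> x = X \<odot>\<^bsub>matrix_module \<rho>\<^esub> (Y \<odot>\<^bsub>matrix_module \<rho>\<^esub> x)"
    using r x by (simp add: assoc_mult_mat_vec[of _ m m _ m])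
  fix y assume y: "y \<in> carrier (matrix_module \<rho>)"
  show "X \<odot>\<^bsub>matrix_module \<rho>\<^esub> (x \<oplus>\<^bsub>matrix_module \<rho>\<^esub> y) =
      X \<odot>\<^bsub>matrix_module \<rho>\<^esub> x \<oplus>\<^bsub>matrix_module \<rho>\<^esub> X \<odot>\<^bsub>matrix_module \<rho>\<^esub> y"
    using r x y by (simp add: mult_add_distrib_mat_vec[of _ m m])
next
  fix x assume "x \<in> carrier (matrix_module \<rho>)"
  then show "\<one>\<^bsub>product_algebra\<^esub> \<odot>\<^bsub>matrix_module \<rho>\<^esub> x = x"
    using assms by (simp add: representation_def)
qed

lemma restricted_smult:
  assumes "representation \<rho>" "x \<in> carrier_vec m"
  shows "c \<odot>\<^bsub>restrict_scalars product_algebra (matrix_module \<rho>)\<^esub> x = c \<cdot>\<^sub>v x"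
proof -
  have "\<rho> (c \<cdot>\<^sub>m 1\<^sub>m m) = c \<cdot>\<^sub>m 1\<^sub>m m"
    using assms(1) product_algebra_memI[OF triple_one] by (simp add: representation_def)
  then show ?thesis using assms(2) by (simp add: smult_mat_vec[of _ m])
qed

lemma has_dim_matrix_module:
  assumes "representation \<rho>"
  shows "has_dim (restrict_scalars product_algebra (matrix_module \<rho>)) m"
proof (rule has_dim_linear_iso[OF vectorspace_Cvec])
  show "vectorspace CC (restrict_scalars product_algebra (matrix_module \<rho>))"
    by (rule vectorspace_restrict_scalars[OF algebra_product_algebra matrix_module_module[OF assms]])
  show "linear_iso (Cvec m) (restrict_scalars product_algebra (matrix_module \<rho>)) (\<lambda>x. x)"
    unfolding linear_iso_def using restricted_smult[OF assms]
    by (auto simp: bij_betw_def simp del: restrict_scalars_simps(4) intro!: linear_mapsI)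
  show "has_dim (Cvec m) m" by (simp add: has_dim_def vec_space.dim_is_n fin_dim_Cvec)
qed

text \<open>
  Scalars \<open>c \<cdot> 1\<close> act on vectors of \<open>\<complex>\<^sup>m\<close> as \<open>c\<close>.  The dual space sees the scalar action on the carrier
  only, so the two dual spaces are equal as records.
\<close>

lemma restricted_dual_matrix_module:
  assumes "representation \<rho>"
  shows "restricted_dual product_algebra (matrix_module \<rho>) = dual_space (Cvec m)"
proof -
  have "carrier (restricted_dual product_algebra (matrix_module \<rho>)) = carrier (dual_space (Cvec m))"
    using restricted_smult[OF assms]
    by (auto intro!: dual_memI dest: dual_memD simp: dual_memD simp del: restrict_scalars_simps(4))
  then show ?thesis by (simp add: dual_space_def)
qed

end

context nondegenerate_product
begin

lemma b_zero:
  assumes "x \<in> carrier_vec m"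
  shows "b (0\<^sub>v m) x = 0\<^sub>v m" "b x (0\<^sub>v m) = 0\<^sub>v m"
proof -
  have z: "0 \<cdot>\<^sub>v v = 0\<^sub>v m" if "v \<in> carrier_vec m" for v :: "complex vec"
    using that by (intro eq_vecI) auto
  show "b (0\<^sub>v m) x = 0\<^sub>v m" using b_smult1[of "0\<^sub>v m" x 0] assms z b_closed by simp
  show "b x (0\<^sub>v m) = 0\<^sub>v m" using b_smult2[of x "0\<^sub>v m" 0] assms z b_closed by simp
qed

text \<open>
  The map \<open>b\<close> is balanced because \<open>(X, second X, third X)\<close> is a triple.  The image of the induced map
  is a subspace containing all values of \<open>b\<close>, so no nonzero functional vanishes on it, and it is the
  whole space.
\<close>

lemma induced_surjection:
  assumes dim: "dim_at_least product_algebra m"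
  obtains \<phi> where
    "nondegenerate_surjection m product_algebra (matrix_module (\<lambda>X. X)) (matrix_module second) (matrix_module third) \<phi>"
    and "acts_faithfully product_algebra (matrix_module (\<lambda>X. X)) (matrix_module second) (matrix_module third)"
    and "\<And>x y. \<lbrakk>x \<in> carrier_vec m; y \<in> carrier_vec m\<rbrakk> \<Longrightarrow>
      \<phi> (pure_tensor product_algebra (matrix_module (\<lambda>X. X)) (matrix_module second) x y) = b x y"
proof -
  let ?N1 = "matrix_module (\<lambda>X. X)" and ?N2 = "matrix_module second" and ?N3 = "matrix_module third"
  note modules = representations[THEN matrix_module_module]
  interpret module_pair product_algebra ?N1 ?N2
    by (intro module_pair.intro modules)
  let ?P = "tensor_product product_algebra ?N1 ?N2"
  obtain \<phi> where hom: "\<phi> \<in> LinearCombinations.module_hom product_algebra ?P ?N3"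
    and pure: "\<And>x y. \<lbrakk>x \<in> carrier ?N1; y \<in> carrier ?N2\<rbrakk> \<Longrightarrow> \<phi> (pure_tensor product_algebra ?N1 ?N2 x y) = b x y"
    and sub: "LinearCombinations.submodule product_algebra (\<phi> ` carrier ?P) ?N3"
  proof (rule balanced_map_induces_hom[OF modules(3), of b])
    fix X x y assume "X \<in> carrier product_algebra" "x \<in> carrier ?N1" "y \<in> carrier ?N2"
    then show "b (X \<odot>\<^bsub>?N1\<^esub> x) y = X \<odot>\<^bsub>?N3\<^esub> b x y" "b x (X \<odot>\<^bsub>?N2\<^esub> y) = X \<odot>\<^bsub>?N3\<^esub> b x y"
      using tripleD(4,5)[OF triple_second_third] by simp_all
  qed (auto simp: b_closed b_add1 b_add2)
  have onto: "\<phi> ` carrier ?P = carrier ?N3"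
  proof -
    let ?W = "restrict_scalars product_algebra ?N3"
    have W: "vectorspace CC ?W"
      by (rule vectorspace_restrict_scalars[OF algebra_product_algebra modules(3)])
    have fd: "vectorspace.fin_dim CC ?W"
      using has_dim_matrix_module[OF representations(3)] by (simp add: has_dim_def)
    have "LinearCombinations.submodule CC (\<phi> ` carrier ?P) ?W"
    proof (rule LinearCombinations.submodule.intro)
      show "module CC ?W" by (rule vectorspace_CCD[OF W])
      show "c \<odot>\<^bsub>?W\<^esub> v \<in> \<phi> ` carrier ?P" if "v \<in> \<phi> ` carrier ?P" for c v
        using LinearCombinations.submodule.smult_closed[OF sub _ that]
          algebra_smult_one(1)[OF algebra_product_algebra product_algebra_memI[OF triple_one], of c]
        by simp
    qed (use LinearCombinations.submodule.subset[OF sub] LinearCombinations.submodule.m_closed[OF sub]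
        LinearCombinations.submodule.zero_closed[OF sub] in auto)
    then have "\<phi> ` carrier ?P = carrier ?W"
    proof (rule submodule_eq_carrierI[OF W fd])
      fix \<alpha> assume "\<alpha> \<in> carrier (dual_space ?W)" and ann: "\<And>s. s \<in> \<phi> ` carrier ?P \<Longrightarrow> \<alpha> s = 0"
      then have "\<alpha> \<in> coord_functional m ` carrier_vec m"
        using coord_functional_bij restricted_dual_matrix_module[OF representations(3)] by (simp add: bij_betw_def)
      then obtain z where z: "z \<in> carrier_vec m" "\<alpha> = coord_functional m z" by blast
      have "z = 0\<^sub>v m"
      proof (rule inj3[OF z(1)])
        fix x y :: "complex vec" assume xy: "x \<in> carrier_vec m" "y \<in> carrier_vec m"
        then have "b x y \<in> \<phi> ` carrier ?P"
          using pure[of x y] pure_tensor_carrier[of x y] by (metis imageI matrix_module_simps(1))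
        from ann[OF this] show "b x y \<bullet> z = b x y \<bullet> 0\<^sub>v m" using z b_closed[OF xy] by simp
      qed simp
      then show "\<forall>x\<in>carrier ?W. \<alpha> x = 0" using z by simp
    qed
    then show ?thesis by simp
  qed
  show ?thesis
  proof (rule that)
    have "\<exists>y\<in>carrier ?N2. \<phi> (pure_tensor product_algebra ?N1 ?N2 x y) \<noteq> \<zero>\<^bsub>?N3\<^esub>"
      if x: "x \<in> carrier ?N1 - {\<zero>\<^bsub>?N1\<^esub>}" for x
    proof (rule ccontr)
      assume "\<not> ?thesis"
      then have "b x y = b (0\<^sub>v m) y" if "y \<in> carrier_vec m" for y
        using that x pure[of x y] b_zero by auto
      then have "x = 0\<^sub>v m" using x by (rule_tac inj1) auto
      then show False using x by simp
    qed
    moreover have "\<exists>x\<in>carrier ?N1. \<phi> (pure_tensor product_algebra ?N1 ?N2 x y) \<noteq> \<zero>\<^bsub>?N3\<^esub>"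
      if y: "y \<in> carrier ?N2 - {\<zero>\<^bsub>?N2\<^esub>}" for y
    proof (rule ccontr)
      assume "\<not> ?thesis"
      then have "b x y = b x (0\<^sub>v m)" if "x \<in> carrier_vec m" for x
        using that y pure[of x y] b_zero by auto
      then have "y = 0\<^sub>v m" using y by (rule_tac inj2) auto
      then show False using y by simp
    qed
    ultimately show "nondegenerate_surjection m product_algebra ?N1 ?N2 ?N3 \<phi>"
      unfolding nondegenerate_surjection_def
      using algebra_product_algebra modules representations[THEN has_dim_matrix_module] dim hom onto
      by blast
    show "acts_faithfully product_algebra ?N1 ?N2 ?N3"
      unfolding acts_faithfully_def
    proof (intro ballI impI)
      fix X assume X: "X \<in> carrier product_algebra"
        and zero: "(\<forall>x\<in>carrier ?N1. X \<odot>\<^bsub>?N1\<^esub> x = \<zero>\<^bsub>?N1\<^esub>) \<and> (\<forall>x\<in>carrier ?N2. X \<odot>\<^bsub>?N2\<^esub> x = \<zero>\<^bsub>?N2\<^esub>) \<and>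
          (\<forall>x\<in>carrier ?N3. X \<odot>\<^bsub>?N3\<^esub> x = \<zero>\<^bsub>?N3\<^esub>)"
      have "X = 0\<^sub>m m m"
        by (rule mat_eqI_vec[OF product_algebra_carrier_mat[OF X]]) (use zero in auto)
      then show "X = \<zero>\<^bsub>product_algebra\<^esub>" by simp
    qed
  qed (use pure in simp)
qed

end

section \<open>The product of a concise tensor\<close>

locale concise_tensor =
  fixes m :: nat and T :: "(complex vec \<Rightarrow> complex) \<times> (complex vec \<Rightarrow> complex) \<times> (complex vec \<Rightarrow> complex) \<Rightarrow> complex"
  assumes T: "T \<in> carrier (tensor_space (Cvec m) (Cvec m) (Cvec m))"
    and concise: "concise (Cvec m) (Cvec m) (Cvec m) T"
begin

abbreviation "\<xi> \<equiv> coord_functional m"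

text \<open>
  \<open>T\<close> as a bilinear map \<open>U\<^sup>* \<times> V\<^sup>* \<rightarrow> W\<close>, where \<open>\<xi>\<close> identifies \<open>\<complex>\<^sup>m\<close> with the dual spaces \<open>U\<^sup>*\<close> and \<open>V\<^sup>*\<close>.
  It is characterised by \<open>T (\<xi> x, \<xi> y, \<gamma>) = \<gamma> (b x y)\<close>.
\<close>

definition b :: "complex vec \<Rightarrow> complex vec \<Rightarrow> complex vec" where
  "b x y = vec m (\<lambda>k. T (\<xi> x, \<xi> y, \<xi> (unit_vec m k)))"

lemma functionalE:
  assumes "\<alpha> \<in> carrier (dual_space (Cvec m))"
  obtains x where "x \<in> carrier_vec m" "\<alpha> = \<xi> x"
  using assms coord_functional_bij[of m] by (auto simp: bij_betw_def)

lemma T_eq: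
  assumes x: "x \<in> carrier_vec m" and y: "y \<in> carrier_vec m" and \<gamma>: "\<gamma> \<in> carrier (dual_space (Cvec m))"
  shows "T (\<xi> x, \<xi> y, \<gamma>) = \<gamma> (b x y)"
proof -
  obtain z where z: "z \<in> carrier_vec m" "\<gamma> = \<xi> z" using functionalE[OF \<gamma>] .
  have "(\<lambda>z\<in>carrier_vec m. T (\<xi> x, \<xi> y, \<xi> z)) \<in> carrier (dual_space (Cvec m))"
    using linear_mapsD(2,3)[OF coord_functional_linear[of m]] coord_functional_mem x y
    by (intro dual_memI) (auto simp: tensor_linear[OF T])
  from Cvec_functional_expansion[OF this z(1)]
  have "T (\<xi> x, \<xi> y, \<xi> z) = (\<Sum>k<m. z $ k * b x y $ k)" using z by (simp add: b_def)
  also have "\<dots> = b x y \<bullet> z" using z by (simp add: scalar_prod_def atLeast0LessThan mult.commute)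
  also have "\<dots> = \<xi> z (b x y)" by (simp add: b_def)
  finally show ?thesis using z by simp
qed

sublocale nondegenerate_product m b
proof
  note lin = linear_mapsD(2,3)[OF coord_functional_linear[of m]] and mem = coord_functional_mem[of _ m]
  show "(\<lambda>x. b x y) \<in> linear_maps (Cvec m) (Cvec m)" if "y \<in> carrier_vec m" for y
    by (rule linear_mapsI)
      (use that lin mem in \<open>auto simp: b_def tensor_linear[OF T] intro!: eq_vecI\<close>)
  show "(\<lambda>y. b x y) \<in> linear_maps (Cvec m) (Cvec m)" if "x \<in> carrier_vec m" for x
    by (rule linear_mapsI)
      (use that lin mem in \<open>auto simp: b_def tensor_linear[OF T] intro!: eq_vecI\<close>)
  have inj: "\<xi> x = \<xi> y \<Longrightarrow> x = y" if "x \<in> carrier_vec m" "y \<in> carrier_vec m" for x y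
    using coord_functional_bij[of m] that by (auto simp: bij_betw_def inj_on_def)
  show "x = x'" if x: "x \<in> carrier_vec m" "x' \<in> carrier_vec m"
    and eq: "\<And>y. y \<in> carrier_vec m \<Longrightarrow> b x y = b x' y" for x x'
  proof (rule inj[OF x])
    have "T (\<xi> x, \<beta>, \<gamma>) = T (\<xi> x', \<beta>, \<gamma>)"
      if \<beta>: "\<beta> \<in> carrier (dual_space (Cvec m))" and \<gamma>: "\<gamma> \<in> carrier (dual_space (Cvec m))" for \<beta> \<gamma>
    proof -
      obtain y where "y \<in> carrier_vec m" "\<beta> = \<xi> y" using functionalE[OF \<beta>] .
      then show ?thesis using T_eq[OF _ _ \<gamma>] x eq by simp
    qed
    then have "contract1 (Cvec m) (Cvec m) (Cvec m) T (\<xi> x) = contract1 (Cvec m) (Cvec m) (Cvec m) T (\<xi> x')"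
      by (auto simp: contract1_def intro!: restrict_ext)
    then show "\<xi> x = \<xi> x'" using concise mem x unfolding concise_def inj_on_def by blast
  qed
  show "y = y'" if y: "y \<in> carrier_vec m" "y' \<in> carrier_vec m"
    and eq: "\<And>x. x \<in> carrier_vec m \<Longrightarrow> b x y = b x y'" for y y'
  proof (rule inj[OF y])
    have "T (\<alpha>, \<xi> y, \<gamma>) = T (\<alpha>, \<xi> y', \<gamma>)"
      if \<alpha>: "\<alpha> \<in> carrier (dual_space (Cvec m))" and \<gamma>: "\<gamma> \<in> carrier (dual_space (Cvec m))" for \<alpha> \<gamma>
    proof -
      obtain x where "x \<in> carrier_vec m" "\<alpha> = \<xi> x" using functionalE[OF \<alpha>] .
      then show ?thesis using T_eq[OF _ _ \<gamma>] y eq by simp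
    qed
    then have "contract2 (Cvec m) (Cvec m) (Cvec m) T (\<xi> y) = contract2 (Cvec m) (Cvec m) (Cvec m) T (\<xi> y')"
      by (auto simp: contract2_def intro!: restrict_ext)
    then show "\<xi> y = \<xi> y'" using concise mem y unfolding concise_def inj_on_def by blast
  qed
  show "z = z'" if z: "z \<in> carrier_vec m" "z' \<in> carrier_vec m"
    and eq: "\<And>x y. \<lbrakk>x \<in> carrier_vec m; y \<in> carrier_vec m\<rbrakk> \<Longrightarrow> b x y \<bullet> z = b x y \<bullet> z'" for z z'
  proof (rule inj[OF z])
    have "T (\<alpha>, \<beta>, \<xi> z) = T (\<alpha>, \<beta>, \<xi> z')"
      if \<alpha>: "\<alpha> \<in> carrier (dual_space (Cvec m))" and \<beta>: "\<beta> \<in> carrier (dual_space (Cvec m))" for \<alpha> \<beta>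
    proof -
      obtain x where x: "x \<in> carrier_vec m" "\<alpha> = \<xi> x" using functionalE[OF \<alpha>] .
      obtain y where y: "y \<in> carrier_vec m" "\<beta> = \<xi> y" using functionalE[OF \<beta>] .
      have "b x y \<in> carrier_vec m" by (simp add: b_def)
      then show ?thesis
        using T_eq[OF x(1) y(1) mem[OF z(1)]] T_eq[OF x(1) y(1) mem[OF z(2)]] eq[OF x(1) y(1)] x y by simp
    qed
    then have "contract3 (Cvec m) (Cvec m) (Cvec m) T (\<xi> z) = contract3 (Cvec m) (Cvec m) (Cvec m) T (\<xi> z')"
      by (auto simp: contract3_def intro!: restrict_ext)
    then show "\<xi> z = \<xi> z'" using concise mem z unfolding concise_def inj_on_def by blast
  qed
qed

lemma tensor_eqI_coord:
  assumes s: "s \<in> carrier (tensor_space (Cvec m) (Cvec m) (Cvec m))"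
    and t: "t \<in> carrier (tensor_space (Cvec m) (Cvec m) (Cvec m))"
    and eq: "\<And>x y \<gamma>. \<lbrakk>x \<in> carrier_vec m; y \<in> carrier_vec m; \<gamma> \<in> carrier (dual_space (Cvec m))\<rbrakk> \<Longrightarrow>
      s (\<xi> x, \<xi> y, \<gamma>) = t (\<xi> x, \<xi> y, \<gamma>)"
  shows "s = t"
proof (rule tensor_eqI[OF s t])
  fix \<alpha> \<beta> \<gamma> assume \<alpha>: "\<alpha> \<in> carrier (dual_space (Cvec m))" and \<beta>: "\<beta> \<in> carrier (dual_space (Cvec m))"
    and \<gamma>: "\<gamma> \<in> carrier (dual_space (Cvec m))"
  obtain x where "x \<in> carrier_vec m" "\<alpha> = \<xi> x" using functionalE[OF \<alpha>] .
  moreover obtain y where "y \<in> carrier_vec m" "\<beta> = \<xi> y" using functionalE[OF \<beta>] .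
  ultimately show "s (\<alpha>, \<beta>, \<gamma>) = t (\<alpha>, \<beta>, \<gamma>)" using eq \<gamma> by simp
qed

definition coords :: "(complex vec \<Rightarrow> complex) \<Rightarrow> complex vec" where
  "coords = inv_into (carrier_vec m) \<xi>"

lemma coords_\<xi>: "x \<in> carrier_vec m \<Longrightarrow> coords (\<xi> x) = x"
  unfolding coords_def using coord_functional_bij[of m] by (simp add: bij_betw_def)

lemma coords_linear: "coords \<in> linear_maps (dual_space (Cvec m)) (Cvec m)"
proof (rule linear_mapsI)
  note lin = linear_mapsD(2,3)[OF coord_functional_linear[of m]]
  fix \<alpha> assume \<alpha>: "\<alpha> \<in> carrier (dual_space (Cvec m))"
  obtain x where x: "x \<in> carrier_vec m" "\<alpha> = \<xi> x" using functionalE[OF \<alpha>] .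
  show "coords \<alpha> \<in> carrier (Cvec m)" using x coords_\<xi> by simp
  show "coords (c \<odot>\<^bsub>dual_space (Cvec m)\<^esub> \<alpha>) = c \<odot>\<^bsub>Cvec m\<^esub> coords \<alpha>" for c
  proof -
    have "c \<odot>\<^bsub>dual_space (Cvec m)\<^esub> \<alpha> = \<xi> (c \<cdot>\<^sub>v x)" using lin(2)[of x c] x by simp
    then show ?thesis using x by (simp add: coords_\<xi>)
  qed
  fix \<beta> assume \<beta>: "\<beta> \<in> carrier (dual_space (Cvec m))"
  obtain y where y: "y \<in> carrier_vec m" "\<beta> = \<xi> y" using functionalE[OF \<beta>] .
  show "coords (\<alpha> \<oplus>\<^bsub>dual_space (Cvec m)\<^esub> \<beta>) = coords \<alpha> \<oplus>\<^bsub>Cvec m\<^esub> coords \<beta>"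
  proof -
    have "\<alpha> \<oplus>\<^bsub>dual_space (Cvec m)\<^esub> \<beta> = \<xi> (x + y)" using lin(1)[of x y] x y by simp
    then show ?thesis using x y by (simp add: coords_\<xi>)
  qed
qed

lemma linear_comp:
  assumes "f \<in> linear_maps P Q" "g \<in> linear_maps Q R"
  shows "(\<lambda>x. g (f x)) \<in> linear_maps P R"
  using linear_mapsD[OF assms(1)] linear_mapsD[OF assms(2)] by (intro linear_mapsI) auto

lemma matrix_linear:
  assumes "M \<in> carrier_mat m m"
  shows "(\<lambda>v. M *\<^sub>v v) \<in> linear_maps (Cvec m) (Cvec m)"
  using assms by (intro linear_mapsI) (auto simp: mult_add_distrib_mat_vec[of _ m m] mult_mat_vec[of _ m m])

text \<open>
  A tensor of the intersection is \<open>(X, 1, 1) T = (1, Y, 1) T = (1, 1, Z) T\<close>, which in terms of \<open>b\<close> says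
  that the matrices of \<open>X\<close>, \<open>Y\<close> and the transpose of \<open>Z\<close> form a triple.  So the product algebra
  surjects linearly onto the intersection.
\<close>

lemma dim_at_least_product_algebra:
  assumes "abundant111 m (Cvec m) (Cvec m) (Cvec m) T"
  shows "dim_at_least product_algebra m"
  unfolding dim_at_least_def
proof
  let ?C = "Cvec m" and ?D = "dual_space (Cvec m)"
  let ?S = "tensor_space ?C ?C ?C" and ?I = "intersection_space ?C ?C ?C T"
  assume fd: "vectorspace.fin_dim CC product_algebra"
  note C = vectorspace_Cvec[of m] fin_dim_Cvec[of m]
  note I = intersection_space_finite_dim[OF C C C T]
  note pull = tensor_pullback_mem[OF C(1) C(1) C(1) _ _ _ T]
  note \<xi>mem = coord_functional_mem[of _ m]
  define P where "P M = (\<lambda>\<alpha>. \<xi> (M *\<^sub>v coords \<alpha>))" for M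
  have P: "P M \<in> linear_maps ?D ?D" if "M \<in> carrier_mat m m" for M
    unfolding P_def
    by (rule linear_comp[OF linear_comp[OF coords_linear matrix_linear[OF that]] coord_functional_linear])
  have P\<xi>: "P M (\<xi> x) = \<xi> (M *\<^sub>v x)" if "x \<in> carrier_vec m" for M x
    using that by (simp add: P_def coords_\<xi>)
  define Q where "Q M = (\<lambda>\<gamma> :: complex vec \<Rightarrow> complex. compose (carrier ?C) \<gamma> (\<lambda>v. M *\<^sub>v v))" for M
  have Q: "Q M \<in> linear_maps ?D ?D" if "M \<in> carrier_mat m m" for M
    unfolding Q_def by (rule transpose_linear[OF C(1) matrix_linear[OF that]])
  define \<Omega> where "\<Omega> X = tensor_pullback ?C ?C ?C (P X) (\<lambda>\<beta>. \<beta>) (\<lambda>\<gamma>. \<gamma>) T" for X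
  have \<Omega>_mem: "\<Omega> X \<in> carrier ?S" if "X \<in> carrier_mat m m" for X
    unfolding \<Omega>_def by (intro pull identity_linear P that)
  have \<Omega>_eq: "\<Omega> X (\<xi> x, \<xi> y, \<gamma>) = \<gamma> (b (X *\<^sub>v x) y)"
    if "X \<in> carrier_mat m m" "x \<in> carrier_vec m" "y \<in> carrier_vec m" "\<gamma> \<in> carrier ?D" for X x y \<gamma>
    using that by (simp add: \<Omega>_def tensor_pullback_apply \<xi>mem P\<xi> T_eq)
  have \<Omega>_int: "\<Omega> X \<in> carrier ?I" if X: "X \<in> carrier product_algebra" for X
  proof -
    note t = tripleD[OF triple_second_third[OF X]]
    show ?thesis
    proof (rule intersection_space_memI[OF C C C T P[OF t(1)] \<Omega>_def P[OF t(2)] _ Q[OF t(3)]])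
      show "\<Omega> X = tensor_pullback ?C ?C ?C (\<lambda>\<alpha>. \<alpha>) (P (second X)) (\<lambda>\<gamma>. \<gamma>) T"
        using t by (intro tensor_eqI_coord \<Omega>_mem pull identity_linear P)
          (simp_all add: \<Omega>_eq tensor_pullback_apply \<xi>mem P\<xi> T_eq)
      show "\<Omega> X = tensor_pullback ?C ?C ?C (\<lambda>\<alpha>. \<alpha>) (\<lambda>\<beta>. \<beta>) (Q (third X)) T"
        using t linear_mapsD(1)[OF Q[OF t(3)]] by (intro tensor_eqI_coord \<Omega>_mem pull identity_linear Q)
          (simp_all add: \<Omega>_eq tensor_pullback_apply \<xi>mem T_eq Q_def compose_def b_closed)
    qed
  qed
  have lin: "\<Omega> \<in> linear_maps product_algebra ?I"
  proof (rule linear_mapsI)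
    note TS = vectorspace_tensor_space[OF C(1) C(1) C(1)]
    note mat = product_algebra_carrier_mat
    fix X assume X: "X \<in> carrier product_algebra"
    have "\<Omega> (c \<cdot>\<^sub>m X) = c \<odot>\<^bsub>?S\<^esub> \<Omega> X" for c
      using mat[OF X]
      by (intro tensor_eqI_coord \<Omega>_mem vectorspace_closed(2)[OF TS])
        (auto simp: \<Omega>_eq tensor_space_simps \<xi>mem smult_mat_vec[of _ m] b_smult1 b_closed dual_memD(3)[of _ ?C, simplified])
    then show "\<Omega> (c \<odot>\<^bsub>product_algebra\<^esub> X) = c \<odot>\<^bsub>?I\<^esub> \<Omega> X" for c by simp
    fix Y assume Y: "Y \<in> carrier product_algebra"
    have "\<Omega> (X + Y) = \<Omega> X \<oplus>\<^bsub>?S\<^esub> \<Omega> Y"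
      using mat[OF X] mat[OF Y]
      by (intro tensor_eqI_coord \<Omega>_mem vectorspace_closed(1)[OF TS])
        (auto simp: \<Omega>_eq tensor_space_simps \<xi>mem add_mult_distrib_mat_vec[of _ m m] b_add1 b_closed
          dual_memD(2)[of _ ?C, simplified])
    then show "\<Omega> (X \<oplus>\<^bsub>product_algebra\<^esub> Y) = \<Omega> X \<oplus>\<^bsub>?I\<^esub> \<Omega> Y" by simp
  qed (rule \<Omega>_int)
  have "\<Omega> ` carrier product_algebra = carrier ?I"
  proof
    show "\<Omega> ` carrier product_algebra \<subseteq> carrier ?I" using \<Omega>_int by blast
    show "carrier ?I \<subseteq> \<Omega> ` carrier product_algebra"
    proof
      fix \<Theta> assume \<Theta>_int: "\<Theta> \<in> carrier ?I"
      obtain X' Y' Z' where X': "X' \<in> linear_maps ?D ?D" "\<Theta> = tensor_pullback ?C ?C ?C X' (\<lambda>\<beta>. \<beta>) (\<lambda>\<gamma>. \<gamma>) T"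
        and Y': "Y' \<in> linear_maps ?D ?D" "\<Theta> = tensor_pullback ?C ?C ?C (\<lambda>\<alpha>. \<alpha>) Y' (\<lambda>\<gamma>. \<gamma>) T"
        and Z': "Z' \<in> linear_maps ?D ?D" "\<Theta> = tensor_pullback ?C ?C ?C (\<lambda>\<alpha>. \<alpha>) (\<lambda>\<beta>. \<beta>) Z' T"
        using intersection_space_memE[OF C C C T \<Theta>_int] .
      have mat: "\<exists>M\<in>carrier_mat m m. \<forall>x\<in>carrier_vec m. L (\<xi> x) = \<xi> (M *\<^sub>v x)"
        if L: "L \<in> linear_maps ?D ?D" for L
      proof -
        obtain M where M: "M \<in> carrier_mat m m" "\<And>x. x \<in> carrier_vec m \<Longrightarrow> coords (L (\<xi> x)) = M *\<^sub>v x"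
          using linear_map_matrix[OF linear_comp[OF linear_comp[OF coord_functional_linear L] coords_linear]]
          by blast
        have "L (\<xi> x) = \<xi> (M *\<^sub>v x)" if x: "x \<in> carrier_vec m" for x
        proof -
          have "L (\<xi> x) \<in> carrier ?D" using linear_mapsD(1)[OF L] \<xi>mem[OF x] .
          then obtain y where "y \<in> carrier_vec m" "L (\<xi> x) = \<xi> y" by (rule functionalE)
          then show ?thesis using M(2)[OF x] coords_\<xi> by simp
        qed
        then show ?thesis using M(1) by blast
      qed
      obtain X where X: "X \<in> carrier_mat m m" "\<And>x. x \<in> carrier_vec m \<Longrightarrow> X' (\<xi> x) = \<xi> (X *\<^sub>v x)"
        using mat[OF X'(1)] by blast
      obtain Y where Y: "Y \<in> carrier_mat m m" "\<And>x. x \<in> carrier_vec m \<Longrightarrow> Y' (\<xi> x) = \<xi> (Y *\<^sub>v x)"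
        using mat[OF Y'(1)] by blast
      \<comment> \<open>\<open>Z\<close> is the transpose of \<open>Z'\<close>: row \<open>k\<close> is the functional \<open>Z'\<close> applied to coordinate \<open>k\<close>\<close>
      obtain Z where Z: "Z \<in> carrier_mat m m"
        "\<And>\<gamma> w. \<lbrakk>\<gamma> \<in> carrier ?D; w \<in> carrier_vec m\<rbrakk> \<Longrightarrow> Z' \<gamma> w = \<gamma> (Z *\<^sub>v w)"
      proof -
        define g where "g w = vec m (\<lambda>k. Z' (\<xi> (unit_vec m k)) w)" for w
        have Zmem: "Z' \<gamma> \<in> carrier ?D" if "\<gamma> \<in> carrier ?D" for \<gamma>
          using linear_mapsD(1)[OF Z'(1) that] .
        have g: "g \<in> linear_maps ?C ?C"
          using dual_memD(2,3)[OF Zmem[OF \<xi>mem]]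
          by (intro linear_mapsI) (auto simp: g_def intro!: eq_vecI)
        obtain Z where Z: "Z \<in> carrier_mat m m" "\<And>w. w \<in> carrier_vec m \<Longrightarrow> g w = Z *\<^sub>v w"
          using linear_map_matrix[OF g] by blast
        have "Z' \<gamma> w = \<gamma> (Z *\<^sub>v w)" if \<gamma>: "\<gamma> \<in> carrier ?D" and w: "w \<in> carrier_vec m" for \<gamma> w
        proof -
          obtain z where z: "z \<in> carrier_vec m" "\<gamma> = \<xi> z" using functionalE[OF \<gamma>] .
          have "(\<lambda>z\<in>carrier_vec m. Z' (\<xi> z) w) \<in> carrier ?D"
          proof (rule dual_memI)
            fix x y assume "x \<in> carrier ?C" "y \<in> carrier ?C"
            then show "(\<lambda>z\<in>carrier_vec m. Z' (\<xi> z) w) (x \<oplus>\<^bsub>?C\<^esub> y) =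
                (\<lambda>z\<in>carrier_vec m. Z' (\<xi> z) w) x + (\<lambda>z\<in>carrier_vec m. Z' (\<xi> z) w) y"
              using linear_mapsD(2)[OF linear_comp[OF coord_functional_linear Z'(1)], of x y] w
              by (simp add: dual_space_simps)
          next
            fix c x assume "x \<in> carrier ?C"
            then show "(\<lambda>z\<in>carrier_vec m. Z' (\<xi> z) w) (c \<odot>\<^bsub>?C\<^esub> x) = c * (\<lambda>z\<in>carrier_vec m. Z' (\<xi> z) w) x"
              using linear_mapsD(3)[OF linear_comp[OF coord_functional_linear Z'(1)], of x c] w
              by (simp add: dual_space_simps)
          qed simp
          from Cvec_functional_expansion[OF this z(1)]
          have "Z' \<gamma> w = (\<Sum>k<m. g w $ k * z $ k)" using z by (simp add: g_def mult.commute)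
          also have "\<dots> = \<gamma> (g w)" using z by (simp add: scalar_prod_def atLeast0LessThan g_def)
          finally show ?thesis using Z(2)[OF w] by simp
        qed
        with Z(1) show thesis by (rule that)
      qed
      have \<Theta>: "\<Theta> (\<xi> x, \<xi> y, \<gamma>) = \<gamma> (b (X *\<^sub>v x) y)" "\<Theta> (\<xi> x, \<xi> y, \<gamma>) = \<gamma> (b x (Y *\<^sub>v y))"
        "\<Theta> (\<xi> x, \<xi> y, \<gamma>) = \<gamma> (Z *\<^sub>v b x y)"
        if xy: "x \<in> carrier_vec m" "y \<in> carrier_vec m" and \<gamma>: "\<gamma> \<in> carrier ?D" for x y \<gamma>
      proof -
        show "\<Theta> (\<xi> x, \<xi> y, \<gamma>) = \<gamma> (b (X *\<^sub>v x) y)"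
          using xy \<gamma> X unfolding X'(2) by (simp add: tensor_pullback_apply \<xi>mem T_eq)
        show "\<Theta> (\<xi> x, \<xi> y, \<gamma>) = \<gamma> (b x (Y *\<^sub>v y))"
          using xy \<gamma> Y unfolding Y'(2) by (simp add: tensor_pullback_apply \<xi>mem T_eq)
        show "\<Theta> (\<xi> x, \<xi> y, \<gamma>) = \<gamma> (Z *\<^sub>v b x y)"
          using xy \<gamma> Z linear_mapsD(1)[OF Z'(1) \<gamma>] unfolding Z'(2)
          by (simp add: tensor_pullback_apply \<xi>mem T_eq b_closed)
      qed
      have "triple X Y Z"
      proof (rule tripleI[OF X(1) Y(1) Z(1)])
        fix x y :: "complex vec" assume xy: "x \<in> carrier_vec m" "y \<in> carrier_vec m"
        show "b (X *\<^sub>v x) y = Z *\<^sub>v b x y"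
        proof (rule functionals_separate_vectors[of _ m])
          fix \<gamma> assume "\<gamma> \<in> carrier ?D"
          from \<Theta>(1)[OF xy this] \<Theta>(3)[OF xy this] show "\<gamma> (b (X *\<^sub>v x) y) = \<gamma> (Z *\<^sub>v b x y)" by simp
        qed (use xy X(1) Z(1) b_closed in auto)
        show "b x (Y *\<^sub>v y) = Z *\<^sub>v b x y"
        proof (rule functionals_separate_vectors[of _ m])
          fix \<gamma> assume "\<gamma> \<in> carrier ?D"
          from \<Theta>(2)[OF xy this] \<Theta>(3)[OF xy this] show "\<gamma> (b x (Y *\<^sub>v y)) = \<gamma> (Z *\<^sub>v b x y)" by simp
        qed (use xy Y(1) Z(1) b_closed in auto)
      qed
      moreover have "\<Theta> = \<Omega> X"
      proof (rule tensor_eqI_coord[OF _ \<Omega>_mem[OF X(1)]])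
        show "\<Theta> \<in> carrier ?S" using \<Theta>_int I(3) by blast
        fix x y :: "complex vec" and \<gamma>
        assume xy: "x \<in> carrier_vec m" "y \<in> carrier_vec m" and \<gamma>: "\<gamma> \<in> carrier ?D"
        show "\<Theta> (\<xi> x, \<xi> y, \<gamma>) = \<Omega> X (\<xi> x, \<xi> y, \<gamma>)"
          using \<Theta>(1)[OF xy \<gamma>] \<Omega>_eq[OF X(1) xy \<gamma>] by simp
      qed
      ultimately show "\<Theta> \<in> \<Omega> ` carrier product_algebra" using product_algebra_memI by blast
    qed
  qed
  then have "vectorspace.dim CC ?I \<le> vectorspace.dim CC product_algebra"
    by (rule surjective_linear_dim_le[OF algebra_vectorspace[OF algebra_product_algebra] I(1) lin _ fd])
  then show "m \<le> vectorspace.dim CC product_algebra"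
    using assms by (simp add: abundant111_def)
qed

text \<open>
  The modules on the first two factors are \<open>U\<^sup>*\<close> and \<open>V\<^sup>*\<close>, both identified with \<open>\<complex>\<^sup>m\<close>; therefore \<open>\<xi>\<close> is
  the isomorphism from \<open>U\<close> and \<open>V\<close> to the duals of these modules.  On the third factor it is the identity.
\<close>

lemma isomorphic_to_tensor_of_hom:
  assumes \<phi>: "\<And>x y. \<lbrakk>x \<in> carrier_vec m; y \<in> carrier_vec m\<rbrakk> \<Longrightarrow>
      \<phi> (pure_tensor product_algebra (matrix_module (\<lambda>X. X)) (matrix_module second) x y) = b x y"
  shows "isomorphic_tensors (Cvec m) (Cvec m) (Cvec m) T
    (restricted_dual product_algebra (matrix_module (\<lambda>X. X))) (restricted_dual product_algebra (matrix_module second))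
    (restrict_scalars product_algebra (matrix_module third))
    (tensor_of_hom product_algebra (matrix_module (\<lambda>X. X)) (matrix_module second) (matrix_module third) \<phi>)"
proof -
  let ?C = "Cvec m" and ?D = "dual_space (Cvec m)"
  let ?U = "restrict_scalars product_algebra (matrix_module (\<lambda>X. X))"
    and ?V = "restrict_scalars product_algebra (matrix_module second)"
    and ?W = "restrict_scalars product_algebra (matrix_module third)"
  note dual = representations[THEN restricted_dual_matrix_module]
  note vs = representations[THEN matrix_module_module, THEN vectorspace_restrict_scalars[OF algebra_product_algebra]]
  have fd: "vectorspace.fin_dim CC ?U" "vectorspace.fin_dim CC ?V"
    using representations[THEN has_dim_matrix_module] by (simp_all add: has_dim_def)
  note D = vectorspace_dual_space[OF vectorspace_Cvec[of m]]
  have ident: "(\<lambda>x. x) \<in> linear_maps ?C ?W"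
    using restricted_smult[OF representations(3)]
    by (intro linear_mapsI) (auto simp del: restrict_scalars_simps(4))
  let ?t = "tensor_pullback ?D ?D ?W (\<lambda>\<Phi>. compose (carrier ?C) \<Phi> \<xi>) (\<lambda>\<Psi>. compose (carrier ?C) \<Psi> \<xi>)
    (\<lambda>\<gamma>. compose (carrier ?C) \<gamma> (\<lambda>x. x)) T"
  have "tensor_of_bilinear ?U ?V ?W
      (\<lambda>x y. \<phi> (pure_tensor product_algebra (matrix_module (\<lambda>X. X)) (matrix_module second) x y)) = ?t"
  proof (rule tensor_of_bilinear_eqI[OF vs(1) fd(1) vs(2) fd(2)])
    show "?t \<in> carrier (tensor_space (dual_space ?U) (dual_space ?V) ?W)"
      unfolding dual
      by (intro tensor_pullback_mem[OF D D vs(3) _ _ _ T] transpose_linear coord_functional_linear vectorspace_Cvec ident)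
    fix x y \<gamma> assume x: "x \<in> carrier ?U" and y: "y \<in> carrier ?V" and \<gamma>: "\<gamma> \<in> carrier (dual_space ?W)"
    have ev: "compose (carrier ?C) (evaluation R z) \<xi> = \<xi> z"
      if "z \<in> carrier_vec m" "dual_space R = ?D" for R and z
      using that coord_functional_mem[of _ m] comm_scalar_prod[of _ m z]
      by (auto simp: compose_def evaluation_def coord_functional_def[of m z] intro!: restrict_ext)
    have "compose (carrier ?C) \<gamma> (\<lambda>x. x) = \<gamma>"
      using dual_memD(1)[of \<gamma> ?C] \<gamma> dual(3) by (auto simp: compose_def extensional_restrict)
    moreover have "evaluation ?U x \<in> carrier (dual_space ?D)" "evaluation ?V y \<in> carrier (dual_space ?D)"
      using evaluation_in_bidual[OF vs(1) x] evaluation_in_bidual[OF vs(2) y] dual by simp_all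
    ultimately show "?t (evaluation ?U x, evaluation ?V y, \<gamma>) =
        \<gamma> (\<phi> (pure_tensor product_algebra (matrix_module (\<lambda>X. X)) (matrix_module second) x y))"
      using x y \<gamma> ev dual by (simp add: tensor_pullback_apply T_eq \<phi>)
  qed
  moreover have "linear_iso ?C ?D \<xi>"
    using coord_functional_linear coord_functional_bij by (simp add: linear_iso_def)
  moreover have "linear_iso ?C ?W (\<lambda>x. x)"
    using ident by (simp add: linear_iso_def bij_betw_def)
  ultimately show ?thesis
    unfolding isomorphic_tensors_def tensor_of_hom_def dual tensor_pullback_def by blast
qed

end

section \<open>Abundant tensors and module homomorphisms\<close>

theorem theorem5p5:
  fixes m :: nat
  shows
    "(\<forall>T \<in> carrier (tensor_space (Cvec m) (Cvec m) (Cvec m)).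
        concise (Cvec m) (Cvec m) (Cvec m) T \<and> abundant111 m (Cvec m) (Cvec m) (Cvec m) T \<longrightarrow>
        (\<exists>(A :: (complex, complex mat) module)
          (N1 :: (complex mat, complex vec) module)
          (N2 :: (complex mat, complex vec) module)
          (N3 :: (complex mat, complex vec) module) \<phi>.
            nondegenerate_surjection m A N1 N2 N3 \<phi> \<and> acts_faithfully A N1 N2 N3 \<and>
            isomorphic_tensors (Cvec m) (Cvec m) (Cvec m) T
              (restricted_dual A N1) (restricted_dual A N2) (restrict_scalars A N3)
              (tensor_of_hom A N1 N2 N3 \<phi>))) \<and>
     (\<forall>(A :: (complex, 'a) module) (N1 :: ('a, 'n1) module) (N2 :: ('a, 'n2) module)
        (N3 :: ('a, 'n3) module) \<phi>.
        nondegenerate_surjection m A N1 N2 N3 \<phi> \<longrightarrow>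
          concise (restricted_dual A N1) (restricted_dual A N2) (restrict_scalars A N3)
            (tensor_of_hom A N1 N2 N3 \<phi>) \<and>
          (acts_faithfully A N1 N2 N3 \<longrightarrow>
            abundant111 m (restricted_dual A N1) (restricted_dual A N2) (restrict_scalars A N3)
              (tensor_of_hom A N1 N2 N3 \<phi>)))"
proof (intro conjI ballI allI impI; (elim conjE)?)
  fix T assume T: "T \<in> carrier (tensor_space (Cvec m) (Cvec m) (Cvec m))"
    and concise: "concise (Cvec m) (Cvec m) (Cvec m) T"
    and abundant: "abundant111 m (Cvec m) (Cvec m) (Cvec m) T"
  interpret concise_tensor m T by (rule concise_tensor.intro[OF T concise])
  from dim_at_least_product_algebra[OF abundant] show
    "\<exists>(A :: (complex, complex mat) module) (N1 :: (complex mat, complex vec) module)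
       (N2 :: (complex mat, complex vec) module) (N3 :: (complex mat, complex vec) module) \<phi>.
       nondegenerate_surjection m A N1 N2 N3 \<phi> \<and> acts_faithfully A N1 N2 N3 \<and>
       isomorphic_tensors (Cvec m) (Cvec m) (Cvec m) T
         (restricted_dual A N1) (restricted_dual A N2) (restrict_scalars A N3)
         (tensor_of_hom A N1 N2 N3 \<phi>)"
    by (rule induced_surjection) (use isomorphic_to_tensor_of_hom in blast)
next
  fix A :: "(complex, 'a) module" and N1 :: "('a, 'n1) module" and N2 :: "('a, 'n2) module"
    and N3 :: "('a, 'n3) module" and \<phi>
  assume "nondegenerate_surjection m A N1 N2 N3 \<phi>"
  then interpret nondegenerate_pairing m A N1 N2 N3 \<phi> by (rule nondegenerate_pairing.intro)
  show "concise (restricted_dual A N1) (restricted_dual A N2) (restrict_scalars A N3)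
      (tensor_of_hom A N1 N2 N3 \<phi>)"
    by (rule concise_T)
  show "abundant111 m (restricted_dual A N1) (restricted_dual A N2) (restrict_scalars A N3)
      (tensor_of_hom A N1 N2 N3 \<phi>)" if "acts_faithfully A N1 N2 N3"
    using that by (rule abundant_T)
qed

end
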